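(* Let $\mathfrak m\subset\mathcal H_{\mathbb R}$ be a closed subspace which is a Lie triple system, and let $M=\exp(\mathfrak m)\subset\Sigma$ with the induced topology and Riemannian metric. Then $M$ is a closed geodesically convex submanifold of $\Sigma$.
   Context: Let $H$ be a complex, infinite dimensional, separable Hilbert space, $\mathsf{HS}\subset B(H)$ the ideal of Hilbert-Schmidt operators, and $\mathcal H_{\mathbb R}=\{a+\lambda: a=a^*\in\mathsf{HS},\lambda\in\mathbb R\}$, a real Hilbert space with inner product $\langle a+\lambda,b+\beta\rangle_2=4\,\mathrm{tr}(ab^* )+\lambda\beta$. $\Sigma$ is the set of positive invertible operators in $\mathcal H_{\mathbb R}$, open in $\mathcal H_{\mathbb R}$, with $T_p\Sigma=\mathcal H_{\mathbb R}$ and Riemannian metric given by $\|x\|_p=\|p^{-1/2}xp^{-1/2}\|_2$. The unique geodesic joining $p,q\in\Sigma$ is $\gamma_{pq}(t)=p^{1/2}(p^{-1/2}qp^{-1/2})^tp^{1/2}$; $M\subset\Sigma$ is geodesically convex if $\gamma_{pq}([0,1])\subset M$ for all $p,q\in M$. $\mathfrak m$ is a Lie triple system if $[[a,b],c]\in\mathfrak m$ for all $a,b,c\in\mathfrak m$, where $[x,y]=xy-yx$. *)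

theory Defs
  imports "HOL-Analysis.Analysis"
begin

section \<open>Separable infinite dimensional complex Hilbert spaces\<close>

text \<open>The library only has real inner product spaces. A complex Hilbert space is presented here as
  a complete one of these, carrying a complex scalar multiplication and a sesquilinear form (linear
  in the first argument) that extend the real structure. Positivity of \<open>cinner\<close> is inherited from
  that of its real part.\<close>

class complex_hilbert_space = real_inner + complete_space +
  fixes scaleC :: "complex \<Rightarrow> 'a \<Rightarrow> 'a" (infixr \<open>*\<^sub>C\<close> 75)
    and cinner :: "'a \<Rightarrow> 'a \<Rightarrow> complex"
  assumes scaleC_add_right: "c *\<^sub>C (x + y) = c *\<^sub>C x + c *\<^sub>C y"
    and scaleC_add_left: "(c + d) *\<^sub>C x = c *\<^sub>C x + d *\<^sub>C x"
    and scaleC_scaleC: "c *\<^sub>C d *\<^sub>C x = (c * d) *\<^sub>C x"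
    and scaleC_of_real: "complex_of_real r *\<^sub>C x = r *\<^sub>R x"
    and cinner_commute: "cinner x y = cnj (cinner y x)"
    and cinner_add_left: "cinner (x + y) z = cinner x z + cinner y z"
    and cinner_scaleC_left: "cinner (c *\<^sub>C x) y = c * cinner x y"
    and inner_eq_Re_cinner: "inner x y = Re (cinner x y)"

class separable_hilbert_space = complex_hilbert_space +
  assumes infinite_dimensional: "finite B \<Longrightarrow> \<exists>x. \<forall>c. x \<noteq> (\<Sum>b\<in>B. c b *\<^sub>C b)"
    and separable: "\<exists>D. countable D \<and> (\<forall>U. open U \<longrightarrow> U \<noteq> {} \<longrightarrow> (\<exists>d\<in>D. d \<in> U))"

instance complex_hilbert_space \<subseteq> banach ..

lemma module_scaleC: "module (scaleC :: complex \<Rightarrow> 'a \<Rightarrow> 'a::complex_hilbert_space)"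
proof
  fix c d :: complex and x y :: 'a
  show "1 *\<^sub>C x = x" using scaleC_of_real[of 1 x] by simp
qed (simp_all add: scaleC_add_right scaleC_add_left scaleC_scaleC)

interpretation complex_module: module "scaleC :: complex \<Rightarrow> 'a \<Rightarrow> 'a::complex_hilbert_space"
  by (rule module_scaleC)

abbreviation cspan :: "'a::complex_hilbert_space set \<Rightarrow> 'a set"
  where "cspan \<equiv> module.span scaleC"

lemma ex_nonzero_vector: "\<exists>x::'a::separable_hilbert_space. x \<noteq> 0"
  using infinite_dimensional[where 'a='a, of "{}"] by auto

lemma scaleC_scaleR: "c *\<^sub>C r *\<^sub>R x = r *\<^sub>R c *\<^sub>C x"
  for x :: "'a::complex_hilbert_space"
  by (simp flip: scaleC_of_real add: scaleC_scaleC mult.commute)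

lemma cinner_add_right: "cinner z (x + y) = cinner z x + cinner z y"
  by (subst (1 2 3) cinner_commute) (simp add: cinner_add_left)

lemma cinner_scaleC_right: "cinner y (c *\<^sub>C x) = cnj c * cinner y x"
  by (subst (1 2) cinner_commute) (simp add: cinner_scaleC_left)

lemma cinner_Im: "Im (cinner x y) = inner x (\<i> *\<^sub>C y)"
proof -
  have "cinner x (\<i> *\<^sub>C y) = cnj \<i> * cinner x y"
    by (rule cinner_scaleC_right)
  then show ?thesis by (simp add: inner_eq_Re_cinner)
qed

lemma cinner_self: "cinner x x = complex_of_real ((norm x)\<^sup>2)"
proof -
  have "Im (cinner x x) = 0"
    using arg_cong[OF cinner_commute[of x x], of Im] by simp
  then show ?thesis
    by (simp add: complex_eq_iff power2_norm_eq_inner inner_eq_Re_cinner)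
qed

lemma norm_scaleC: "norm (c *\<^sub>C x) = cmod c * norm x" for x :: "'a::complex_hilbert_space"
proof -
  have "complex_of_real ((norm (c *\<^sub>C x))\<^sup>2) = (c * cnj c) * cinner x x"
    unfolding cinner_self[symmetric] by (simp add: cinner_scaleC_right cinner_scaleC_left)
  also have "\<dots> = complex_of_real ((cmod c * norm x)\<^sup>2)"
    by (simp add: cinner_self power_mult_distrib flip: complex_norm_square)
  finally have "(norm (c *\<^sub>C x))\<^sup>2 = (cmod c * norm x)\<^sup>2" by (simp only: of_real_eq_iff)
  then show ?thesis by simp
qed

lemma bounded_linear_scaleC: "bounded_linear (\<lambda>x::'a::complex_hilbert_space. c *\<^sub>C x)"
  by (rule bounded_linear_intro[where K="cmod c"])
     (simp_all add: scaleC_add_right scaleC_scaleR norm_scaleC mult.commute)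

lemma bounded_linear_cinner_left: "bounded_linear (\<lambda>x. cinner x y)"
proof -
  have eq: "cinner x y = Complex (inner x y) (inner x (\<i> *\<^sub>C y))" for x
    by (simp add: complex_eq_iff cinner_Im inner_eq_Re_cinner[symmetric])
  have eq2: "(\<lambda>x. cinner x y)
      = (\<lambda>x. complex_of_real (inner x y) + \<i> * complex_of_real (inner x (\<i> *\<^sub>C y)))"
    by (rule ext) (simp add: eq complex_eq_iff)
  show ?thesis unfolding eq2
    by (intro bounded_linear_add bounded_linear_compose[OF bounded_linear_of_real]
        bounded_linear_inner_left bounded_linear_compose[OF bounded_linear_mult_right])
qed


subsection \<open>Orthonormal bases\<close>

definition orthonormal :: "'a::complex_hilbert_space set \<Rightarrow> bool"
  where "orthonormal B \<longleftrightarrow> (\<forall>e\<in>B. \<forall>f\<in>B. cinner e f = (if e = f then 1 else 0))"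

definition is_onb :: "'a::complex_hilbert_space set \<Rightarrow> bool"
  where "is_onb B \<longleftrightarrow> orthonormal B \<and> closure (cspan B) = UNIV"

lemma cspan_scaleR: "x \<in> cspan B \<Longrightarrow> r *\<^sub>R x \<in> cspan B"
  by (metis complex_module.span_scale scaleC_of_real)

lemma orthogonal_complement_nonzero:
  fixes S :: "'a::complex_hilbert_space set"
  assumes cl: "closed S" and x: "x \<notin> S" and z: "0 \<in> S"
    and add: "\<And>u v. u \<in> S \<Longrightarrow> v \<in> S \<Longrightarrow> u + v \<in> S"
    and sc: "\<And>r u. u \<in> S \<Longrightarrow> r *\<^sub>R u \<in> S"
  shows "\<exists>z. z \<noteq> 0 \<and> (\<forall>v\<in>S. inner z v = 0)"
proof -
  have ne: "S \<noteq> {}" using z by auto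
  define d where "d = infdist x S"
  have d0: "0 \<le> d" by (simp add: d_def infdist_nonneg)
  have dle: "d \<le> norm (x - u)" if "u \<in> S" for u
    using infdist_le[OF that, of x] by (simp add: d_def dist_norm)
  have ex: "\<exists>u\<in>S. norm (x - u) < d + inverse (Suc n)" for n :: nat
  proof (rule ccontr)
    assume "\<not> ?thesis"
    then have "d + inverse (Suc n) \<le> infdist x S"
      using ne by (auto simp: infdist_notempty dist_norm not_less intro!: cINF_greatest)
    then show False by (simp add: d_def)
  qed
  then obtain u where uS: "\<And>n. u n \<in> S" and u: "\<And>n. norm (x - u n) < d + inverse (Suc n)"
    by metis
  have lim: "(\<lambda>n. norm (x - u n)) \<longlonglongrightarrow> d"
  proof (rule tendsto_sandwich[where f="\<lambda>_. d" and h="\<lambda>n. d + inverse (Suc n)"])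
    show "(\<lambda>n. d + inverse (real (Suc n))) \<longlonglongrightarrow> d"
      using tendsto_add[OF tendsto_const LIMSEQ_inverse_real_of_nat, of d] by simp
  qed (use dle uS u in \<open>auto intro!: always_eventually less_imp_le\<close>)
  have par: "(norm (u m - u n))\<^sup>2 \<le> 2 * (norm (x - u m))\<^sup>2 + 2 * (norm (x - u n))\<^sup>2 - 4 * d\<^sup>2" for m n
  proof -
    have "(1/2) *\<^sub>R (u m + u n) \<in> S" by (intro sc add uS)
    from power_mono[OF dle[OF this] d0, of 2]
    have "d\<^sup>2 \<le> (norm (x - (1/2) *\<^sub>R (u m + u n)))\<^sup>2" .
    moreover have "(norm (u m - u n))\<^sup>2 = 2 * (norm (x - u m))\<^sup>2 + 2 * (norm (x - u n))\<^sup>2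
        - 4 * (norm (x - (1/2) *\<^sub>R (u m + u n)))\<^sup>2"
      unfolding power2_norm_eq_inner by (simp add: algebra_simps inner_commute)
    ultimately show ?thesis by simp
  qed
  have "Cauchy u"
  proof (rule CauchyI)
    fix e :: real assume e: "0 < e"
    have "(\<lambda>n. (norm (x - u n))\<^sup>2) \<longlonglongrightarrow> d\<^sup>2" by (intro tendsto_power lim)
    from order_tendstoD(2)[OF this, of "d\<^sup>2 + e\<^sup>2 / 4"] e
    obtain M where M: "\<And>n. n \<ge> M \<Longrightarrow> (norm (x - u n))\<^sup>2 < d\<^sup>2 + e\<^sup>2 / 4"
      by (auto simp: eventually_sequentially)
    have "norm (u m - u n) < e" if "m \<ge> M" "n \<ge> M" for m n
      using par[of m n] M[OF that(1)] M[OF that(2)] e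
      by (intro power2_less_imp_less[of _ e]) auto
    then show "\<exists>M. \<forall>m\<ge>M. \<forall>n\<ge>M. norm (u m - u n) < e" by blast
  qed
  then obtain p where p: "u \<longlonglongrightarrow> p" using Cauchy_convergent convergent_def by blast
  have pS: "p \<in> S" using closed_sequentially[OF cl _ p] uS by blast
  have nd: "norm (x - p) = d"
    using LIMSEQ_unique[OF tendsto_norm[OF tendsto_diff[OF tendsto_const p]] lim] .
  show ?thesis
  proof (intro exI conjI ballI)
    show "x - p \<noteq> 0" using pS x by auto
    fix v assume v: "v \<in> S"
    show "inner (x - p) v = 0"
    proof (cases "v = 0")
      case False
      define t where "t = inner (x - p) v / inner v v"
      have "p + t *\<^sub>R v \<in> S" by (intro add sc pS v)
      from power_mono[OF dle[OF this] d0, of 2]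
      have "inner (x - p) (x - p) \<le> inner (x - p - t *\<^sub>R v) (x - p - t *\<^sub>R v)"
        unfolding nd[symmetric] power2_norm_eq_inner by (simp add: algebra_simps)
      also have "\<dots> = inner (x - p) (x - p) - 2 * t * inner (x - p) v + t * t * inner v v"
        by (simp add: inner_diff_left inner_diff_right inner_commute)
      also have "\<dots> = inner (x - p) (x - p) - (inner (x - p) v)\<^sup>2 / inner v v"
        using False by (simp add: t_def field_simps power2_eq_square)
      finally have "(inner (x - p) v)\<^sup>2 / inner v v \<le> 0" by simp
      moreover have "inner v v > 0" using False by simp
      ultimately show ?thesis by (simp add: divide_le_0_iff)
    qed simp
  qed
qed

lemma ex_onb: "\<exists>B :: 'a::complex_hilbert_space set. is_onb B"
proof -
  have "\<exists>M\<in>{B :: 'a set. orthonormal B}. \<forall>X\<in>{B. orthonormal B}. M \<subseteq> X \<longrightarrow> X = M"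
  proof (rule subset_Zorn')
    fix C :: "'a set set" assume C: "subset.chain {B. orthonormal B} C"
    show "\<Union>C \<in> {B. orthonormal B}"
    proof (simp add: orthonormal_def, intro ballI)
      fix X Y e f assume X: "X \<in> C" "e \<in> X" and Y: "Y \<in> C" "f \<in> Y"
      from C X Y have "X \<subseteq> Y \<or> Y \<subseteq> X" by (auto simp: subset.chain_def subset_chain_def)
      then obtain Z where "Z \<in> C" "e \<in> Z" "f \<in> Z" using X Y by blast
      moreover have "orthonormal Z" using C \<open>Z \<in> C\<close> by (auto simp: subset.chain_def)
      ultimately show "(e = f \<longrightarrow> cinner f f = 1) \<and> (e \<noteq> f \<longrightarrow> cinner e f = 0)"
        by (simp add: orthonormal_def)
    qed
  qed
  then obtain B :: "'a set" where on: "orthonormal B"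
    and max: "\<And>X. orthonormal X \<Longrightarrow> B \<subseteq> X \<Longrightarrow> X = B" by auto
  have "closure (cspan B) = UNIV"
  proof (rule ccontr)
    assume "closure (cspan B) \<noteq> UNIV"
    then obtain x where x: "x \<notin> closure (cspan B)" by auto
    have sub: "subspace (cspan B)"
      by (auto simp: subspace_def complex_module.span_zero complex_module.span_add cspan_scaleR)
    have sub': "subspace (closure (cspan B))"
    proof (rule subspaceI)
      show "0 \<in> closure (cspan B)"
        using subspace_0[OF sub] closure_subset by blast
      fix u v and r :: real assume u: "u \<in> closure (cspan B)" and v: "v \<in> closure (cspan B)"
      then obtain f g where f: "\<And>n. f n \<in> cspan B" "f \<longlonglongrightarrow> u"
        and g: "\<And>n. g n \<in> cspan B" "g \<longlonglongrightarrow> v"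
        by (auto simp: closure_sequential)
      show "u + v \<in> closure (cspan B)"
        unfolding closure_sequential using tendsto_add[OF f(2) g(2)] subspace_add[OF sub f(1) g(1)]
        by (intro exI[of _ "\<lambda>n. f n + g n"]) auto
      show "r *\<^sub>R u \<in> closure (cspan B)"
        unfolding closure_sequential
        using tendsto_scaleR[OF tendsto_const f(2), of r] subspace_scale[OF sub f(1)]
        by (intro exI[of _ "\<lambda>n. r *\<^sub>R f n"]) auto
    qed
    obtain z where z0: "z \<noteq> 0" and zS: "\<And>v. v \<in> closure (cspan B) \<Longrightarrow> inner z v = 0"
      using orthogonal_complement_nonzero[OF closed_closure x]
        subspace_0[OF sub'] subspace_add[OF sub'] subspace_scale[OF sub'] by metis
    have zB: "cinner z e = 0" if e: "e \<in> B" for e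
    proof -
      have "e \<in> cspan B" "\<i> *\<^sub>C e \<in> cspan B"
        using e by (auto intro: complex_module.span_base complex_module.span_scale)
      then have "inner z e = 0" "inner z (\<i> *\<^sub>C e) = 0"
        using zS closure_subset by blast+
      then show ?thesis by (simp add: complex_eq_iff cinner_Im inner_eq_Re_cinner[symmetric])
    qed
    define w where "w = (1 / norm z) *\<^sub>R z"
    have wB: "cinner w e = 0" if "e \<in> B" for e
      using zB[OF that] unfolding w_def scaleC_of_real[symmetric] by (simp add: cinner_scaleC_left)
    have ww: "cinner w w = 1" using z0 by (simp add: cinner_self w_def)
    have Bw: "cinner e w = 0" if "e \<in> B" for e
      using wB[OF that] cinner_commute[of e w] by simp
    have "orthonormal (insert w B)"
      using on wB ww Bw unfolding orthonormal_def by auto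
    then have "w \<in> B" using max[of "insert w B"] by auto
    then show False using wB ww by auto
  qed
  then show ?thesis using on by (auto simp: is_onb_def)
qed

text \<open>Neither the Hilbert-Schmidt class nor the trace depends on the basis used to define them.\<close>

definition onb :: "'a::complex_hilbert_space set"
  where "onb = (SOME B. is_onb B)"

lemma is_onb_onb: "is_onb onb"
  unfolding onb_def by (rule someI_ex) (rule ex_onb)


section \<open>Bounded operators\<close>

typedef (overloaded) 'a cop =
    "{T :: 'a::separable_hilbert_space \<Rightarrow>\<^sub>L 'a. \<forall>c x. blinfun_apply T (c *\<^sub>C x) = c *\<^sub>C blinfun_apply T x}"
  by (rule exI[of _ 0]) (simp add: complex_module.scale_zero_right)

setup_lifting type_definition_cop

lift_definition cop_apply :: "'a::separable_hilbert_space cop \<Rightarrow> 'a \<Rightarrow> 'a" is blinfun_apply .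

lemma cop_eqI: "(\<And>x. cop_apply S x = cop_apply T x) \<Longrightarrow> S = T"
  by transfer (rule blinfun_eqI)

instantiation cop :: (separable_hilbert_space) real_normed_vector
begin

lift_definition norm_cop :: "'a cop \<Rightarrow> real" is norm .

lift_definition minus_cop :: "'a cop \<Rightarrow> 'a cop \<Rightarrow> 'a cop" is minus
  by (simp add: blinfun.diff_left complex_module.scale_right_diff_distrib)

lift_definition uminus_cop :: "'a cop \<Rightarrow> 'a cop" is uminus
  by (simp add: blinfun.minus_left complex_module.scale_minus_right)

lift_definition zero_cop :: "'a cop" is 0
  by (simp add: complex_module.scale_zero_right)

lift_definition plus_cop :: "'a cop \<Rightarrow> 'a cop \<Rightarrow> 'a cop" is plus
  by (simp add: blinfun.add_left scaleC_add_right)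

lift_definition scaleR_cop :: "real \<Rightarrow> 'a cop \<Rightarrow> 'a cop" is scaleR
  by (simp add: blinfun.scaleR_left scaleC_scaleR)

definition dist_cop :: "'a cop \<Rightarrow> 'a cop \<Rightarrow> real"
  where "dist_cop S T = norm (S - T)"

definition uniformity_cop :: "('a cop \<times> 'a cop) filter"
  where "uniformity_cop = (INF e\<in>{0 <..}. principal {(x, y). dist x y < e})"

definition open_cop :: "'a cop set \<Rightarrow> bool"
  where "open_cop S = (\<forall>x\<in>S. \<forall>\<^sub>F (x', y) in uniformity. x' = x \<longrightarrow> y \<in> S)"

definition sgn_cop :: "'a cop \<Rightarrow> 'a cop"
  where "sgn_cop x = scaleR (inverse (norm x)) x"

instance
proof
  fix x y z :: "'a cop" and a b :: real and U :: "'a cop set"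
  show "dist x y = norm (x - y)" by (rule dist_cop_def)
  show "open U \<longleftrightarrow> (\<forall>x\<in>U. \<forall>\<^sub>F (x', y) in uniformity. x' = x \<longrightarrow> y \<in> U)" by (rule open_cop_def)
  show "sgn x = inverse (norm x) *\<^sub>R x" by (rule sgn_cop_def)
  show "uniformity = (INF e\<in>{0 <..}. principal {(x, y :: 'a cop). dist x y < e})"
    by (rule uniformity_cop_def)
  show "norm (x + y) \<le> norm x + norm y" by transfer (rule norm_triangle_ineq)
  show "norm x = 0 \<longleftrightarrow> x = 0" by transfer simp
  show "norm (a *\<^sub>R x) = \<bar>a\<bar> * norm x" by transfer simp
  show "x - y = x + - y" by transfer simp
  show "x + y + z = x + (y + z)" by transfer simp
  show "x + y = y + x" by transfer simp
  show "0 + x = x" by transfer simp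
  show "- x + x = 0" by transfer simp
  show "a *\<^sub>R (x + y) = a *\<^sub>R x + a *\<^sub>R y" by transfer (rule scaleR_add_right)
  show "(a + b) *\<^sub>R x = a *\<^sub>R x + b *\<^sub>R x" by transfer (rule scaleR_add_left)
  show "a *\<^sub>R b *\<^sub>R x = (a * b) *\<^sub>R x" by transfer simp
  show "1 *\<^sub>R x = x" by transfer simp
qed

end

lemma norm_cop_apply: "norm (cop_apply T x) \<le> norm T * norm x"
  by transfer (rule norm_blinfun)

lemma cop_apply_scaleC: "cop_apply T (c *\<^sub>C x) = c *\<^sub>C cop_apply T x"
  by transfer simp

lemma bounded_bilinear_cop_apply: "bounded_bilinear cop_apply"
proof
  fix S T :: "'a cop" and x y :: 'a and r :: real
  show "cop_apply (S + T) x = cop_apply S x + cop_apply T x" by transfer (simp add: blinfun.add_left)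
  show "cop_apply T (x + y) = cop_apply T x + cop_apply T y" by transfer (simp add: blinfun.add_right)
  show "cop_apply (r *\<^sub>R T) x = r *\<^sub>R cop_apply T x" by transfer (simp add: blinfun.scaleR_left)
  show "cop_apply T (r *\<^sub>R x) = r *\<^sub>R cop_apply T x" by transfer (simp add: blinfun.scaleR_right)
  show "\<exists>K. \<forall>T x. norm (cop_apply T x :: 'a) \<le> norm T * norm x * K"
    by (auto intro!: exI[of _ 1] norm_cop_apply)
qed

interpretation cop: bounded_bilinear cop_apply
  by (rule bounded_bilinear_cop_apply)

instance cop :: (separable_hilbert_space) banach
proof
  fix X :: "nat \<Rightarrow> 'a cop"
  assume X: "Cauchy X"
  have dist: "dist (Rep_cop S) (Rep_cop T) = dist S T" for S T :: "'a cop"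
    unfolding dist_norm norm_cop.rep_eq minus_cop.rep_eq ..
  have "Cauchy (\<lambda>n. Rep_cop (X n))"
    using X unfolding Cauchy_def dist .
  from Cauchy_convergent[OF this] obtain L where L: "(\<lambda>n. Rep_cop (X n)) \<longlonglongrightarrow> L"
    unfolding convergent_def by (rule exE)
  have lim: "(\<lambda>n. blinfun_apply (Rep_cop (X n)) x) \<longlonglongrightarrow> blinfun_apply L x" for x
    by (rule blinfun.tendsto[OF L tendsto_const])
  have "blinfun_apply L (c *\<^sub>C x) = c *\<^sub>C blinfun_apply L x" for c x
  proof (rule LIMSEQ_unique[OF lim])
    show "(\<lambda>n. blinfun_apply (Rep_cop (X n)) (c *\<^sub>C x)) \<longlonglongrightarrow> c *\<^sub>C blinfun_apply L x"
      using bounded_linear.tendsto[OF bounded_linear_scaleC lim, of c x] Rep_cop[of "X _"] by simp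
  qed
  then have R: "Rep_cop (Abs_cop L) = L" by (simp add: Abs_cop_inverse)
  have "X \<longlonglongrightarrow> Abs_cop L"
    using L unfolding tendsto_iff dist[symmetric] R .
  then show "convergent X" by (auto simp: convergent_def)
qed

instantiation cop :: (separable_hilbert_space) real_normed_algebra_1
begin

lift_definition one_cop :: "'a cop" is id_blinfun by simp

lift_definition times_cop :: "'a cop \<Rightarrow> 'a cop \<Rightarrow> 'a cop" is blinfun_compose by simp

instance
proof
  fix x y z :: "'a cop" and a :: real
  show "x * y * z = x * (y * z)" by transfer (auto intro!: blinfun_eqI)
  show "(x + y) * z = x * z + y * z"
    by transfer (auto intro!: blinfun_eqI simp: blinfun.bilinear_simps)
  show "x * (y + z) = x * y + x * z"
    by transfer (auto intro!: blinfun_eqI simp: blinfun.bilinear_simps)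
  show "a *\<^sub>R x * y = a *\<^sub>R (x * y)"
    by transfer (auto intro!: blinfun_eqI simp: blinfun.bilinear_simps)
  show "x * a *\<^sub>R y = a *\<^sub>R (x * y)"
    by transfer (auto intro!: blinfun_eqI simp: blinfun.bilinear_simps)
  show "1 * x = x" by transfer (auto intro!: blinfun_eqI)
  show "x * 1 = x" by transfer (auto intro!: blinfun_eqI)
  show "norm (x * y) \<le> norm x * norm y" by transfer (rule norm_blinfun_compose)
  show n1: "norm (1 :: 'a cop) = 1"
  proof -
    obtain v :: 'a where "v \<noteq> 0" using ex_nonzero_vector by blast
    then show ?thesis
      unfolding norm_cop.rep_eq one_cop.rep_eq by (intro norm_blinfun_eqI[where x=v]) auto
  qed
  show "(0 :: 'a cop) \<noteq> 1"
  proof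
    assume "(0 :: 'a cop) = 1"
    then have "norm (0 :: 'a cop) = norm (1 :: 'a cop)" by simp
    then show False using n1 by simp
  qed
qed

end

lemma cop_apply_times: "cop_apply (S * T) x = cop_apply S (cop_apply T x)"
  by transfer simp

lemma cop_apply_one: "cop_apply 1 x = x"
  by transfer simp

text \<open>\<open>THE\<close> is justified by the Riesz representation theorem.\<close>

definition adj :: "'a::separable_hilbert_space cop \<Rightarrow> 'a cop"
  where "adj T = (THE S. \<forall>x y. cinner (cop_apply T x) y = cinner x (cop_apply S y))"

definition selfadjoint :: "'a::separable_hilbert_space cop \<Rightarrow> bool"
  where "selfadjoint T \<longleftrightarrow> (\<forall>x y. cinner (cop_apply T x) y = cinner x (cop_apply T y))"

definition positive_cop :: "'a::separable_hilbert_space cop \<Rightarrow> bool"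
  where "positive_cop T \<longleftrightarrow> (\<forall>x. \<exists>r\<ge>0. cinner (cop_apply T x) x = complex_of_real r)"

definition invertible_cop :: "'a::separable_hilbert_space cop \<Rightarrow> bool"
  where "invertible_cop T \<longleftrightarrow> (\<exists>S. S * T = 1 \<and> T * S = 1)"

definition hilbert_schmidt :: "'a::separable_hilbert_space cop \<Rightarrow> bool"
  where "hilbert_schmidt T \<longleftrightarrow> (\<lambda>e. (norm (cop_apply T e))\<^sup>2) summable_on onb"

definition trace_cop :: "'a::separable_hilbert_space cop \<Rightarrow> complex"
  where "trace_cop T = (\<Sum>\<^sub>\<infinity>e\<in>onb. cinner (cop_apply T e) e)"

definition commutator :: "'a::separable_hilbert_space cop \<Rightarrow> 'a cop \<Rightarrow> 'a cop"
  where "commutator x y = x * y - y * x"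

text \<open>Real powers of a positive invertible operator, by functional calculus: the logarithm of such an
  operator is its unique selfadjoint logarithm.\<close>

definition cop_ln :: "'a::separable_hilbert_space cop \<Rightarrow> 'a cop"
  where "cop_ln T = (THE x. selfadjoint x \<and> exp x = T)"

definition cop_powr :: "'a::separable_hilbert_space cop \<Rightarrow> real \<Rightarrow> 'a cop"
  where "cop_powr T t = exp (t *\<^sub>R cop_ln T)"

lemma selfadjoint_iff_inner:
  "selfadjoint T \<longleftrightarrow> (\<forall>x y. inner (cop_apply T x) y = inner x (cop_apply T y))"
proof
  show "\<forall>x y. inner (cop_apply T x) y = inner x (cop_apply T y)" if "selfadjoint T"
    using that by (simp add: selfadjoint_def inner_eq_Re_cinner)
  assume *: "\<forall>x y. inner (cop_apply T x) y = inner x (cop_apply T y)"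
  show "selfadjoint T"
    unfolding selfadjoint_def
  proof (intro allI complex_eqI)
    fix x y
    show "Re (cinner (cop_apply T x) y) = Re (cinner x (cop_apply T y))"
      using * by (simp add: inner_eq_Re_cinner)
    show "Im (cinner (cop_apply T x) y) = Im (cinner x (cop_apply T y))"
      using * by (simp add: cinner_Im cop_apply_scaleC flip: cop_apply_scaleC)
  qed
qed

lemma adj_selfadjoint: "selfadjoint T \<Longrightarrow> adj T = T"
  unfolding adj_def
proof (rule the_equality)
  assume T: "selfadjoint T"
  then show "\<forall>x y. cinner (cop_apply T x) y = cinner x (cop_apply T y)"
    by (simp add: selfadjoint_def)
  fix S assume S: "\<forall>x y. cinner (cop_apply T x) y = cinner x (cop_apply S y)"
  show "S = T"
  proof (rule cop_eqI)
    fix y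
    have "inner x (cop_apply S y) = inner x (cop_apply T y)" for x
      using S T by (simp add: selfadjoint_def inner_eq_Re_cinner)
    then show "cop_apply S y = cop_apply T y"
      by (metis inner_commute vector_eq_ldot)
  qed
qed

lemma selfadjoint_simps:
  "selfadjoint 0" "selfadjoint 1"
  "selfadjoint S \<Longrightarrow> selfadjoint T \<Longrightarrow> selfadjoint (S + T)"
  "selfadjoint T \<Longrightarrow> selfadjoint (r *\<^sub>R T)"
  "selfadjoint T \<Longrightarrow> selfadjoint (T ^ n)"
proof -
  show "selfadjoint 0" "selfadjoint 1"
    "selfadjoint S \<Longrightarrow> selfadjoint T \<Longrightarrow> selfadjoint (S + T)"
    "selfadjoint T \<Longrightarrow> selfadjoint (r *\<^sub>R T)"
    by (simp_all add: selfadjoint_iff_inner cop_apply_one cop.zero_left cop.add_left cop.scaleR_left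
        inner_add_left inner_add_right)
  show "selfadjoint (T ^ n)" if "selfadjoint T"
  proof (induction n)
    case (Suc n)
    have "inner (cop_apply (T ^ Suc n) x) y = inner x (cop_apply (T ^ Suc n) y)" for x y
    proof -
      have "inner (cop_apply (T ^ Suc n) x) y = inner x (cop_apply (T ^ n * T) y)"
        using Suc that by (simp add: selfadjoint_iff_inner cop_apply_times)
      then show ?thesis by (simp only: power_Suc2)
    qed
    then show ?case by (simp only: selfadjoint_iff_inner) blast
  qed (simp add: selfadjoint_iff_inner cop_apply_one)
qed

lemma selfadjoint_exp:
  assumes "selfadjoint T"
  shows "selfadjoint (exp T)"
proof -
  define f where "f N = (\<Sum>n<N. T ^ n /\<^sub>R fact n)" for N
  have f: "selfadjoint (f N)" for N
    unfolding f_def by (induction N) (simp_all add: selfadjoint_simps assms)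
  have lim: "f \<longlonglongrightarrow> exp T"
    using exp_converges[of T] by (simp add: sums_def f_def[abs_def])
  show ?thesis
    unfolding selfadjoint_iff_inner
  proof (intro allI)
    fix x y
    have "(\<lambda>N. inner (cop_apply (f N) x) y) \<longlonglongrightarrow> inner (cop_apply (exp T) x) y"
      by (intro tendsto_intros cop.tendsto lim)
    moreover have "(\<lambda>N. inner (cop_apply (f N) x) y) \<longlonglongrightarrow> inner x (cop_apply (exp T) y)"
    proof -
      have "(\<lambda>N. inner x (cop_apply (f N) y)) \<longlonglongrightarrow> inner x (cop_apply (exp T) y)"
        by (intro tendsto_intros cop.tendsto lim)
      then show ?thesis using f by (simp add: selfadjoint_iff_inner)
    qed
    ultimately show "inner (cop_apply (exp T) x) y = inner x (cop_apply (exp T) y)"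
      by (rule LIMSEQ_unique)
  qed
qed

lemma hilbert_schmidt_zero: "hilbert_schmidt 0"
  by (simp add: hilbert_schmidt_def cop.zero_left)

lemma hilbert_schmidt_left:
  assumes "hilbert_schmidt T"
  shows "hilbert_schmidt (S * T)"
proof -
  have "(\<lambda>e. (norm S)\<^sup>2 * (norm (cop_apply T e))\<^sup>2) summable_on onb"
    using assms unfolding hilbert_schmidt_def by (rule summable_on_cmult_right)
  then have "(\<lambda>e. (norm (cop_apply (S * T) e))\<^sup>2) summable_on onb"
    by (rule summable_on_comparison_test)
       (auto simp: cop_apply_times power_mult_distrib[symmetric] intro!: power_mono norm_cop_apply)
  then show ?thesis by (simp add: hilbert_schmidt_def)
qed

lemma hilbert_schmidt_scaleR: "hilbert_schmidt T \<Longrightarrow> hilbert_schmidt (r *\<^sub>R T)"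
  using hilbert_schmidt_left[of T "r *\<^sub>R 1"] by simp

lemma hilbert_schmidt_add:
  assumes "hilbert_schmidt S" "hilbert_schmidt T"
  shows "hilbert_schmidt (S + T)"
proof -
  have le: "(norm (a + b))\<^sup>2 \<le> 2 * (norm a)\<^sup>2 + 2 * (norm b)\<^sup>2" for a b :: 'a
    using zero_le_power2[of "norm (a - b)"] unfolding power2_norm_eq_inner
    by (simp add: algebra_simps inner_commute)
  have "(\<lambda>e. 2 * (norm (cop_apply S e))\<^sup>2 + 2 * (norm (cop_apply T e))\<^sup>2) summable_on onb"
    using assms unfolding hilbert_schmidt_def
    by (intro summable_on_add summable_on_cmult_right)
  then have "(\<lambda>e. (norm (cop_apply (S + T) e))\<^sup>2) summable_on onb"
    by (rule summable_on_comparison_test) (simp_all add: cop.add_left le)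
  then show ?thesis by (simp add: hilbert_schmidt_def)
qed

lemma infinite_onb: "infinite (onb :: 'a::separable_hilbert_space set)"
proof
  assume fin: "finite (onb :: 'a set)"
  define P where "P x = (\<Sum>b\<in>onb. cinner x b *\<^sub>C b)" for x :: 'a
  have on: "orthonormal (onb :: 'a set)" and dense: "closure (cspan onb) = (UNIV :: 'a set)"
    using is_onb_onb[where 'a='a] by (auto simp: is_onb_def)
  have cont: "continuous_on UNIV P"
    unfolding P_def
  proof (rule continuous_on_sum)
    fix b :: 'a
    have "(\<lambda>x. cinner x b *\<^sub>C b) = (\<lambda>x. Re (cinner x b) *\<^sub>R b + Im (cinner x b) *\<^sub>R \<i> *\<^sub>C b)"
    proof
      fix x
      have "cinner x b *\<^sub>C b
          = (complex_of_real (Re (cinner x b)) + complex_of_real (Im (cinner x b)) * \<i>) *\<^sub>C b"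
        using complex_eq[of "cinner x b"] by (simp only: mult.commute)
      then show "cinner x b *\<^sub>C b = Re (cinner x b) *\<^sub>R b + Im (cinner x b) *\<^sub>R \<i> *\<^sub>C b"
        by (simp only: scaleC_add_left flip: scaleC_scaleC scaleC_of_real)
    qed
    then show "continuous_on UNIV (\<lambda>x. cinner x b *\<^sub>C b)"
      by (simp only:) (intro continuous_intros
          bounded_linear.continuous_on[OF bounded_linear_cinner_left])
  qed
  have Pb: "P b = b" if b: "b \<in> onb" for b
  proof -
    have "P b = (\<Sum>c\<in>onb. if c = b then b else 0)"
      unfolding P_def using on b
      by (intro sum.cong) (auto simp: orthonormal_def complex_module.scale_zero_left)
    then show ?thesis using fin b by simp
  qed
  have "P x = x" if "x \<in> cspan onb" for x
    using that
  proof (induction rule: complex_module.span_induct_alt)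
    case (step c b y)
    have "P (c *\<^sub>C b + y) = c *\<^sub>C P b + P y"
      by (simp add: P_def cinner_add_left cinner_scaleC_left scaleC_add_left sum.distrib
          complex_module.scale_sum_right scaleC_scaleC)
    then show ?case using step Pb by simp
  next
    case base
    have "cinner 0 b = 0" for b :: 'a
      using cinner_scaleC_left[of 0 0 b] by (simp only: complex_module.scale_zero_left mult_zero_left)
    then show ?case by (simp add: P_def complex_module.scale_zero_left)
  qed
  then have "cspan onb \<subseteq> {x. P x = x}" by auto
  moreover have "closed {x. P x = x}"
    by (intro closed_Collect_eq cont continuous_on_id)
  ultimately have "closure (cspan onb) \<subseteq> {x. P x = x}" by (rule closure_minimal)
  then have "P x = x" for x unfolding dense by blast
  then have *: "x = (\<Sum>b\<in>onb. cinner x b *\<^sub>C b)" for x :: 'a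
    unfolding P_def by (rule sym)
  obtain x :: 'a where "\<forall>c. x \<noteq> (\<Sum>b\<in>onb. c b *\<^sub>C b)"
    using infinite_dimensional[OF fin] by blast
  then show False using *[of x] by blast
qed

lemma not_hilbert_schmidt_of_real: "hilbert_schmidt (of_real r :: 'a::separable_hilbert_space cop) \<longleftrightarrow> r = 0"
proof
  assume hs: "hilbert_schmidt (of_real r :: 'a cop)"
  show "r = 0"
  proof (rule ccontr)
    assume "r \<noteq> 0"
    with hilbert_schmidt_scaleR[OF hs, of "1 / r"] have "hilbert_schmidt (1 :: 'a cop)"
      by (simp add: of_real_def)
    moreover have "norm e = 1" if "e \<in> onb" for e :: 'a
    proof -
      have "cinner e e = 1"
        using is_onb_onb[where 'a='a] that by (auto simp: is_onb_def orthonormal_def)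
      then have "complex_of_real ((norm e)\<^sup>2) = complex_of_real 1" by (simp only: cinner_self of_real_1)
      then have "(norm e)\<^sup>2 = 1" by (simp only: of_real_eq_iff)
      then show ?thesis by (simp add: power2_eq_1_iff) (smt (verit) norm_ge_zero)
    qed
    ultimately have "(\<lambda>e::'a. 1 :: real) summable_on onb"
      unfolding hilbert_schmidt_def
      by (subst summable_on_cong[where g="\<lambda>e. (norm (cop_apply 1 e))\<^sup>2"]) (auto simp: cop_apply_one)
    then have "real (card F) \<le> (\<Sum>\<^sub>\<infinity>e\<in>(onb::'a set). 1 :: real)" if "finite F" "F \<subseteq> onb" for F :: "'a set"
      using finite_sum_le_infsum[of "\<lambda>e::'a. 1 :: real" onb F] that by simp
    moreover obtain n :: nat where "(\<Sum>\<^sub>\<infinity>e\<in>(onb::'a set). 1 :: real) < real n"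
      using reals_Archimedean2 by blast
    moreover obtain F :: "'a set" where "finite F" "card F = n" "F \<subseteq> onb"
      using infinite_arbitrarily_large[OF infinite_onb] by blast
    ultimately show False by force
  qed
qed (simp add: hilbert_schmidt_zero)


section \<open>Selfadjoint Hilbert-Schmidt perturbations of real scalars\<close>

text \<open>As the identity is not a Hilbert-Schmidt operator, the decomposition \<open>T = a + \<lambda>\<close> is unique;
  \<open>scalar_part T\<close> is \<open>\<lambda>\<close> and \<open>hs_part T\<close> is \<open>a\<close>.\<close>

definition scalar_part :: "'a::separable_hilbert_space cop \<Rightarrow> real"
  where "scalar_part T = (THE r. hilbert_schmidt (T - of_real r))"

definition hs_part :: "'a::separable_hilbert_space cop \<Rightarrow> 'a cop"
  where "hs_part T = T - of_real (scalar_part T)"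

text \<open>On these operators the trace in the following form is real; \<open>Re\<close> only fixes the type.\<close>

definition inner2 :: "'a::separable_hilbert_space cop \<Rightarrow> 'a cop \<Rightarrow> real"
  where "inner2 S T = 4 * Re (trace_cop (hs_part S * adj (hs_part T))) + scalar_part S * scalar_part T"

lemma scalar_part_eq: "hilbert_schmidt a \<Longrightarrow> scalar_part (a + of_real r) = r"
  unfolding scalar_part_def
proof (rule the_equality)
  assume a: "hilbert_schmidt a"
  then show "hilbert_schmidt (a + of_real r - of_real r)" by simp
  fix s assume "hilbert_schmidt (a + of_real r - of_real s)"
  from hilbert_schmidt_add[OF this hilbert_schmidt_scaleR[OF a, of "-1"]]
  have "hilbert_schmidt (of_real (r - s) :: 'a cop)" by simp
  then show "s = r" by (simp only: not_hilbert_schmidt_of_real)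
qed

lemma hs_part_eq: "hilbert_schmidt a \<Longrightarrow> hs_part (a + of_real r) = a"
  by (simp add: hs_part_def scalar_part_eq)

typedef (overloaded) 'a hsr =
    "{T :: 'a::separable_hilbert_space cop.
       \<exists>a r. selfadjoint a \<and> hilbert_schmidt a \<and> T = a + of_real r}"
  morphisms cop_of Abs_hsr
  by (rule exI[of _ 0], rule CollectI, rule exI[of _ 0], rule exI[of _ 0])
     (simp add: selfadjoint_simps hilbert_schmidt_zero)

setup_lifting type_definition_hsr

lemma hsr_cases:
  obtains a r where "selfadjoint a" "hilbert_schmidt a" "cop_of x = a + of_real r"
    "hs_part (cop_of x) = a" "scalar_part (cop_of x) = r"
  using cop_of[of x] by (auto simp: hs_part_eq scalar_part_eq)

lemma hs_inner_summable:
  assumes "hilbert_schmidt a" "hilbert_schmidt b"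
  shows "(\<lambda>e. cinner (cop_apply a e) (cop_apply b e)) summable_on onb"
    and "(\<lambda>e. inner (cop_apply a e) (cop_apply b e)) summable_on onb"
proof -
  have *: "(\<lambda>e. norm (norm (cop_apply a e) * norm (cop_apply b e))) summable_on onb"
    by (rule abs_summable_product)
       (use assms in \<open>simp_all add: hilbert_schmidt_def power2_eq_square\<close>)
  have "cmod (cinner x y) \<le> norm x * norm y" for x y :: 'a
  proof (cases "cinner x y = 0")
    case False
    define u where "u = cnj (cinner x y) / cmod (cinner x y)"
    have u: "cmod u = 1" using False by (simp add: u_def norm_divide)
    have "cinner (u *\<^sub>C x) y = complex_of_real (cmod (cinner x y))"
      using False by (simp add: cinner_scaleC_left u_def complex_norm_square[symmetric] mult.commute
          power2_eq_square)
    then have "cmod (cinner x y) = inner (u *\<^sub>C x) y" by (simp add: inner_eq_Re_cinner)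
    also have "\<dots> \<le> norm (u *\<^sub>C x) * norm y" by (rule norm_cauchy_schwarz)
    finally show ?thesis by (simp add: norm_scaleC u)
  qed simp
  then show c: "(\<lambda>e. cinner (cop_apply a e) (cop_apply b e)) summable_on onb"
    by (intro abs_summable_summable[OF Infinite_Sum.abs_summable_on_comparison_test[OF *]]) simp
  show "(\<lambda>e. inner (cop_apply a e) (cop_apply b e)) summable_on onb"
    using summable_on_Re[OF c] by (simp add: inner_eq_Re_cinner)
qed

lemma Re_trace_hs:
  assumes a: "selfadjoint a" "hilbert_schmidt a" and b: "selfadjoint b" "hilbert_schmidt b"
  shows "Re (trace_cop (a * adj b)) = (\<Sum>\<^sub>\<infinity>e\<in>onb. inner (cop_apply b e) (cop_apply a e))"
proof -
  have "cinner (cop_apply (a * adj b) e) e = cinner (cop_apply b e) (cop_apply a e)" for e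
    using a(1) by (simp add: adj_selfadjoint[OF b(1)] cop_apply_times selfadjoint_def)
  then show ?thesis
    using infsum_Re[OF hs_inner_summable(1)[OF b(2) a(2)]]
    by (simp add: trace_cop_def inner_eq_Re_cinner)
qed

lemma hs_inner_self_zero:
  assumes a: "selfadjoint a" "hilbert_schmidt a"
    and z: "(\<Sum>\<^sub>\<infinity>e\<in>onb. inner (cop_apply a e) (cop_apply a e)) = 0"
  shows "a = 0"
proof (rule cop_eqI)
  fix x
  have e: "cop_apply a e = 0" if "e \<in> onb" for e
    using nonneg_infsum_le_0D[OF _ hs_inner_summable(2)[OF a(2) a(2)] _ that] z by simp
  have "cop_apply a y = 0" if "y \<in> cspan onb" for y
    using that
    by (induction rule: complex_module.span_induct_alt)
       (simp_all add: cop.zero_right cop.add_right cop_apply_scaleC e complex_module.scale_zero_right)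
  then have "cspan onb \<subseteq> {y. cop_apply a y = 0}" by auto
  moreover have "closed {y. cop_apply a y = 0}"
    by (intro closed_Collect_eq continuous_on_const
        bounded_linear.continuous_on[OF cop.bounded_linear_right] continuous_on_id)
  ultimately have "closure (cspan onb) \<subseteq> {y. cop_apply a y = 0}" by (rule closure_minimal)
  then show "cop_apply a x = cop_apply 0 x"
    using is_onb_onb[where 'a='a] by (auto simp: is_onb_def cop.zero_left)
qed

instantiation hsr :: (separable_hilbert_space) real_inner
begin

lift_definition zero_hsr :: "'a hsr" is 0
  by (rule exI[of _ 0], rule exI[of _ 0]) (simp add: selfadjoint_simps hilbert_schmidt_zero)

lift_definition plus_hsr :: "'a hsr \<Rightarrow> 'a hsr \<Rightarrow> 'a hsr" is plus
proof -
  fix S T :: "'a cop"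
  assume "\<exists>a r. selfadjoint a \<and> hilbert_schmidt a \<and> S = a + of_real r"
    "\<exists>a r. selfadjoint a \<and> hilbert_schmidt a \<and> T = a + of_real r"
  then obtain a r b s where *: "selfadjoint a" "hilbert_schmidt a" "S = a + of_real r"
    "selfadjoint b" "hilbert_schmidt b" "T = b + of_real s" by blast
  then show "\<exists>a r. selfadjoint a \<and> hilbert_schmidt a \<and> S + T = a + of_real r"
    by (intro exI[of _ "a + b"] exI[of _ "r + s"])
       (simp add: selfadjoint_simps hilbert_schmidt_add)
qed

lift_definition scaleR_hsr :: "real \<Rightarrow> 'a hsr \<Rightarrow> 'a hsr" is scaleR
proof -
  fix t :: real and T :: "'a cop"
  assume "\<exists>a r. selfadjoint a \<and> hilbert_schmidt a \<and> T = a + of_real r"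
  then obtain a r where *: "selfadjoint a" "hilbert_schmidt a" "T = a + of_real r" by blast
  then show "\<exists>a r. selfadjoint a \<and> hilbert_schmidt a \<and> t *\<^sub>R T = a + of_real r"
    by (intro exI[of _ "t *\<^sub>R a"] exI[of _ "t * r"])
       (simp add: selfadjoint_simps hilbert_schmidt_scaleR scaleR_add_right of_real_def)
qed

definition uminus_hsr :: "'a hsr \<Rightarrow> 'a hsr"
  where "uminus_hsr x = (-1) *\<^sub>R x"

definition minus_hsr :: "'a hsr \<Rightarrow> 'a hsr \<Rightarrow> 'a hsr"
  where "minus_hsr x y = x + - y"

definition inner_hsr :: "'a hsr \<Rightarrow> 'a hsr \<Rightarrow> real"
  where "inner_hsr x y = inner2 (cop_of x) (cop_of y)"

definition norm_hsr :: "'a hsr \<Rightarrow> real"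
  where "norm_hsr x = sqrt (inner x x)"

definition dist_hsr :: "'a hsr \<Rightarrow> 'a hsr \<Rightarrow> real"
  where "dist_hsr x y = norm (x - y)"

definition uniformity_hsr :: "('a hsr \<times> 'a hsr) filter"
  where "uniformity_hsr = (INF e\<in>{0 <..}. principal {(x, y). dist x y < e})"

definition open_hsr :: "'a hsr set \<Rightarrow> bool"
  where "open_hsr S = (\<forall>x\<in>S. \<forall>\<^sub>F (x', y) in uniformity. x' = x \<longrightarrow> y \<in> S)"

definition sgn_hsr :: "'a hsr \<Rightarrow> 'a hsr"
  where "sgn_hsr x = scaleR (inverse (norm x)) x"

instance
proof
  fix x y z :: "'a hsr" and s t :: real and U :: "'a hsr set"
  show "dist x y = norm (x - y)" by (rule dist_hsr_def)
  show "open U \<longleftrightarrow> (\<forall>x\<in>U. \<forall>\<^sub>F (x', y) in uniformity. x' = x \<longrightarrow> y \<in> U)" by (rule open_hsr_def)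
  show "sgn x = inverse (norm x) *\<^sub>R x" by (rule sgn_hsr_def)
  show "uniformity = (INF e\<in>{0 <..}. principal {(x, y :: 'a hsr). dist x y < e})"
    by (rule uniformity_hsr_def)
  show "norm x = sqrt (inner x x)" by (rule norm_hsr_def)
  show "x - y = x + - y" by (rule minus_hsr_def)
  show "x + y + z = x + (y + z)" by transfer (simp add: add.assoc)
  show "x + y = y + x" by transfer (simp add: add.commute)
  show "0 + x = x" by transfer simp
  show "- x + x = 0" unfolding uminus_hsr_def by transfer simp
  show "s *\<^sub>R (x + y) = s *\<^sub>R x + s *\<^sub>R y" by transfer (simp add: scaleR_add_right)
  show "(s + t) *\<^sub>R x = s *\<^sub>R x + t *\<^sub>R x" by transfer (simp add: scaleR_add_left)
  show "s *\<^sub>R t *\<^sub>R x = (s * t) *\<^sub>R x" by transfer simp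
  show "1 *\<^sub>R x = x" by transfer simp
  obtain a r where x: "selfadjoint a" "hilbert_schmidt a" "cop_of x = a + of_real r"
    "hs_part (cop_of x) = a" "scalar_part (cop_of x) = r" by (rule hsr_cases[of x])
  obtain b q where y: "selfadjoint b" "hilbert_schmidt b" "cop_of y = b + of_real q"
    "hs_part (cop_of y) = b" "scalar_part (cop_of y) = q" by (rule hsr_cases[of y])
  obtain c p where z: "selfadjoint c" "hilbert_schmidt c" "cop_of z = c + of_real p"
    "hs_part (cop_of z) = c" "scalar_part (cop_of z) = p" by (rule hsr_cases[of z])
  show "inner x y = inner y x"
    by (simp add: inner_hsr_def inner2_def x y hs_part_eq scalar_part_eq Re_trace_hs inner_commute)
  have xy: "cop_of (x + y) = (a + b) + of_real (r + q)"
    by (simp add: plus_hsr.rep_eq x y)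
  have ab: "selfadjoint (a + b)" "hilbert_schmidt (a + b)"
    using x y by (simp_all add: selfadjoint_simps hilbert_schmidt_add)
  show "inner (x + y) z = inner x z + inner y z"
    unfolding inner_hsr_def inner2_def xy
    by (simp only: hs_part_eq scalar_part_eq ab x y z Re_trace_hs)
       (simp add: cop.add_left inner_add_right infsum_add hs_inner_summable x y z algebra_simps)
  have sx: "cop_of (s *\<^sub>R x) = s *\<^sub>R a + of_real (s * r)"
    by (simp add: scaleR_hsr.rep_eq x scaleR_add_right of_real_def)
  have sa: "selfadjoint (s *\<^sub>R a)" "hilbert_schmidt (s *\<^sub>R a)"
    using x by (simp_all add: selfadjoint_simps hilbert_schmidt_scaleR)
  show "inner (s *\<^sub>R x) y = s * inner x y"
    unfolding inner_hsr_def inner2_def sx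
    by (simp only: hs_part_eq scalar_part_eq sa x y Re_trace_hs)
       (simp add: cop.scaleR_left infsum_cmult_right' algebra_simps)
  have xx: "inner x x = 4 * (\<Sum>\<^sub>\<infinity>e\<in>onb. inner (cop_apply a e) (cop_apply a e)) + r * r"
    by (simp add: inner_hsr_def inner2_def x hs_part_eq scalar_part_eq Re_trace_hs)
  have nn: "0 \<le> (\<Sum>\<^sub>\<infinity>e\<in>onb. inner (cop_apply a e) (cop_apply a e))"
    by (intro infsum_nonneg) simp
  show "0 \<le> inner x x" using nn by (simp add: xx)
  show "inner x x = 0 \<longleftrightarrow> x = 0"
  proof
    assume "inner x x = 0"
    with nn have "r * r = 0" and z: "(\<Sum>\<^sub>\<infinity>e\<in>onb. inner (cop_apply a e) (cop_apply a e)) = 0"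
      unfolding xx by (smt (verit) zero_le_square)+
    then have "cop_of x = 0" using hs_inner_self_zero[OF x(1,2) z] x(3) by simp
    then show "x = 0" by transfer simp
  next
    assume "x = 0"
    then have "a + of_real r = 0 + of_real 0" using x(3) by (simp add: zero_hsr.rep_eq)
    then have "a = 0" "r = 0"
      using hs_part_eq[OF x(2), of r] hs_part_eq[OF hilbert_schmidt_zero, of 0]
        scalar_part_eq[OF x(2), of r] scalar_part_eq[OF hilbert_schmidt_zero, of 0] by metis+
    then show "inner x x = 0" by (simp add: xx cop.zero_left)
  qed
qed

end

lift_definition hsr_exp :: "'a::separable_hilbert_space hsr \<Rightarrow> 'a hsr" is exp
proof -
  fix T :: "'a cop"
  assume "\<exists>a r. selfadjoint a \<and> hilbert_schmidt a \<and> T = a + of_real r"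
  then obtain a r where a: "selfadjoint a" "hilbert_schmidt a" and T: "T = a + of_real r" by blast
  define g where "g = (\<Sum>n. a ^ n /\<^sub>R fact (Suc n))"
  have sum: "summable (\<lambda>n. a ^ n /\<^sub>R fact (Suc n))"
  proof (rule summable_comparison_test'[OF summable_norm_exp[of a], where N=0])
    fix n
    have "norm (a ^ n /\<^sub>R fact (Suc n)) = norm (a ^ n) * inverse (fact (Suc n))"
      by simp
    also have "\<dots> \<le> norm (a ^ n) * inverse (fact n)"
      by (intro mult_left_mono le_imp_inverse_le fact_mono) (auto simp del: fact_Suc)
    finally show "norm (a ^ n /\<^sub>R fact (Suc n)) \<le> norm (a ^ n /\<^sub>R fact n)"
      by (simp add: mult.commute del: fact_Suc)
  qed
  have "exp a = 1 + (\<Sum>n. a ^ Suc n /\<^sub>R fact (Suc n))"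
    unfolding exp_def using suminf_split_head[OF summable_exp_generic[of a]] by simp
  also have "(\<Sum>n. a ^ Suc n /\<^sub>R fact (Suc n)) = g * a"
    unfolding g_def using suminf_mult2[OF sum, of a] by (simp add: power_Suc2 del: fact_Suc power_Suc)
  finally have e: "exp a = 1 + g * a" .
  have sa: "selfadjoint (g * a)"
  proof -
    have "g * a = exp a + (-1) *\<^sub>R 1" using e by simp
    then show ?thesis using selfadjoint_exp[OF a(1)] by (simp only: selfadjoint_simps)
  qed
  have "exp T = exp a * of_real (exp r)"
    unfolding T exp_of_real[symmetric] by (rule exp_add_commuting) (simp add: of_real_def)
  also have "\<dots> = exp r *\<^sub>R (g * a) + of_real (exp r)"
    by (simp add: e of_real_def scaleR_add_right)
  finally show "\<exists>a r. selfadjoint a \<and> hilbert_schmidt a \<and> exp T = a + of_real r"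
    using sa hilbert_schmidt_left[OF a(2)]
    by (intro exI[of _ "exp r *\<^sub>R (g * a)"] exI[of _ "exp r"])
       (simp add: selfadjoint_simps hilbert_schmidt_scaleR)
qed


section \<open>Smooth maps and submanifolds\<close>

text \<open>A function on lists of length \<open>k\<close> stands for a bounded \<open>k\<close>-linear map.\<close>

definition bounded_multilinear ::
    "nat \<Rightarrow> ('a::real_normed_vector list \<Rightarrow> 'b::real_normed_vector) \<Rightarrow> bool"
  where "bounded_multilinear k F \<longleftrightarrow>
    (\<forall>us v w vs. length us + length vs + 1 = k \<longrightarrow>
        F (us @ (v + w) # vs) = F (us @ v # vs) + F (us @ w # vs)) \<and>
    (\<forall>us r v vs. length us + length vs + 1 = k \<longrightarrow>
        F (us @ (r *\<^sub>R v) # vs) = r *\<^sub>R F (us @ v # vs)) \<and>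
    (\<exists>C. \<forall>vs. length vs = k \<longrightarrow> norm (F vs) \<le> C * prod_list (map norm vs))"

text \<open>\<open>f\<close> is smooth on the open set \<open>U\<close> if it has Frechet derivatives of all orders there:
  \<open>D x\<close> restricted to lists of length \<open>k\<close> is the \<open>k\<close>-th derivative at \<open>x\<close>, a bounded \<open>k\<close>-linear map,
  and \<open>D\<close> at order \<open>k + 1\<close> is the Frechet derivative of \<open>D\<close> at order \<open>k\<close> with respect to the
  operator norm of \<open>k\<close>-linear maps (under the usual identification of linear maps into \<open>k\<close>-linear
  maps with \<open>k + 1\<close>-linear maps).\<close>

definition smooth_on :: "'a::real_normed_vector set \<Rightarrow> ('a \<Rightarrow> 'b::real_normed_vector) \<Rightarrow> bool"
  where "smooth_on U f \<longleftrightarrow>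
    (\<exists>D :: 'a \<Rightarrow> 'a list \<Rightarrow> 'b.
      (\<forall>x\<in>U. D x [] = f x) \<and>
      (\<forall>k. \<forall>x\<in>U. bounded_multilinear k (D x)) \<and>
      (\<forall>k. \<forall>x\<in>U. \<forall>e>0. \<exists>d>0. \<forall>y\<in>U. norm (y - x) < d \<longrightarrow>
        (\<forall>vs. length vs = k \<longrightarrow>
          norm (D y vs - D x vs - D x ((y - x) # vs)) \<le> e * norm (y - x) * prod_list (map norm vs))))"

definition diffeomorphism_on ::
    "'a::real_normed_vector set \<Rightarrow> 'b::real_normed_vector set \<Rightarrow> ('a \<Rightarrow> 'b) \<Rightarrow> bool"
  where "diffeomorphism_on U V \<phi> \<longleftrightarrow>
    open U \<and> open V \<and> bij_betw \<phi> U V \<and> smooth_on U \<phi> \<and> smooth_on V (the_inv_into U \<phi>)"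

text \<open>Riemannian manifolds realised inside a fixed normed space: the underlying set, its topology,
  its tangent spaces, and the inner product on each tangent space.\<close>

record 'a riemannian =
  points :: "'a set"
  topol :: "'a topology"
  tangent :: "'a \<Rightarrow> 'a set"
  metric :: "'a \<Rightarrow> 'a \<Rightarrow> 'a \<Rightarrow> real"

text \<open>Velocities at \<open>p\<close> of curves lying in \<open>M\<close>.\<close>

definition tangent_vectors :: "'a::real_normed_vector set \<Rightarrow> 'a \<Rightarrow> 'a set"
  where "tangent_vectors M p =
    {v. \<exists>c e. 0 < e \<and> c 0 = p \<and> c ` {-e<..<e} \<subseteq> M \<and> (c has_vector_derivative v) (at (0::real))}"

text \<open>The subset \<open>M\<close> of \<open>N\<close> with the induced topology and Riemannian metric (values of the metric off
  the tangent space are set to \<open>0\<close>).\<close>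

definition induced :: "'a::real_normed_vector riemannian \<Rightarrow> 'a set \<Rightarrow> 'a riemannian"
  where "induced N M =
    \<lparr>points = M, topol = subtopology (topol N) M, tangent = tangent_vectors M,
     metric = (\<lambda>p v w. if v \<in> tangent_vectors M p \<and> w \<in> tangent_vectors M p
                       then metric N p v w else 0)\<rparr>"

text \<open>\<open>N\<close> is understood to be open in the ambient Hilbert space, so charts of \<open>N\<close> are diffeomorphisms
  between open subsets of that space; its closed subspaces are automatically complemented.\<close>

definition riemannian_submanifold :: "'a::real_inner riemannian \<Rightarrow> 'a riemannian \<Rightarrow> bool"
  where "riemannian_submanifold M N \<longleftrightarrow>
    points M \<subseteq> points N \<and>
    topol M = subtopology (topol N) (points M) \<and>
    (\<forall>p\<in>points M. \<exists>U V (\<phi> :: 'a \<Rightarrow> 'a) F. p \<in> U \<and> U \<subseteq> points N \<and> diffeomorphism_on U V \<phi> \<and>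
        subspace F \<and> closed F \<and> \<phi> ` (U \<inter> points M) = V \<inter> F) \<and>
    (\<forall>p\<in>points M. tangent M p = tangent_vectors (points M) p \<and>
        (\<forall>v\<in>tangent M p. \<forall>w\<in>tangent M p. metric M p v w = metric N p v w))"


section \<open>The cone of positive invertible operators\<close>

definition Sigma_set :: "'a::separable_hilbert_space hsr set"
  where "Sigma_set = {p. positive_cop (cop_of p) \<and> invertible_cop (cop_of p)}"

definition Sigma_metric :: "'a::separable_hilbert_space hsr \<Rightarrow> 'a hsr \<Rightarrow> 'a hsr \<Rightarrow> real"
  where "Sigma_metric p x y =
    (let r = cop_powr (cop_of p) (- (1/2)) in inner2 (r * cop_of x * r) (r * cop_of y * r))"

definition Sigma_mfd :: "'a::separable_hilbert_space hsr riemannian"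
  where "Sigma_mfd =
    \<lparr>points = Sigma_set, topol = top_of_set Sigma_set, tangent = (\<lambda>p. UNIV), metric = Sigma_metric\<rparr>"

definition geodesic :: "'a::separable_hilbert_space hsr \<Rightarrow> 'a hsr \<Rightarrow> real \<Rightarrow> 'a cop"
  where "geodesic p q t =
    (let r = cop_powr (cop_of p) (1/2); s = cop_powr (cop_of p) (- (1/2))
     in r * cop_powr (s * cop_of q * s) t * r)"

definition geodesically_convex :: "'a::separable_hilbert_space hsr set \<Rightarrow> bool"
  where "geodesically_convex M \<longleftrightarrow>
    M \<subseteq> Sigma_set \<and> (\<forall>p\<in>M. \<forall>q\<in>M. geodesic p q ` {0..1} \<subseteq> cop_of ` M)"

text \<open>The inner commutator of selfadjoint operators is skew-adjoint, so the condition is stated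
  for the underlying operators.\<close>

definition lie_triple_system :: "'a::separable_hilbert_space hsr set \<Rightarrow> bool"
  where "lie_triple_system m \<longleftrightarrow>
    (\<forall>a\<in>m. \<forall>b\<in>m. \<forall>c\<in>m.
      commutator (commutator (cop_of a) (cop_of b)) (cop_of c) \<in> cop_of ` m)"

end

theory Submission
  imports Defs
begin

text \<open>The logarithm is a global chart: \<open>exp\<close> is a diffeomorphism from the whole space of selfadjoint
  operators onto \<open>\<Sigma>\<close>, with inverse \<open>p \<mapsto> \<integral>\<^sub>0\<^sup>1 (p - 1) (1 + s (p - 1))\<^sup>-\<^sup>1 ds\<close>, and it carries the closed subspace
  \<open>\<mm>\<close> onto \<open>M\<close>; so \<open>M\<close> is a closed submanifold for any closed subspace. Smoothness of both maps is obtained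
  in the Banach algebra of all Hilbert-Schmidt perturbations of scalars, from explicit derivatives and
  quadratic bounds on the Taylor remainders.

  The Lie triple condition enters through convexity, which reduces to \<open>e\<^sup>x e\<^sup>y e\<^sup>x \<in> exp \<mm>\<close> for \<open>x, y \<in> \<mm>\<close>.
  The curve \<open>b t\<close> with \<open>exp (b t) = e\<^sup>t\<^sup>x e\<^sup>y e\<^sup>t\<^sup>x\<close> satisfies \<open>S (b') = e\<^sup>-\<^sup>b\<^sup>/\<^sup>2 x e\<^sup>b\<^sup>/\<^sup>2 + e\<^sup>b\<^sup>/\<^sup>2 x e\<^sup>-\<^sup>b\<^sup>/\<^sup>2\<close>, where
  \<open>S = sinh (ad b / 2) / (ad b / 2)\<close>. Both sides are even in \<open>ad b\<close>, hence preserve \<open>\<mm>\<close>, and \<open>S\<close> is coercive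
  because \<open>b\<close> is selfadjoint, hence invertible on \<open>\<mm>\<close>. Euler's method for this equation stays in \<open>\<mm>\<close>,
  and \<open>exp \<mm>\<close> is closed.\<close>

section \<open>Smooth maps on Banach algebras\<close>

text \<open>Products of selfadjoint operators need not be selfadjoint, so power series and
  resolvents are treated in the larger algebra \<open>hsa\<close>, which \<open>hsr\<close> enters
  through a bounded linear embedding with a bounded linear left inverse. The norm of
  \<open>hsa\<close> is submultiplicative; inverting \<open>S\<close> needs an inner product and is
  done in \<open>hsr\<close>, whose Hilbert norm is equivalent to it on the embedded copy.

  The vector field behind \<open>b'\<close> is known only pointwise: at each \<open>b\<close> some
  velocity exists, with a norm bound on bounded sets. Euler's method asks for no more than that. Its
  local error is \<open>O(h^2)\<close> by Duhamel's formula, and earlier errors are carried along by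
  the linear map sending \<open>E\<close> to \<open>exp (h x) * E * exp (h x)\<close>, of norm at
  most \<open>exp (2 h |x|)\<close>; stability thus comes from the exact flow and not from the
  field. The method works for a time that depends only on a bound for the starting point. The
  logarithm of the exact curve is bounded on \<open>[0, 1]\<close> by compactness, so the same time
  serves at every restart.\<close>

abbreviation pnorm :: "'a::real_normed_vector list \<Rightarrow> real"
  where "pnorm vs \<equiv> prod_list (map norm vs)"

lemma pnorm_nonneg: "0 \<le> pnorm vs"
  by (induction vs) auto

text \<open>Explicit derivative formulas yield quadratic remainders, and these give the required
  bound \<open>e * norm (y - x)\<close> once \<open>norm (y - x) < e / (\<bar>C\<bar> + 1)\<close>.
  A single \<open>D\<close> on lists of all lengths serves every order at once.\<close>

lemma smooth_onI:
  assumes f: "\<And>x. x \<in> U \<Longrightarrow> D x [] = f x"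
    and ml: "\<And>k x. x \<in> U \<Longrightarrow> bounded_multilinear k (D x)"
    and rem: "\<And>k x. x \<in> U \<Longrightarrow> \<exists>C. \<exists>r>0. \<forall>y\<in>U. norm (y - x) < r \<longrightarrow>
      (\<forall>vs. length vs = k \<longrightarrow>
        norm (D y vs - D x vs - D x ((y - x) # vs)) \<le> C * (norm (y - x))\<^sup>2 * pnorm vs)"
  shows "smooth_on U f"
  unfolding smooth_on_def
proof (intro exI[of _ D] conjI ballI allI impI)
  fix k x and e :: real assume x: "x \<in> U" and e: "0 < e"
  from rem[OF x] obtain C r where r: "r > 0"
    and C: "\<And>y vs. y \<in> U \<Longrightarrow> norm (y - x) < r \<Longrightarrow> length vs = k \<Longrightarrow>
      norm (D y vs - D x vs - D x ((y - x) # vs)) \<le> C * (norm (y - x))\<^sup>2 * pnorm vs"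
    by metis
  define d where "d = min r (e / (\<bar>C\<bar> + 1))"
  show "\<exists>d>0. \<forall>y\<in>U. norm (y - x) < d \<longrightarrow> (\<forall>vs. length vs = k \<longrightarrow>
      norm (D y vs - D x vs - D x ((y - x) # vs)) \<le> e * norm (y - x) * pnorm vs)"
  proof (intro exI[of _ d] conjI ballI impI allI)
    show "d > 0" using r e by (simp add: d_def)
    fix y and vs :: "'a list" assume y: "y \<in> U" "norm (y - x) < d" "length vs = k"
    have "norm (y - x) * (\<bar>C\<bar> + 1) \<le> e"
      using y(2) by (simp add: d_def field_simps)
    moreover have "C * norm (y - x) \<le> norm (y - x) * (\<bar>C\<bar> + 1)"
      using mult_right_mono[of C "\<bar>C\<bar> + 1" "norm (y - x)"] by (simp add: mult.commute)
    ultimately have "C * norm (y - x) * (norm (y - x) * pnorm vs) \<le> e * (norm (y - x) * pnorm vs)"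
      by (intro mult_right_mono) (auto simp: pnorm_nonneg)
    then show "norm (D y vs - D x vs - D x ((y - x) # vs)) \<le> e * norm (y - x) * pnorm vs"
      using C[OF y(1) _ y(3)] y(2) by (fastforce simp: d_def power2_eq_square algebra_simps)
  qed
qed (use f ml in auto)

lemma smooth_onE:
  assumes "smooth_on U f"
  obtains D where "\<And>x. x \<in> U \<Longrightarrow> D x [] = f x"
    "\<And>k x. x \<in> U \<Longrightarrow> bounded_multilinear k (D x)"
    "\<And>k x e. x \<in> U \<Longrightarrow> e > 0 \<Longrightarrow> \<exists>d>0. \<forall>y\<in>U. norm (y - x) < d \<longrightarrow>
        (\<forall>vs. length vs = k \<longrightarrow>
          norm (D y vs - D x vs - D x ((y - x) # vs)) \<le> e * norm (y - x) * pnorm vs)"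
proof -
  from assms obtain D where D: "(\<forall>x\<in>U. D x [] = f x) \<and>
      (\<forall>k. \<forall>x\<in>U. bounded_multilinear k (D x)) \<and>
      (\<forall>k. \<forall>x\<in>U. \<forall>e>0. \<exists>d>0. \<forall>y\<in>U. norm (y - x) < d \<longrightarrow>
        (\<forall>vs. length vs = k \<longrightarrow>
          norm (D y vs - D x vs - D x ((y - x) # vs)) \<le> e * norm (y - x) * pnorm vs))"
    unfolding smooth_on_def by (rule exE)
  show thesis
    by (rule that[of D])
      (rule D[THEN conjunct1, rule_format] D[THEN conjunct2, THEN conjunct1, rule_format]
        D[THEN conjunct2, THEN conjunct2, rule_format]; assumption)+
qed

lemma smooth_on_subset:
  assumes "smooth_on U f" "V \<subseteq> U" "\<And>x. x \<in> V \<Longrightarrow> f x = g x"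
  shows "smooth_on V g"
proof -
  obtain D where D0: "\<And>x. x \<in> U \<Longrightarrow> D x [] = f x"
    and D1: "\<And>k x. x \<in> U \<Longrightarrow> bounded_multilinear k (D x)"
    and D2: "\<And>k x e. x \<in> U \<Longrightarrow> e > 0 \<Longrightarrow> \<exists>d>0. \<forall>y\<in>U. norm (y - x) < d \<longrightarrow>
        (\<forall>vs. length vs = k \<longrightarrow>
          norm (D y vs - D x vs - D x ((y - x) # vs)) \<le> e * norm (y - x) * pnorm vs)"
    using smooth_onE[OF assms(1)] by blast
  show ?thesis
    unfolding smooth_on_def
  proof (intro exI[of _ D] conjI ballI allI impI)
    fix k x and e :: real assume "x \<in> V" "e > 0"
    then obtain d where "d > 0" "\<forall>y\<in>U. norm (y - x) < d \<longrightarrow> (\<forall>vs. length vs = k \<longrightarrow>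
          norm (D y vs - D x vs - D x ((y - x) # vs)) \<le> e * norm (y - x) * pnorm vs)"
      using D2 assms(2) by (metis subsetD)
    then show "\<exists>d>0. \<forall>y\<in>V. norm (y - x) < d \<longrightarrow> (\<forall>vs. length vs = k \<longrightarrow>
          norm (D y vs - D x vs - D x ((y - x) # vs)) \<le> e * norm (y - x) * pnorm vs)"
      using assms(2) by (intro exI[of _ d]) blast
  qed (use D0 D1 assms in auto)
qed

lemma pnorm_map_le:
  assumes "0 \<le> K" "\<And>v. norm (j v) \<le> K * norm v"
  shows "pnorm (map j vs) \<le> K ^ length vs * pnorm vs"
proof (induction vs)
  case (Cons v vs)
  have "norm (j v) * pnorm (map j vs) \<le> (K * norm v) * (K ^ length vs * pnorm vs)"
    by (rule mult_mono[OF assms(2) Cons]) (use assms(1) pnorm_nonneg[of "map j vs"] in auto)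
  then show ?case by (simp add: mult_ac o_def)
qed simp

text \<open>Transfers smoothness from \<open>hsa\<close> to \<open>hsr\<close>, with
  \<open>j\<close> the embedding and \<open>g\<close> the projection onto selfadjoint parts.\<close>

lemma smooth_on_linear_compose:
  fixes j :: "'a::real_normed_vector \<Rightarrow> 'b::real_normed_vector"
  assumes f: "smooth_on U f" and j: "bounded_linear j" and g: "bounded_linear g"
  shows "smooth_on (j -` U) (\<lambda>x. g (f (j x)))"
proof -
  interpret j: bounded_linear j by (rule j)
  interpret g: bounded_linear g by (rule g)
  obtain K where K: "K > 0" "\<And>v. norm (j v) \<le> K * norm v"
    using j.pos_bounded by (auto simp: mult.commute)
  obtain L where L: "L > 0" "\<And>v. norm (g v) \<le> L * norm v"
    using g.pos_bounded by (auto simp: mult.commute)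
  have pj: "pnorm (map j vs) \<le> K ^ length vs * pnorm vs" for vs
    by (rule pnorm_map_le) (use K in auto)
  obtain D where D0: "\<And>x. x \<in> U \<Longrightarrow> D x [] = f x"
    and D1: "\<And>k x. x \<in> U \<Longrightarrow> bounded_multilinear k (D x)"
    and D2: "\<And>k x e. x \<in> U \<Longrightarrow> e > 0 \<Longrightarrow> \<exists>d>0. \<forall>y\<in>U. norm (y - x) < d \<longrightarrow>
        (\<forall>vs. length vs = k \<longrightarrow>
          norm (D y vs - D x vs - D x ((y - x) # vs)) \<le> e * norm (y - x) * pnorm vs)"
    using smooth_onE[OF f] by blast
  show ?thesis
    unfolding smooth_on_def
  proof (intro exI[of _ "\<lambda>x vs. g (D (j x) (map j vs))"] conjI ballI allI impI)
    fix x assume "x \<in> j -` U" then show "g (D (j x) (map j [])) = g (f (j x))" by (simp add: D0)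
  next
    fix k x assume "x \<in> j -` U"
    then have bm: "bounded_multilinear k (D (j x))" using D1 by simp
    then obtain C where C: "\<And>vs. length vs = k \<Longrightarrow> norm (D (j x) vs) \<le> C * pnorm vs"
      unfolding bounded_multilinear_def by blast
    show "bounded_multilinear k (\<lambda>vs. g (D (j x) (map j vs)))"
      unfolding bounded_multilinear_def
    proof (intro conjI exI[of _ "L * (\<bar>C\<bar> * K ^ k)"] allI impI)
      fix vs :: "'a list" assume l: "length vs = k"
      have "norm (g (D (j x) (map j vs))) \<le> L * norm (D (j x) (map j vs))" by (rule L)
      also have "\<dots> \<le> L * (C * pnorm (map j vs))"
        using C[of "map j vs"] L(1) l by (intro mult_left_mono) auto
      also have "\<dots> \<le> L * (\<bar>C\<bar> * (K ^ k * pnorm vs))"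
        using L(1) pj[of vs] l pnorm_nonneg[of "map j vs"]
        by (intro mult_left_mono order_trans[OF mult_right_mono mult_left_mono]) auto
      finally show "norm (g (D (j x) (map j vs))) \<le> L * (\<bar>C\<bar> * K ^ k) * pnorm vs"
        by (simp add: mult_ac)
    qed (use bm in \<open>auto simp: bounded_multilinear_def j.add j.scaleR g.add g.scaleR\<close>)
  next
    fix k x and e :: real assume x: "x \<in> j -` U" and e: "e > 0"
    \<comment> \<open>\<open>L\<close> comes from \<open>g\<close>, one factor \<open>K\<close> from
      \<open>norm (j y - j x)\<close> and \<open>K ^ k\<close> from the \<open>k\<close> mapped
      directions; the quotient cancels them.\<close>
    define e' where "e' = e / (L * K * K ^ k)"
    have e': "e' > 0" using e K L by (simp add: e'_def)
    obtain d where d: "d > 0" "\<And>y vs. y \<in> U \<Longrightarrow> norm (y - j x) < d \<Longrightarrow> length vs = k \<Longrightarrow>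
          norm (D y vs - D (j x) vs - D (j x) ((y - j x) # vs)) \<le> e' * norm (y - j x) * pnorm vs"
      using D2[OF _ e'] x by (metis vimageD)
    show "\<exists>d>0. \<forall>y\<in>j -` U. norm (y - x) < d \<longrightarrow> (\<forall>vs. length vs = k \<longrightarrow>
        norm (g (D (j y) (map j vs)) - g (D (j x) (map j vs)) - g (D (j x) (map j ((y - x) # vs))))
          \<le> e * norm (y - x) * pnorm vs)"
    proof (intro exI[of _ "d / K"] conjI ballI impI allI)
      show "d / K > 0" using d K by simp
      fix y and vs :: "'a list" assume y: "y \<in> j -` U" "norm (y - x) < d / K" and l: "length vs = k"
      let ?E = "D (j y) (map j vs) - D (j x) (map j vs) - D (j x) ((j y - j x) # map j vs)"
      have n: "norm (j y - j x) \<le> K * norm (y - x)" using K(2)[of "y - x"] by (simp add: j.diff)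
      also have "\<dots> < d" using y(2) K(1) by (simp add: field_simps)
      finally have "norm ?E \<le> e' * norm (j y - j x) * pnorm (map j vs)"
        using d(2)[of "j y" "map j vs"] y(1) l by simp
      also have "\<dots> \<le> e' * (K * norm (y - x)) * (K ^ k * pnorm vs)"
        using n pj[of vs] l e' K(1) pnorm_nonneg[of "map j vs"]
        by (intro mult_mono) auto
      finally have "L * norm ?E \<le> L * (e' * (K * norm (y - x)) * (K ^ k * pnorm vs))"
        using L(1) by (intro mult_left_mono) auto
      also have "\<dots> = e * norm (y - x) * pnorm vs"
        using L K by (simp add: e'_def)
      finally show "norm (g (D (j y) (map j vs)) - g (D (j x) (map j vs))
          - g (D (j x) (map j ((y - x) # vs)))) \<le> e * norm (y - x) * pnorm vs"
        using L(2)[of ?E] by (simp add: g.diff j.diff)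
    qed
  qed
qed

lemma smooth_on_imp_continuous_on:
  assumes "smooth_on U f"
  shows "continuous_on U f"
  unfolding continuous_on_iff
proof (intro ballI allI impI)
  fix x and e :: real assume x: "x \<in> U" and e: "e > 0"
  obtain D where D0: "\<And>x. x \<in> U \<Longrightarrow> D x [] = f x"
    and D1: "\<And>k x. x \<in> U \<Longrightarrow> bounded_multilinear k (D x)"
    and D2: "\<And>k x e. x \<in> U \<Longrightarrow> e > 0 \<Longrightarrow> \<exists>d>0. \<forall>y\<in>U. norm (y - x) < d \<longrightarrow>
        (\<forall>vs. length vs = k \<longrightarrow>
          norm (D y vs - D x vs - D x ((y - x) # vs)) \<le> e * norm (y - x) * pnorm vs)"
    using smooth_onE[OF assms] by blast
  obtain d where d: "d > 0"
    "\<And>y. y \<in> U \<Longrightarrow> norm (y - x) < d \<Longrightarrow> norm (f y - f x - D x [y - x]) \<le> norm (y - x)"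
    using D2[OF x, of 1 0] x D0 by auto
  obtain C where "\<And>vs. length vs = 1 \<Longrightarrow> norm (D x vs) \<le> C * pnorm vs"
    using D1[OF x, of 1] unfolding bounded_multilinear_def by blast
  from this[of "[_]"] have C: "norm (D x [v]) \<le> C * norm v" for v by simp
  \<comment> \<open>Order 0 with tolerance 1 gives the local Lipschitz constant
    \<open>1 + \<bar>C\<bar>\<close>; the additional 1 makes the last inequality strict.\<close>
  define r where "r = min d (e / (\<bar>C\<bar> + 2))"
  show "\<exists>r>0. \<forall>y\<in>U. dist y x < r \<longrightarrow> dist (f y) (f x) < e"
  proof (intro exI[of _ r] conjI ballI impI)
    show "r > 0" using d e by (simp add: r_def)
    fix y assume y: "y \<in> U" "dist y x < r"
    have "norm (f y - f x) \<le> norm (f y - f x - D x [y - x]) + norm (D x [y - x])"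
      by (rule norm_triangle_sub[of _ "D x [y - x]", THEN order_trans]) simp
    also have "\<dots> \<le> norm (y - x) + \<bar>C\<bar> * norm (y - x)"
      using d(2)[OF y(1)] C[of "y - x"] y(2) mult_right_mono[OF abs_ge_self[of C] norm_ge_zero[of "y - x"]]
      by (intro add_mono) (auto simp: r_def dist_norm)
    also have "\<dots> < (\<bar>C\<bar> + 2) * r"
    proof -
      have "(1 + \<bar>C\<bar>) * norm (y - x) \<le> (1 + \<bar>C\<bar>) * r" using y by (intro mult_left_mono) (auto simp: dist_norm)
      then show ?thesis using \<open>r > 0\<close> by (simp add: algebra_simps)
    qed
    also have "\<dots> \<le> e"
    proof -
      have "r \<le> e / (\<bar>C\<bar> + 2)" by (simp add: r_def)
      then show ?thesis by (simp add: pos_le_divide_eq mult.commute)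
    qed
    finally show "dist (f y) (f x) < e" by (simp add: dist_norm)
  qed
qed


subsection \<open>The Leibniz rule for lists of directions\<close>

text \<open>\<open>leib F vs\<close> is the sum, over all positions \<open>i\<close>, of \<open>vs ! i * F\<close> applied to \<open>vs\<close> with position
  \<open>i\<close> removed. If \<open>F\<close> collects the derivatives of \<open>f\<close> at \<open>x\<close>, then \<open>leib_mult (x - c) F\<close> collects
  those of \<open>\<lambda>x. (x - c) * f x\<close>.\<close>

primrec leib :: "('a::real_normed_algebra_1 list \<Rightarrow> 'a) \<Rightarrow> 'a list \<Rightarrow> 'a" where
  "leib F [] = 0"
| "leib F (v # vs) = v * F vs + leib (\<lambda>ws. F (v # ws)) vs"

definition leib_mult :: "'a::real_normed_algebra_1 \<Rightarrow> ('a list \<Rightarrow> 'a) \<Rightarrow> 'a list \<Rightarrow> 'a"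
  where "leib_mult a F vs = a * F vs + leib F vs"

lemma leib_cong:
  "(\<And>ws. Suc (length ws) = length vs \<Longrightarrow> F ws = G ws) \<Longrightarrow> leib F vs = leib G vs"
proof (induction vs arbitrary: F G)
  case (Cons v vs)
  have "leib (\<lambda>ws. F (v # ws)) vs = leib (\<lambda>ws. G (v # ws)) vs"
    by (rule Cons.IH) (simp add: Cons.prems)
  then show ?case using Cons.prems[of vs] by simp
qed simp

lemma leib_add: "leib (\<lambda>ws. F ws + G ws) vs = leib F vs + leib G vs"
  by (induction vs arbitrary: F G) (simp_all add: algebra_simps)

lemma leib_scaleR: "leib (\<lambda>ws. r *\<^sub>R F ws) vs = r *\<^sub>R leib F vs"
  by (induction vs arbitrary: F) (simp_all add: algebra_simps)

lemma leib_diff: "leib (\<lambda>ws. F ws - G ws) vs = leib F vs - leib G vs"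
  by (induction vs arbitrary: F G) (simp_all add: algebra_simps)

text \<open>There is one summand per position, and each is at most \<open>C * pnorm vs\<close>
  because the entry removed from the list reappears as a factor.\<close>

lemma norm_leib_le:
  assumes "\<And>ws. Suc (length ws) = length vs \<Longrightarrow> norm (F ws) \<le> C * pnorm ws"
  shows "norm (leib F vs) \<le> real (length vs) * C * pnorm vs"
  using assms
proof (induction vs arbitrary: F C)
  case (Cons v vs)
  have "norm (leib (\<lambda>ws. F (v # ws)) vs) \<le> real (length vs) * (C * norm v) * pnorm vs"
    proof (rule Cons.IH)
    fix ws :: "'a list" assume "Suc (length ws) = length vs"
    then show "norm (F (v # ws)) \<le> C * norm v * pnorm ws"
      using Cons.prems[of "v # ws"] by (simp add: mult.assoc)
  qed
  moreover have "norm (v * F vs) \<le> norm v * (C * pnorm vs)"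
    using Cons.prems[of vs] by (intro order_trans[OF norm_mult_ineq] mult_left_mono) auto
  ultimately show ?case
    by (simp add: algebra_simps) (smt (verit) norm_triangle_ineq)
qed simp

section \<open>Multilinearity of functions on lists\<close>

definition multilin :: "nat \<Rightarrow> ('a::real_normed_vector list \<Rightarrow> 'b::real_normed_vector) \<Rightarrow> bool"
  where "multilin k F \<longleftrightarrow>
    (\<forall>us v w vs. length us + length vs + 1 = k \<longrightarrow>
        F (us @ (v + w) # vs) = F (us @ v # vs) + F (us @ w # vs)) \<and>
    (\<forall>us r v vs. length us + length vs + 1 = k \<longrightarrow>
        F (us @ (r *\<^sub>R v) # vs) = r *\<^sub>R F (us @ v # vs))"

lemma multilinI:
  assumes "\<And>us v w vs. length us + length vs + 1 = k \<Longrightarrow>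
        F (us @ (v + w) # vs) = F (us @ v # vs) + F (us @ w # vs)"
    "\<And>us r v vs. length us + length vs + 1 = k \<Longrightarrow>
        F (us @ (r *\<^sub>R v) # vs) = r *\<^sub>R F (us @ v # vs)"
  shows "multilin k F"
  using assms by (simp add: multilin_def)

lemma multilin_add:
  assumes "multilin k F" "length us + length vs + 1 = k"
  shows "F (us @ (v + w) # vs) = F (us @ v # vs) + F (us @ w # vs)"
  using assms unfolding multilin_def by blast

lemma multilin_scaleR:
  assumes "multilin k F" "length us + length vs + 1 = k"
  shows "F (us @ (r *\<^sub>R v) # vs) = r *\<^sub>R F (us @ v # vs)"
  using assms unfolding multilin_def by blast

lemma bounded_multilinearI:
  "multilin k F \<Longrightarrow> (\<And>vs. length vs = k \<Longrightarrow> norm (F vs) \<le> C * pnorm vs) \<Longrightarrow> bounded_multilinear k F"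
  unfolding multilin_def bounded_multilinear_def by blast

lemma multilin_0: "multilin 0 F"
  by (simp add: multilin_def)

lemma multilin_Cons:
  assumes "multilin (Suc k) F" shows "multilin k (\<lambda>ws. F (v # ws))"
proof (rule multilinI)
  fix us vs :: "'a list" and u w assume "length us + length vs + 1 = k"
  then show "F (v # us @ (u + w) # vs) = F (v # us @ u # vs) + F (v # us @ w # vs)"
    using multilin_add[OF assms, of "v # us" vs] by simp
next
  fix us vs :: "'a list" and r u assume "length us + length vs + 1 = k"
  then show "F (v # us @ (r *\<^sub>R u) # vs) = r *\<^sub>R F (v # us @ u # vs)"
    using multilin_scaleR[OF assms, of "v # us" vs] by simp
qed

lemma multilin_leib:
  assumes "multilin k F"
  shows "multilin (Suc k) (leib F)"
proof (rule multilinI)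
  fix us vs :: "'a list" and v w assume "length us + length vs + 1 = Suc k"
  then show "leib F (us @ (v + w) # vs) = leib F (us @ v # vs) + leib F (us @ w # vs)"
    using assms
  proof (induction us arbitrary: k F)
    case Nil
    have "leib (\<lambda>ws. F ((v + w) # ws)) vs = leib (\<lambda>ws. F (v # ws) + F (w # ws)) vs"
      by (rule leib_cong) (use Nil multilin_add[OF Nil(2), of "[]"] in simp)
    then show ?case by (simp add: leib_add algebra_simps)
  next
    case (Cons u us)
    then obtain k' where k: "k = Suc k'" by (cases k) auto
    have "leib (\<lambda>ws. F (u # ws)) (us @ (v + w) # vs)
        = leib (\<lambda>ws. F (u # ws)) (us @ v # vs) + leib (\<lambda>ws. F (u # ws)) (us @ w # vs)"
      by (rule Cons.IH[of k']) (use Cons.prems k in \<open>auto intro!: multilin_Cons\<close>)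
    then show ?case
      using multilin_add[OF Cons.prems(2), of us vs v w] Cons.prems(1) by (simp add: algebra_simps)
  qed
next
  fix us vs :: "'a list" and r v assume "length us + length vs + 1 = Suc k"
  then show "leib F (us @ (r *\<^sub>R v) # vs) = r *\<^sub>R leib F (us @ v # vs)"
    using assms
  proof (induction us arbitrary: k F)
    case Nil
    have "leib (\<lambda>ws. F ((r *\<^sub>R v) # ws)) vs = leib (\<lambda>ws. r *\<^sub>R F (v # ws)) vs"
      by (rule leib_cong) (use Nil multilin_scaleR[OF Nil(2), of "[]"] in simp)
    then show ?case by (simp add: leib_scaleR algebra_simps)
  next
    case (Cons u us)
    then obtain k' where k: "k = Suc k'" by (cases k) auto
    have "leib (\<lambda>ws. F (u # ws)) (us @ (r *\<^sub>R v) # vs) = r *\<^sub>R leib (\<lambda>ws. F (u # ws)) (us @ v # vs)"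
      by (rule Cons.IH[of k']) (use Cons.prems k in \<open>auto intro!: multilin_Cons\<close>)
    then show ?case
      using multilin_scaleR[OF Cons.prems(2), of us vs r v] Cons.prems(1) by (simp add: algebra_simps)
  qed
qed

lemma multilin_mult: "multilin k F \<Longrightarrow> multilin k (\<lambda>vs. a * F vs)"
  for F :: "_ \<Rightarrow> 'a::real_normed_algebra"
  by (auto simp: multilin_def algebra_simps)

lemma multilin_plus: "multilin k F \<Longrightarrow> multilin k G \<Longrightarrow> multilin k (\<lambda>vs. F vs + G vs)"
  by (auto simp: multilin_def algebra_simps)

lemma multilin_leib_mult:
  assumes "\<And>k. multilin k F"
  shows "multilin k (leib_mult a F)"
proof -
  have "multilin k (leib F)" by (cases k) (simp_all add: multilin_0 multilin_leib assms)
  then show ?thesis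
    unfolding leib_mult_def by (intro multilin_plus multilin_mult assms)
qed

lemma norm_leib_mult_le:
  assumes "\<And>ws. Suc (length ws) = length vs \<Longrightarrow> norm (F ws) \<le> C * pnorm ws"
    and "norm (F vs) \<le> C' * pnorm vs"
  shows "norm (leib_mult a F vs) \<le> (norm a * C' + real (length vs) * C) * pnorm vs"
proof -
  have "norm (a * F vs) \<le> norm a * (C' * pnorm vs)"
    using assms(2) by (intro order_trans[OF norm_mult_ineq] mult_left_mono) auto
  then show ?thesis
    using norm_leib_le[OF assms(1)] unfolding leib_mult_def
    by (simp add: algebra_simps) (smt (verit) norm_triangle_ineq)
qed

definition taylor_rem :: "('a::real_normed_vector list \<Rightarrow> 'b::real_normed_vector) \<Rightarrow> ('a list \<Rightarrow> 'b) \<Rightarrow> 'a \<Rightarrow> 'a list \<Rightarrow> 'b"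
  where "taylor_rem G F h vs = G vs - F vs - F (h # vs)"

text \<open>Product rule for remainders: the factor \<open>a\<close> is affine in the base point and
  has no remainder of its own, so beyond the remainder of the other factor only the quadratic term
  \<open>h * F (h # vs)\<close> appears. It drives the induction for powers and the estimate for the
  logarithm.\<close>

lemma taylor_rem_leib_mult:
  "taylor_rem (leib_mult (a + h) G) (leib_mult a F) h vs
    = leib_mult (a + h) (taylor_rem G F h) vs + h * F (h # vs)"
proof -
  have "leib (taylor_rem G F h) vs = leib G vs - leib F vs - leib (\<lambda>ws. F (h # ws)) vs"
    unfolding taylor_rem_def by (simp add: leib_diff)
  then show ?thesis
    by (simp add: taylor_rem_def leib_mult_def algebra_simps)
qed


subsection \<open>Smoothness of the exponential\<close>

text \<open>All derivatives of \<open>\<lambda>x. x ^ n\<close> at \<open>x\<close>, generated by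
  the product rule for \<open>x * x ^ n\<close>; the constant 1 has a nonzero value at order 0
  only.\<close>

primrec pow_tower :: "nat \<Rightarrow> 'a::real_normed_algebra_1 \<Rightarrow> 'a list \<Rightarrow> 'a" where
  "pow_tower 0 x = (\<lambda>vs. if vs = [] then 1 else 0)"
| "pow_tower (Suc n) x = leib_mult x (pow_tower n x)"

lemma pow_tower_Nil: "pow_tower n x [] = x ^ n"
  by (induction n) (simp_all add: leib_mult_def)

lemma multilin_pow_tower: "multilin k (pow_tower n x)"
proof (induction n arbitrary: k)
  case 0
  show ?case by (simp add: multilin_def)
qed (simp add: multilin_leib_mult)

text \<open>The bound grows geometrically in \<open>n\<close> at fixed order \<open>k\<close>, hence
  is summable against \<open>1 / fact n\<close>. It reproduces itself because
  \<open>r * k! + k * (k - 1)!\<close> is at most \<open>(r + 1) * k!\<close>.\<close>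

lemma norm_pow_tower_le:
  assumes "norm x \<le> r"
  shows "norm (pow_tower n x vs) \<le> (fact (length vs) * (r + 1) ^ n) * pnorm vs"
proof (induction n arbitrary: vs)
  case 0
  show ?case by (simp add: pnorm_nonneg)
next
  case (Suc n)
  have r: "0 \<le> r" using assms norm_ge_zero order_trans by blast
  let ?q = "(r + 1) ^ n" and ?k = "length vs"
  have *: "norm (pow_tower (Suc n) x vs)
      \<le> (norm x * (fact ?k * ?q) + real ?k * (fact (?k - 1) * ?q)) * pnorm vs"
    unfolding pow_tower.simps
  proof (rule norm_leib_mult_le)
    fix ws :: "'a list" assume "Suc (length ws) = ?k"
    then have "length ws = ?k - 1" by simp
    then show "norm (pow_tower n x ws) \<le> fact (?k - 1) * ?q * pnorm ws" using Suc[of ws] by simp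
  qed (rule Suc)
  have "real ?k * (fact (?k - 1) * ?q) \<le> fact ?k * ?q"
    using r by (cases ?k) auto
  moreover have "norm x * (fact ?k * ?q) \<le> r * (fact ?k * ?q)"
    using r assms by (intro mult_right_mono) auto
  moreover have "fact ?k * (r + 1) ^ Suc n = r * (fact ?k * ?q) + fact ?k * ?q"
    by (simp add: algebra_simps)
  ultimately have "norm x * (fact ?k * ?q) + real ?k * (fact (?k - 1) * ?q)
      \<le> fact ?k * (r + 1) ^ Suc n"
    by linarith
  from order_trans[OF * mult_right_mono[OF this pnorm_nonneg]] show ?case .
qed

text \<open>The factorial is shifted by 2 so that the induction absorbs both the Leibniz sum and the
  new quadratic term: \<open>k * (k + 1)! + (k + 1)!\<close> is at most
  \<open>(k + 2)!\<close>.\<close>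

lemma taylor_rem_pow_tower_le:
  assumes "norm x \<le> r" "norm (x + h) \<le> r"
  shows "norm (taylor_rem (pow_tower n (x + h)) (pow_tower n x) h vs)
    \<le> (fact (length vs + 2) * (r + 1) ^ n * (norm h)\<^sup>2) * pnorm vs"
proof (induction n arbitrary: vs)
  case 0
  show ?case using assms by (simp add: taylor_rem_def pnorm_nonneg)
next
  case (Suc n)
  have r: "0 \<le> r" using assms norm_ge_zero order_trans by blast
  let ?q = "(r + 1) ^ n * (norm h)\<^sup>2" and ?k = "length vs"
  let ?T = "taylor_rem (pow_tower n (x + h)) (pow_tower n x) h"
  have eq: "taylor_rem (pow_tower (Suc n) (x + h)) (pow_tower (Suc n) x) h vs
     = leib_mult (x + h) ?T vs + h * pow_tower n x (h # vs)"
    by (simp add: taylor_rem_leib_mult)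
  have 1: "norm (leib_mult (x + h) ?T vs)
      \<le> (norm (x + h) * (fact (?k + 2) * ?q) + real ?k * (fact (?k + 1) * ?q)) * pnorm vs"
  proof (rule norm_leib_mult_le)
    fix ws :: "'a list" assume "Suc (length ws) = ?k"
    then have "length ws + 2 = ?k + 1" by simp
    then show "norm (?T ws) \<le> fact (?k + 1) * ?q * pnorm ws" using Suc[of ws] by (metis mult.assoc)
  qed (use Suc[of vs] in \<open>simp only: mult.assoc\<close>)
  have "norm (h * pow_tower n x (h # vs)) \<le> norm h * (fact (?k + 1) * (r + 1) ^ n * (norm h * pnorm vs))"
    using norm_pow_tower_le[OF assms(1), of n "h # vs"]
    by (intro order_trans[OF norm_mult_ineq] mult_left_mono) auto
  then have 2: "norm (h * pow_tower n x (h # vs)) \<le> (fact (?k + 1) * ?q) * pnorm vs"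
    by (simp add: power2_eq_square mult_ac)
  have q: "0 \<le> ?q" using r by simp
  have "norm (x + h) * (fact (?k + 2) * ?q) \<le> r * (fact (?k + 2) * ?q)"
    using q assms by (intro mult_right_mono) auto
  moreover have "real ?k * (fact (?k + 1) * ?q) + fact (?k + 1) * ?q \<le> fact (?k + 2) * ?q"
    using q by (simp add: algebra_simps)
  ultimately have "norm (x + h) * (fact (?k + 2) * ?q) + real ?k * (fact (?k + 1) * ?q)
      + fact (?k + 1) * ?q \<le> fact (?k + 2) * ((r + 1) * ?q)"
    by (simp add: algebra_simps)
  from mult_right_mono[OF this pnorm_nonneg[of vs]] 1 2 show ?case
    unfolding eq by (intro norm_triangle_le) (simp add: algebra_simps)
qed

definition exp_tower :: "'a::{real_normed_algebra_1,banach} \<Rightarrow> 'a list \<Rightarrow> 'a"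
  where "exp_tower x vs = (\<Sum>n. pow_tower n x vs /\<^sub>R fact n)"

lemma sums_exp_bound: "(\<lambda>n. A * (r ^ n / fact n) * B) sums (A * exp (r::real) * B)"
  using exp_converges[of r] by (intro sums_mult sums_mult2) (simp add: divide_inverse mult.commute)

lemma norm_sums_le:
  fixes f :: "nat \<Rightarrow> 'a::banach"
  assumes "f sums s" "\<And>n. norm (f n) \<le> g n" "g sums t"
  shows "norm s \<le> t"
  using norm_suminf_le[of f g] assms by (metis sums_summable sums_unique)

lemma exp_tower_sums: "(\<lambda>n. pow_tower n x vs /\<^sub>R fact n) sums exp_tower x vs"
proof -
  have "summable (\<lambda>n. pow_tower n x vs /\<^sub>R fact n)"
  proof (rule summable_comparison_test')
    show "summable (\<lambda>n. fact (length vs) * ((norm x + 1) ^ n / fact n) * pnorm vs)"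
      using sums_exp_bound sums_summable by blast
    show "norm (pow_tower n x vs /\<^sub>R fact n) \<le> fact (length vs) * ((norm x + 1) ^ n / fact n) * pnorm vs"
      for n using norm_pow_tower_le[of x "norm x" n vs] by (simp add: field_simps)
  qed
  then show ?thesis unfolding exp_tower_def by (rule summable_sums)
qed

lemma multilin_exp_tower: "multilin k (exp_tower x)"
proof (rule multilinI)
  fix us vs :: "'a list" and v w assume l: "length us + length vs + 1 = k"
  show "exp_tower x (us @ (v + w) # vs) = exp_tower x (us @ v # vs) + exp_tower x (us @ w # vs)"
    by (rule sums_unique2[OF exp_tower_sums])
      (use sums_add[OF exp_tower_sums[of x "us @ v # vs"] exp_tower_sums[of x "us @ w # vs"]]
        multilin_add[OF multilin_pow_tower l] in \<open>simp add: scaleR_add_right\<close>)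
next
  fix us vs :: "'a list" and r v assume l: "length us + length vs + 1 = k"
  show "exp_tower x (us @ (r *\<^sub>R v) # vs) = r *\<^sub>R exp_tower x (us @ v # vs)"
    by (rule sums_unique2[OF exp_tower_sums])
      (use sums_scaleR_right[OF exp_tower_sums[of x "us @ v # vs"], of r]
        multilin_scaleR[OF multilin_pow_tower l] in \<open>simp add: mult.commute\<close>)
qed

lemma taylor_rem_exp_tower_le:
  assumes "norm x \<le> r" "norm (x + h) \<le> r"
  shows "norm (taylor_rem (exp_tower (x + h)) (exp_tower x) h vs)
    \<le> fact (length vs + 2) * exp (r + 1) * ((norm h)\<^sup>2 * pnorm vs)"
proof (rule norm_sums_le)
  let ?T = "\<lambda>n. taylor_rem (pow_tower n (x + h)) (pow_tower n x) h vs"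
  show "(\<lambda>n. ?T n /\<^sub>R fact n) sums taylor_rem (exp_tower (x + h)) (exp_tower x) h vs"
    unfolding taylor_rem_def scaleR_diff_right by (intro sums_diff exp_tower_sums)
  show "norm (?T n /\<^sub>R fact n) \<le> fact (length vs + 2) * ((r + 1) ^ n / fact n) * ((norm h)\<^sup>2 * pnorm vs)" for n
    using taylor_rem_pow_tower_le[OF assms, of n vs] by (simp add: field_simps del: fact_Suc)
  show "(\<lambda>n. fact (length vs + 2) * ((r + 1) ^ n / fact n) * ((norm h)\<^sup>2 * pnorm vs)) sums
    (fact (length vs + 2) * exp (r + 1) * ((norm h)\<^sup>2 * pnorm vs))"
    by (rule sums_exp_bound)
qed

lemma exp_tower_Nil: "exp_tower x [] = exp x"
  by (simp add: exp_tower_def exp_def pow_tower_Nil)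

lemma smooth_on_exp: "smooth_on UNIV (exp :: 'a::{real_normed_algebra_1,banach} \<Rightarrow> 'a)"
proof (rule smooth_onI[where D=exp_tower])
  fix x :: 'a
  show "exp_tower x [] = exp x" by (rule exp_tower_Nil)
  fix k
  show "bounded_multilinear k (exp_tower x)"
  proof (rule bounded_multilinearI[OF multilin_exp_tower])
    fix vs :: "'a list" assume l: "length vs = k"
    show "norm (exp_tower x vs) \<le> fact k * exp (norm x + 1) * pnorm vs"
      by (rule norm_sums_le[OF exp_tower_sums _ sums_exp_bound])
        (use norm_pow_tower_le[of x "norm x" _ vs] l in \<open>simp add: field_simps\<close>)
  qed
  show "\<exists>C. \<exists>r>0. \<forall>y\<in>UNIV. norm (y - x) < r \<longrightarrow> (\<forall>vs. length vs = k \<longrightarrow>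
      norm (exp_tower y vs - exp_tower x vs - exp_tower x ((y - x) # vs))
        \<le> C * (norm (y - x))\<^sup>2 * pnorm vs)"
  proof (rule exI[of _ "fact (k + 2) * exp (norm x + 1 + 1)"], rule exI[of _ 1],
      intro conjI ballI impI allI)
    fix y and vs :: "'a list" assume y: "norm (y - x) < (1::real)" and l: "length vs = k"
    have "norm (x + (y - x)) \<le> norm x + norm (y - x)" by (rule norm_triangle_ineq)
    with y have "norm (x + (y - x)) \<le> norm x + 1" by simp
    from taylor_rem_exp_tower_le[OF _ this, of vs] l
    show "norm (exp_tower y vs - exp_tower x vs - exp_tower x ((y - x) # vs))
        \<le> fact (k + 2) * exp (norm x + 1 + 1) * (norm (y - x))\<^sup>2 * pnorm vs"
      by (simp add: taylor_rem_def mult.assoc del: fact_Suc)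
  qed simp
qed

text \<open>The Taylor remainder of order 0 contributes \<open>2 * exp (r + 2) * norm h\<close>, as
  \<open>norm h \<le> 1\<close> lets one factor go, and the first derivative at most
  \<open>exp (r + 1) * norm h\<close>.\<close>

lemma norm_exp_add_diff_le:
  fixes x h :: "'a::{real_normed_algebra_1,banach}"
  assumes "norm x \<le> r" "norm h \<le> 1"
  shows "norm (exp (x + h) - exp x) \<le> 3 * exp (r + 2) * norm h"
proof -
  have "norm (x + h) \<le> r + 1" using assms norm_triangle_ineq[of x h] by linarith
  then have 1: "norm (exp (x + h) - exp x - exp_tower x [h]) \<le> 2 * exp (r + 2) * (norm h)\<^sup>2"
    using taylor_rem_exp_tower_le[of x "r + 1" h "[]"] assms
    by (simp add: taylor_rem_def exp_tower_Nil add.commute)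
  have 2: "norm (exp_tower x [h]) \<le> 1 * exp (r + 1) * norm h"
    by (rule norm_sums_le[OF exp_tower_sums _ sums_exp_bound])
      (use norm_pow_tower_le[OF assms(1), of _ "[h]"] in \<open>simp add: field_simps\<close>)
  have "exp (r + 1) * norm h \<le> exp (r + 2) * norm h" by (intro mult_right_mono) auto
  moreover have "2 * exp (r + 2) * (norm h)\<^sup>2 \<le> 2 * exp (r + 2) * norm h"
    using assms by (intro mult_left_mono) (auto simp: power2_eq_square mult_left_le)
  moreover have "norm (exp (x + h) - exp x)
      \<le> norm (exp (x + h) - exp x - exp_tower x [h]) + norm (exp_tower x [h])"
    by (rule norm_triangle_sub[of _ "exp_tower x [h]", THEN order_trans]) simp
  ultimately show ?thesis using 1 2 by linarith
qed

subsection \<open>Inverses\<close>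

definition unit_elt :: "'a::ring_1 \<Rightarrow> bool"
  where "unit_elt u \<longleftrightarrow> (\<exists>v. v * u = 1 \<and> u * v = 1)"

definition uinv :: "'a::ring_1 \<Rightarrow> 'a"
  where "uinv u = (THE v. v * u = 1 \<and> u * v = 1)"

lemma uinv_eqI: "v * u = 1 \<Longrightarrow> u * v = 1 \<Longrightarrow> uinv u = v"
  unfolding uinv_def by (rule the_equality) (blast, metis mult.assoc mult_1 mult_1_right)

lemma unit_eltI: "v * u = 1 \<Longrightarrow> u * v = 1 \<Longrightarrow> unit_elt u"
  by (auto simp: unit_elt_def)

lemma uinv_left: "unit_elt u \<Longrightarrow> uinv u * u = 1"
  and uinv_right: "unit_elt u \<Longrightarrow> u * uinv u = 1"
  unfolding unit_elt_def by (metis uinv_eqI)+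

lemma uinv_commute:
  assumes "unit_elt u" "x * u = u * x"
  shows "x * uinv u = uinv u * x"
proof -
  have "x * uinv u = uinv u * (u * x) * uinv u"
    using assms(1) by (simp add: uinv_left flip: mult.assoc)
  also have "\<dots> = uinv u * x * (u * uinv u)" by (simp add: assms(2)[symmetric] mult.assoc)
  finally show ?thesis using assms(1) by (simp add: uinv_right)
qed

lemma unit_one_minus:
  fixes x :: "'a::{real_normed_algebra_1,banach}"
  assumes "norm x < 1"
  shows "unit_elt (1 - x)" "norm (uinv (1 - x)) \<le> 1 / (1 - norm x)"
proof -
  define s where "s = (\<Sum>n. x ^ n)"
  have sm: "summable (\<lambda>n. x ^ n)" by (rule complete_algebra_summable_geometric[OF assms])
  have h: "(\<Sum>n. x ^ Suc n) = s - 1"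
    using suminf_split_head[OF sm] by (simp add: s_def)
  have "x * s = s - 1" using suminf_mult[OF sm, of x] h by (simp add: s_def)
  moreover have "s * x = s - 1"
    using suminf_mult2[OF sm, of x] h by (simp add: s_def power_Suc2 del: power_Suc)
  ultimately have s: "s * (1 - x) = 1" "(1 - x) * s = 1" by (simp_all add: algebra_simps)
  then show "unit_elt (1 - x)" by (rule unit_eltI)
  have "norm s \<le> (\<Sum>n. norm x ^ n)"
    unfolding s_def by (rule norm_suminf_le) (use assms in \<open>auto intro: norm_power_ineq\<close>)
  then show "norm (uinv (1 - x)) \<le> 1 / (1 - norm x)"
    using uinv_eqI[OF s] assms by (simp add: suminf_geometric)
qed

text \<open>Write \<open>v = u * (1 - x)\<close> with \<open>x = uinv u * (u - v)\<close>, so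
  \<open>norm x \<le> 1 / 2\<close> and the Neumann series has norm at most 2. The difference bound
  follows from \<open>uinv v - uinv u = uinv v * (u - v) * uinv u\<close>.\<close>

lemma unit_perturb:
  fixes u v :: "'a::{real_normed_algebra_1,banach}"
  assumes u: "unit_elt u" and uv: "norm (uinv u) * norm (v - u) \<le> 1 / 2"
  shows "unit_elt v" "norm (uinv v) \<le> 2 * norm (uinv u)"
    "norm (uinv v - uinv u) \<le> 2 * (norm (uinv u))\<^sup>2 * norm (v - u)"
proof -
  define x where "x = uinv u * (u - v)"
  have nx: "norm x \<le> 1 / 2"
    using uv norm_mult_ineq[of "uinv u" "u - v"] by (simp add: x_def norm_minus_commute)
  have x1: "unit_elt (1 - x)" and "norm (uinv (1 - x)) \<le> 1 / (1 - norm x)"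
    using unit_one_minus[of x] nx by auto
  moreover have "1 / (1 - norm x) \<le> 2" using nx by (simp add: field_simps)
  ultimately have n2: "norm (uinv (1 - x)) \<le> 2" by simp
  have v: "v = u * (1 - x)"
    using u by (simp add: x_def algebra_simps uinv_right flip: mult.assoc)
  have inv: "uinv (1 - x) * uinv u * v = 1" "v * (uinv (1 - x) * uinv u) = 1"
  proof -
    have "uinv (1 - x) * uinv u * v = uinv (1 - x) * (uinv u * u) * (1 - x)"
      unfolding v by (simp only: mult.assoc)
    then show "uinv (1 - x) * uinv u * v = 1" using u x1 by (simp add: uinv_left)
    have "v * (uinv (1 - x) * uinv u) = u * ((1 - x) * uinv (1 - x)) * uinv u"
      unfolding v by (simp only: mult.assoc)
    then show "v * (uinv (1 - x) * uinv u) = 1" using u x1 by (simp add: uinv_right)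
  qed
  show uv': "unit_elt v" by (rule unit_eltI[OF inv])
  have "norm (uinv v) \<le> norm (uinv (1 - x)) * norm (uinv u)"
    unfolding uinv_eqI[OF inv] by (rule norm_mult_ineq)
  also have "\<dots> \<le> 2 * norm (uinv u)" using n2 by (intro mult_right_mono) auto
  finally show le: "norm (uinv v) \<le> 2 * norm (uinv u)" .
  have "uinv v - uinv u = uinv v * (u - v) * uinv u"
    using u uv' by (simp add: algebra_simps uinv_left uinv_right)
  then have "norm (uinv v - uinv u) \<le> norm (uinv v) * norm (u - v) * norm (uinv u)"
    by (simp, intro order_trans[OF norm_mult_ineq] mult_right_mono norm_mult_ineq) simp
  also have "\<dots> \<le> 2 * norm (uinv u) * norm (v - u) * norm (uinv u)"
    unfolding norm_minus_commute[of u v] using le by (intro mult_right_mono) auto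
  finally show "norm (uinv v - uinv u) \<le> 2 * (norm (uinv u))\<^sup>2 * norm (v - u)"
    by (simp add: power2_eq_square mult_ac)
qed

lemma continuous_on_uinv:
  fixes f :: "'b::topological_space \<Rightarrow> 'a::{real_normed_algebra_1,banach}"
  assumes f: "continuous_on S f" and u: "\<And>x. x \<in> S \<Longrightarrow> unit_elt (f x)"
  shows "continuous_on S (\<lambda>x. uinv (f x))"
  unfolding continuous_on_def
proof
  fix x assume x: "x \<in> S"
  let ?k = "norm (uinv (f x))"
  have lim: "((\<lambda>y. norm (f y - f x)) \<longlongrightarrow> 0) (at x within S)"
    using f x by (auto simp: continuous_on_def intro!: tendsto_norm_zero tendsto_eq_intros)
  have "((\<lambda>y. ?k * norm (f y - f x)) \<longlongrightarrow> ?k * 0) (at x within S)"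
    by (intro tendsto_intros lim)
  then have "\<forall>\<^sub>F y in at x within S. ?k * norm (f y - f x) < 1 / 2"
    by (rule order_tendstoD) simp
  then have ev: "\<forall>\<^sub>F y in at x within S. norm (uinv (f y) - uinv (f x)) \<le> 2 * ?k\<^sup>2 * norm (f y - f x)"
    by eventually_elim (use unit_perturb(3)[OF u[OF x]] in auto)
  have "((\<lambda>y. 2 * ?k\<^sup>2 * norm (f y - f x)) \<longlongrightarrow> 2 * ?k\<^sup>2 * 0) (at x within S)"
    by (intro tendsto_intros lim)
  then have "((\<lambda>y. uinv (f y) - uinv (f x)) \<longlongrightarrow> 0) (at x within S)"
    using Lim_null_comparison[OF ev] by simp
  then show "((\<lambda>y. uinv (f y)) \<longlongrightarrow> uinv (f x)) (at x within S)"
    using Lim_null by blast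
qed


subsection \<open>The logarithm\<close>

text \<open>Differentiating \<open>(1 + s x) * R = 1\<close> by the product rule expresses order
  \<open>k + 1\<close> through order \<open>k\<close>. Since \<open>leib\<close> removes an
  arbitrary entry and not just the head, the recursion is on the length and not on the list.\<close>

primrec res_pow :: "nat \<Rightarrow> real \<Rightarrow> 'a::real_normed_algebra_1 \<Rightarrow> 'a list \<Rightarrow> 'a" where
  "res_pow 0 s R = (\<lambda>vs. R)"
| "res_pow (Suc k) s R = (\<lambda>vs. (- s *\<^sub>R R) * leib (res_pow k s R) vs)"

text \<open>The derivatives of \<open>\<lambda>x. uinv (1 + s *\<^sub>R x)\<close>, where \<open>R\<close> is the value of this function.\<close>

definition res_tower :: "real \<Rightarrow> 'a::real_normed_algebra_1 \<Rightarrow> 'a list \<Rightarrow> 'a"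
  where "res_tower s R vs = res_pow (length vs) s R vs"

lemma res_tower_Nil: "res_tower s R [] = R"
  by (simp add: res_tower_def)

lemma res_tower_eq:
  assumes "vs \<noteq> []"
  shows "res_tower s R vs = (- s *\<^sub>R R) * leib (res_tower s R) vs"
proof -
  obtain k where k: "length vs = Suc k" using assms by (cases vs) auto
  have "leib (res_pow k s R) vs = leib (res_tower s R) vs"
    by (rule leib_cong) (simp add: res_tower_def k)
  then show ?thesis by (simp add: res_tower_def k)
qed

lemma multilin_res_tower: "multilin k (res_tower s R)"
proof -
  have "multilin k (res_pow k s R)"
    by (induction k) (simp_all only: multilin_0 res_pow.simps multilin_mult multilin_leib)
  then show ?thesis by (simp add: multilin_def res_tower_def)
qed

lemma norm_res_tower_le:
  assumes s: "s \<in> {0..1}" and R: "norm R \<le> K"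
  shows "norm (res_tower s R vs) \<le> (fact (length vs) * K ^ Suc (length vs)) * pnorm vs"
proof (induction "length vs" arbitrary: vs)
  case 0
  then show ?case using R by (simp add: res_tower_Nil)
next
  case (Suc k)
  then have ne: "vs \<noteq> []" by auto
  have K: "0 \<le> K" using R norm_ge_zero order_trans by blast
  have l: "norm (leib (res_tower s R) vs) \<le> real (length vs) * (fact k * K ^ Suc k) * pnorm vs"
  proof (rule norm_leib_le)
    fix ws :: "'a list" assume "Suc (length ws) = length vs"
    then have "k = length ws" using Suc by simp
    then show "norm (res_tower s R ws) \<le> fact k * K ^ Suc k * pnorm ws" using Suc(1)[of ws] by simp
  qed
  have "norm (- s *\<^sub>R R) \<le> 1 * K" unfolding norm_scaleR using s R by (intro mult_mono) auto
  then have "norm ((- s *\<^sub>R R) * leib (res_tower s R) vs)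
      \<le> K * (real (length vs) * (fact k * K ^ Suc k) * pnorm vs)"
    using l K by (intro order_trans[OF norm_mult_ineq] mult_mono) auto
  then show ?case unfolding res_tower_eq[OF ne] Suc(2)[symmetric] by (simp add: mult_ac)
qed

text \<open>Obtained from the product rules that define both towers, multiplied out before
  \<open>R'\<close> is applied. Order 0 fits the same scheme: there both products equal 1 and
  cancel.\<close>

lemma taylor_rem_res_tower:
  assumes R: "(1 + s *\<^sub>R a) * R = 1" and R': "R' * (1 + s *\<^sub>R (a + h)) = 1" "(1 + s *\<^sub>R (a + h)) * R' = 1"
  shows "taylor_rem (res_tower s R') (res_tower s R) h vs
    = (- s *\<^sub>R R') * (leib (taylor_rem (res_tower s R') (res_tower s R) h) vs + h * res_tower s R (h # vs))"
    (is "?T vs = _")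
proof -
  let ?F = "res_tower s R" and ?G = "res_tower s R'"
  have F: "(1 + s *\<^sub>R a) * ?F ws = - s *\<^sub>R leib ?F ws" if "ws \<noteq> []" for ws
    unfolding res_tower_eq[OF that] using R by (simp flip: mult.assoc)
  have G: "(1 + s *\<^sub>R (a + h)) * ?G ws = - s *\<^sub>R leib ?G ws" if "ws \<noteq> []" for ws
    unfolding res_tower_eq[OF that] using R' by (simp flip: mult.assoc)
  have FG: "(1 + s *\<^sub>R (a + h)) * ?G vs - (1 + s *\<^sub>R a) * ?F vs = - s *\<^sub>R (leib ?G vs - leib ?F vs)"
  proof (cases "vs = []")
    case True
    then show ?thesis using R R' by (simp add: res_tower_Nil)
  next
    case False
    then show ?thesis by (simp add: F G scaleR_diff_right)
  qed
  have T: "leib ?T vs = leib ?G vs - leib ?F vs - leib (\<lambda>ws. ?F (h # ws)) vs"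
    unfolding taylor_rem_def by (simp add: leib_diff)
  have u: "(1 + s *\<^sub>R (a + h)) = (1 + s *\<^sub>R a) + s *\<^sub>R h" by (simp add: scaleR_add_right)
  have "(1 + s *\<^sub>R (a + h)) * ?T vs
      = ((1 + s *\<^sub>R (a + h)) * ?G vs - (1 + s *\<^sub>R a) * ?F vs) - s *\<^sub>R (h * ?F vs)
        - (1 + s *\<^sub>R a) * ?F (h # vs) - s *\<^sub>R (h * ?F (h # vs))"
    unfolding u taylor_rem_def by (simp add: algebra_simps)
  also have "\<dots> = - s *\<^sub>R (leib ?T vs + h * ?F (h # vs))"
    unfolding FG F[of "h # vs", simplified] T by (simp add: algebra_simps)
  finally have "R' * ((1 + s *\<^sub>R (a + h)) * ?T vs) = R' * (- s *\<^sub>R (leib ?T vs + h * ?F (h # vs)))"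
    by simp
  then show ?thesis using R'(1) by (simp flip: mult.assoc)
qed

text \<open>The constant depends on \<open>K\<close> and \<open>k\<close> alone. Uniformity in
  \<open>s\<close> is what allows the estimate to be integrated later.\<close>

lemma taylor_rem_res_tower_le:
  assumes "K \<ge> 0"
  shows "\<exists>C\<ge>0. \<forall>s R R' (a :: 'a::real_normed_algebra_1) h vs. s \<in> {0..1} \<longrightarrow> norm R \<le> K \<longrightarrow> norm R' \<le> K \<longrightarrow>
    (1 + s *\<^sub>R a) * R = 1 \<longrightarrow> R' * (1 + s *\<^sub>R (a + h)) = 1 \<longrightarrow> (1 + s *\<^sub>R (a + h)) * R' = 1 \<longrightarrow> length vs = k \<longrightarrow>
    norm (taylor_rem (res_tower s R') (res_tower s R) h vs) \<le> C * (norm h)\<^sup>2 * pnorm vs"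
proof -
  define B where "B k = fact (Suc k) * K ^ Suc (Suc k)" for k
  \<comment> \<open>\<open>B k\<close> bounds the quadratic term \<open>h * F (h # vs)\<close>; at
    each order the \<open>Suc k\<close> positions of the Leibniz sum contribute the previous
    constant, and the outer \<open>R'\<close> contributes \<open>K\<close>.\<close>
  define C where "C = rec_nat (K * B 0) (\<lambda>k c. K * (real (Suc k) * c + B (Suc k)))"
  have B0: "0 \<le> B k" for k using assms by (simp add: B_def del: fact_Suc)
  have C0: "0 \<le> C k" for k by (induction k) (use B0 assms in \<open>auto simp: C_def\<close>)
  have main: "norm (taylor_rem (res_tower s R') (res_tower s R) h vs) \<le> C k * (norm h)\<^sup>2 * pnorm vs"
    if s: "s \<in> {0..1}" and R: "norm R \<le> K" and R': "norm R' \<le> K"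
      and "(1 + s *\<^sub>R a) * R = 1" "R' * (1 + s *\<^sub>R (a + h)) = 1" "(1 + s *\<^sub>R (a + h)) * R' = 1"
      and l: "length vs = k"
    for s R R' vs k and a h :: 'a
  proof -
    let ?T = "taylor_rem (res_tower s R') (res_tower s R) h"
    have sR: "norm (- s *\<^sub>R R') \<le> 1 * K"
      unfolding norm_scaleR using s R' by (intro mult_mono) auto
    have hF: "norm (h * res_tower s R (h # vs)) \<le> B (length vs) * (norm h)\<^sup>2 * pnorm vs" for vs
    proof -
      have "norm (res_tower s R (h # vs)) \<le> B (length vs) * (norm h * pnorm vs)"
        using norm_res_tower_le[OF s R, of "h # vs"] by (simp add: B_def del: fact_Suc)
      then have "norm (h * res_tower s R (h # vs)) \<le> norm h * (B (length vs) * (norm h * pnorm vs))"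
        by (intro order_trans[OF norm_mult_ineq] mult_left_mono) auto
      then show ?thesis by (simp add: power2_eq_square mult_ac)
    qed
    have step: "norm (?T vs) \<le> K * (c * (norm h)\<^sup>2 * pnorm vs + B (length vs) * (norm h)\<^sup>2 * pnorm vs)"
      if "norm (leib ?T vs) \<le> c * (norm h)\<^sup>2 * pnorm vs" for c vs
      unfolding taylor_rem_res_tower[OF \<open>(1 + s *\<^sub>R a) * R = 1\<close> \<open>R' * (1 + s *\<^sub>R (a + h)) = 1\<close>
          \<open>(1 + s *\<^sub>R (a + h)) * R' = 1\<close>, of vs]
    proof (rule order_trans[OF norm_mult_ineq], rule mult_mono)
      show "norm (leib ?T vs + h * res_tower s R (h # vs))
          \<le> c * (norm h)\<^sup>2 * pnorm vs + B (length vs) * (norm h)\<^sup>2 * pnorm vs"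
        using that hF[of vs] by (rule norm_triangle_mono)
    qed (use sR assms in auto)
    show ?thesis
      using l
    proof (induction k arbitrary: vs)
    case 0
    from step[of vs 0] 0 show ?case by (simp add: C_def)
    next
    case (Suc k)
    have "norm (leib ?T vs) \<le> real (length vs) * (C k * (norm h)\<^sup>2) * pnorm vs"
      by (rule norm_leib_le) (use Suc in auto)
    then have "norm (?T vs) \<le> K * (real (Suc k) * C k * (norm h)\<^sup>2 * pnorm vs + B (Suc k) * (norm h)\<^sup>2 * pnorm vs)"
      using step[of vs "real (Suc k) * C k"] Suc.prems by (simp add: mult.assoc)
    also have "\<dots> = C (Suc k) * (norm h)\<^sup>2 * pnorm vs"
      by (simp add: C_def algebra_simps)
    finally show ?case .
  qed
  qed
  show ?thesis using main C0 by (intro exI[of _ "C k"]) blast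
qed

text \<open>Invertibility along the whole segment from 1 to \<open>p\<close>, and not only at
  \<open>p\<close>, makes the integrand of the logarithm continuous on a compact interval.\<close>

definition log_dom :: "'a::real_normed_algebra_1 set"
  where "log_dom = {p. \<forall>s\<in>{0..1}. unit_elt (1 + s *\<^sub>R (p - 1))}"

definition resolv :: "'a::real_normed_algebra_1 \<Rightarrow> real \<Rightarrow> 'a"
  where "resolv p s = uinv (1 + s *\<^sub>R (p - 1))"

definition alg_ln :: "'a::{real_normed_algebra_1,banach} \<Rightarrow> 'a"
  where "alg_ln p = integral {0..1} (\<lambda>s. (p - 1) * resolv p s)"

lemma continuous_on_resolv:
  "p \<in> log_dom \<Longrightarrow> continuous_on {0..1} (resolv p)" for p :: "'a::{real_normed_algebra_1,banach}"
  unfolding resolv_def[abs_def] by (intro continuous_on_uinv continuous_intros) (simp add: log_dom_def)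

lemma resolv_inverse:
  assumes "p \<in> log_dom" "s \<in> {0..1}"
  shows "resolv p s * (1 + s *\<^sub>R (p - 1)) = 1" "(1 + s *\<^sub>R (p - 1)) * resolv p s = 1"
  using assms by (auto simp: log_dom_def resolv_def uinv_left uinv_right)

text \<open>Compactness of the segment bounds the resolvent by some \<open>K\<close>; within radius
  \<open>1 / (2 * K)\<close> every point of the segment moves little enough for
  \<open>unit_perturb\<close>, at the price of doubling the bound.\<close>

lemma log_dom_nhds:
  fixes p :: "'a::{real_normed_algebra_1,banach}"
  assumes p: "p \<in> log_dom"
  obtains K r where "K \<ge> 0" "r > 0" "\<And>q. norm (q - p) < r \<Longrightarrow> q \<in> log_dom"
    "\<And>q s. norm (q - p) < r \<Longrightarrow> s \<in> {0..1} \<Longrightarrow> norm (resolv q s) \<le> K"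
proof -
  have "bounded (resolv p ` {0..1})"
    by (intro compact_imp_bounded compact_continuous_image continuous_on_resolv p) auto
  then obtain K where K: "K > 0" "\<And>s. s \<in> {0..1} \<Longrightarrow> norm (resolv p s) \<le> K"
    unfolding bounded_pos by auto
  have *: "unit_elt (1 + s *\<^sub>R (q - 1))" "norm (resolv q s) \<le> 2 * K"
    if q: "norm (q - p) < 1 / (2 * K)" and s: "s \<in> {0..1}" for q s
  proof -
    have u: "unit_elt (1 + s *\<^sub>R (p - 1))" using p s by (simp add: log_dom_def)
    have "norm ((1 + s *\<^sub>R (q - 1)) - (1 + s *\<^sub>R (p - 1))) = s * norm (q - p)"
      using s by (simp flip: scaleR_diff_right)
    also have "\<dots> \<le> 1 * (1 / (2 * K))" using s q by (intro mult_mono) auto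
    finally have "norm (uinv (1 + s *\<^sub>R (p - 1))) * norm ((1 + s *\<^sub>R (q - 1)) - (1 + s *\<^sub>R (p - 1)))
        \<le> K * (1 / (2 * K))"
      using K(2)[OF s] K(1) by (intro mult_mono) (auto simp: resolv_def)
    then have le: "norm (uinv (1 + s *\<^sub>R (p - 1))) * norm ((1 + s *\<^sub>R (q - 1)) - (1 + s *\<^sub>R (p - 1))) \<le> 1 / 2"
      using K(1) by simp
    show "unit_elt (1 + s *\<^sub>R (q - 1))" by (rule unit_perturb(1)[OF u le])
    show "norm (resolv q s) \<le> 2 * K"
      using unit_perturb(2)[OF u le] K(2)[OF s] by (simp add: resolv_def)
  qed
  show ?thesis by (rule that[of "2 * K" "1 / (2 * K)"]) (use * K in \<open>auto simp: log_dom_def\<close>)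
qed

definition ln_integrand :: "'a::real_normed_algebra_1 \<Rightarrow> 'a list \<Rightarrow> real \<Rightarrow> 'a"
  where "ln_integrand p vs s = leib_mult (p - 1) (res_tower s (resolv p s)) vs"

definition ln_tower :: "'a::{real_normed_algebra_1,banach} \<Rightarrow> 'a list \<Rightarrow> 'a"
  where "ln_tower p vs = integral {0..1} (ln_integrand p vs)"

lemma continuous_on_leib:
  assumes "\<And>ws. Suc (length ws) = length vs \<Longrightarrow> continuous_on S (\<lambda>s. F s ws)"
  shows "continuous_on S (\<lambda>s. leib (F s) vs)"
  using assms
proof (induction vs arbitrary: F)
  case (Cons v vs)
  have "continuous_on S (\<lambda>s. leib (\<lambda>ws. F s (v # ws)) vs)"
    by (rule Cons.IH) (simp add: Cons.prems)
  then show ?case by (simp, intro continuous_intros Cons.prems) simp_all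
qed simp

lemma continuous_on_res_tower:
  fixes p :: "'a::{real_normed_algebra_1,banach}"
  assumes p: "p \<in> log_dom"
  shows "continuous_on {0..1} (\<lambda>s. res_tower s (resolv p s) vs)"
proof (induction "length vs" arbitrary: vs)
  case 0
  then show ?case using continuous_on_resolv[OF p] by (simp add: res_tower_Nil)
next
  case (Suc k)
  then have "vs \<noteq> []" by auto
  then show ?case
    unfolding res_tower_eq[OF \<open>vs \<noteq> []\<close>]
    by (intro continuous_intros continuous_on_resolv p continuous_on_leib) (use Suc in auto)
qed

lemma continuous_on_ln_integrand:
  fixes p :: "'a::{real_normed_algebra_1,banach}"
  assumes p: "p \<in> log_dom"
  shows "continuous_on {0..1} (ln_integrand p vs)"
  unfolding ln_integrand_def leib_mult_def
  by (intro continuous_intros continuous_on_leib continuous_on_res_tower p)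

lemma ln_integrand_integrable: "p \<in> log_dom \<Longrightarrow> ln_integrand p vs integrable_on {0..1}"
  for p :: "'a::{real_normed_algebra_1,banach}"
  by (intro integrable_continuous_interval continuous_on_ln_integrand)

lemma open_log_dom: "open (log_dom :: 'a::{real_normed_algebra_1,banach} set)"
  unfolding open_dist by (metis log_dom_nhds dist_norm)

text \<open>Differentiation under the integral sign: the remainder estimates for the integrand are
  uniform in \<open>s\<close>, and the interval has length 1.\<close>

lemma smooth_on_alg_ln: "smooth_on log_dom (alg_ln :: 'a::{real_normed_algebra_1,banach} \<Rightarrow> 'a)"
proof (rule smooth_onI[where D=ln_tower])
  fix p :: 'a assume p: "p \<in> log_dom"
  show "ln_tower p [] = alg_ln p"
    by (simp add: ln_tower_def alg_ln_def ln_integrand_def[abs_def] leib_mult_def res_tower_Nil)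
  obtain K r where K: "K \<ge> 0" and r: "r > 0"
    and Kr: "\<And>q s. norm (q - p) < r \<Longrightarrow> s \<in> {0..1} \<Longrightarrow> norm (resolv q s) \<le> K"
    by (rule log_dom_nhds[OF p]) blast
  fix k
  have ml: "multilin k (\<lambda>vs. ln_integrand p vs s)" for s
    unfolding ln_integrand_def by (intro multilin_leib_mult multilin_res_tower)
  show "bounded_multilinear k (ln_tower p)"
  proof (rule bounded_multilinearI)
    show "multilin k (ln_tower p)"
    proof (rule multilinI)
      fix us vs :: "'a list" and v w assume l: "length us + length vs + 1 = k"
      show "ln_tower p (us @ (v + w) # vs) = ln_tower p (us @ v # vs) + ln_tower p (us @ w # vs)"
        unfolding ln_tower_def
        by (subst integral_add[symmetric])
          (use ln_integrand_integrable[OF p] multilin_add[OF ml l] in \<open>auto intro!: integral_cong\<close>)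
    next
      fix us vs :: "'a list" and c v assume l: "length us + length vs + 1 = k"
      show "ln_tower p (us @ (c *\<^sub>R v) # vs) = c *\<^sub>R ln_tower p (us @ v # vs)"
      proof -
        have "ln_tower p (us @ (c *\<^sub>R v) # vs) = integral {0..1} (\<lambda>s. c *\<^sub>R ln_integrand p (us @ v # vs) s)"
          unfolding ln_tower_def using multilin_scaleR[OF ml l] by (intro integral_cong) simp
        then show ?thesis by (simp add: ln_tower_def)
      qed
    qed
    fix vs :: "'a list" assume l: "length vs = k"
    let ?B = "norm (p - 1) * (fact k * K ^ Suc k) + real (length vs) * (fact (k - 1) * K ^ Suc (k - 1))"
    have "norm (ln_tower p vs) \<le> (?B * pnorm vs) * (1 - 0)"
      unfolding ln_tower_def
    proof (rule integral_bound)
      fix s :: real assume s: "s \<in> {0..1}"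
      show "norm (ln_integrand p vs s) \<le> ?B * pnorm vs"
        unfolding ln_integrand_def
      proof (rule norm_leib_mult_le)
        fix ws :: "'a list" assume "Suc (length ws) = length vs"
        then have "length ws = k - 1" using l by simp
        then show "norm (res_tower s (resolv p s) ws) \<le> fact (k - 1) * K ^ Suc (k - 1) * pnorm ws"
          using norm_res_tower_le[OF s Kr[OF _ s], of p ws] r by simp
      qed (use norm_res_tower_le[OF s Kr[OF _ s], of p vs] r l in simp)
    qed (simp_all add: continuous_on_ln_integrand p)
    then show "norm (ln_tower p vs) \<le> (norm (p - 1) * (fact k * K ^ Suc k) + real k * (fact (k - 1) * K ^ Suc (k - 1))) * pnorm vs"
      using l by simp
  qed
  obtain C where C: "C \<ge> 0" "\<And>s R R' a h vs. s \<in> {0..1} \<Longrightarrow> norm R \<le> K \<Longrightarrow> norm R' \<le> K \<Longrightarrow>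
    (1 + s *\<^sub>R a) * R = 1 \<Longrightarrow> R' * (1 + s *\<^sub>R (a + h)) = 1 \<Longrightarrow> (1 + s *\<^sub>R (a + h)) * R' = 1 \<Longrightarrow> length vs = k \<Longrightarrow>
    norm (taylor_rem (res_tower s R') (res_tower s R) (h :: 'a) vs) \<le> C * (norm h)\<^sup>2 * pnorm vs"
    using taylor_rem_res_tower_le[OF K, of k] by blast
  \<comment> \<open>\<open>leib\<close> evaluates the remainder on lists of length
    \<open>k - 1\<close>. At \<open>k = 0\<close> no such list occurs and the factor
    \<open>real k\<close> in \<open>A\<close> vanishes, so the truncated subtraction is
    harmless.\<close>
  obtain C' where C': "C' \<ge> 0" "\<And>s R R' a h vs. s \<in> {0..1} \<Longrightarrow> norm R \<le> K \<Longrightarrow> norm R' \<le> K \<Longrightarrow>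
    (1 + s *\<^sub>R a) * R = 1 \<Longrightarrow> R' * (1 + s *\<^sub>R (a + h)) = 1 \<Longrightarrow> (1 + s *\<^sub>R (a + h)) * R' = 1 \<Longrightarrow> length vs = k - 1 \<Longrightarrow>
    norm (taylor_rem (res_tower s R') (res_tower s R) (h :: 'a) vs) \<le> C' * (norm h)\<^sup>2 * pnorm vs"
    using taylor_rem_res_tower_le[OF K, of "k - 1"] by blast
  define A where "A = (norm (p - 1) + r) * C + real k * C' + fact (Suc k) * K ^ Suc (Suc k)"
  show "\<exists>C. \<exists>r>0. \<forall>y\<in>log_dom. norm (y - p) < r \<longrightarrow> (\<forall>vs. length vs = k \<longrightarrow>
      norm (ln_tower y vs - ln_tower p vs - ln_tower p ((y - p) # vs))
        \<le> C * (norm (y - p))\<^sup>2 * pnorm vs)"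
  proof (rule exI[of _ A], rule exI[of _ r], intro conjI ballI impI allI r)
    fix y and vs :: "'a list" assume y: "y \<in> log_dom" "norm (y - p) < r" and l: "length vs = k"
    let ?h = "y - p"
    have eq: "ln_tower y vs - ln_tower p vs - ln_tower p (?h # vs)
      = integral {0..1} (\<lambda>s. ln_integrand y vs s - ln_integrand p vs s - ln_integrand p (?h # vs) s)"
      unfolding ln_tower_def
      by (simp add: integral_diff integrable_diff ln_integrand_integrable p y)
    have "norm (ln_tower y vs - ln_tower p vs - ln_tower p (?h # vs)) \<le> (A * (norm ?h)\<^sup>2 * pnorm vs) * (1 - 0)"
      unfolding eq
    proof (rule integral_bound)
      fix s :: real assume s: "s \<in> {0..1}"
      let ?F = "res_tower s (resolv p s)" and ?G = "res_tower s (resolv y s)"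
      have Rp: "norm (resolv p s) \<le> K" and Ry: "norm (resolv y s) \<le> K"
        using Kr[of p] Kr[OF y(2)] s r by auto
      have T: "norm (taylor_rem ?G ?F ?h ws) \<le> C * (norm ?h)\<^sup>2 * pnorm ws" if "length ws = k" for ws
        by (rule C(2)[OF s Rp Ry _ _ _ that, of "p - 1"]) (use resolv_inverse[OF p s] resolv_inverse[OF y(1) s] in simp_all)
      have T': "norm (taylor_rem ?G ?F ?h ws) \<le> C' * (norm ?h)\<^sup>2 * pnorm ws" if "length ws = k - 1" for ws
        by (rule C'(2)[OF s Rp Ry _ _ _ that, of "p - 1"]) (use resolv_inverse[OF p s] resolv_inverse[OF y(1) s] in simp_all)
      have e: "ln_integrand y vs s - ln_integrand p vs s - ln_integrand p (?h # vs) s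
          = leib_mult (y - 1) (taylor_rem ?G ?F ?h) vs + ?h * ?F (?h # vs)"
        using taylor_rem_leib_mult[of "p - 1" ?h ?G ?F vs] by (simp add: taylor_rem_def ln_integrand_def)
      have n1: "norm (leib_mult (y - 1) (taylor_rem ?G ?F ?h) vs)
          \<le> (norm (y - 1) * (C * (norm ?h)\<^sup>2) + real (length vs) * (C' * (norm ?h)\<^sup>2)) * pnorm vs"
        by (rule norm_leib_mult_le) (use l T T' in auto)
      have "norm (?h * ?F (?h # vs)) \<le> norm ?h * (fact (Suc k) * K ^ Suc (Suc k) * (norm ?h * pnorm vs))"
        using norm_res_tower_le[OF s Rp, of "?h # vs"] l
        by (intro order_trans[OF norm_mult_ineq] mult_left_mono) auto
      then have n2: "norm (?h * ?F (?h # vs)) \<le> fact (Suc k) * K ^ Suc (Suc k) * ((norm ?h)\<^sup>2 * pnorm vs)"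
        by (simp add: power2_eq_square mult_ac del: fact_Suc)
      have y1: "norm (y - 1) \<le> norm (p - 1) + r"
        using y(2) norm_triangle_ineq[of "p - 1" "y - p"] by simp
      have "norm (y - 1) * (C * ((norm ?h)\<^sup>2 * pnorm vs))
          \<le> (norm (p - 1) + r) * (C * ((norm ?h)\<^sup>2 * pnorm vs))"
        by (intro mult_right_mono y1 mult_nonneg_nonneg C(1) pnorm_nonneg) simp
      then show "norm (ln_integrand y vs s - ln_integrand p vs s - ln_integrand p (?h # vs) s)
          \<le> A * (norm ?h)\<^sup>2 * pnorm vs"
        unfolding e A_def using n1 n2 l
        by (intro norm_triangle_le) (simp add: algebra_simps del: fact_Suc)
    qed (simp_all add: continuous_on_diff continuous_on_ln_integrand p y)
    then show "norm (ln_tower y vs - ln_tower p vs - ln_tower p (?h # vs)) \<le> A * (norm ?h)\<^sup>2 * pnorm vs"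
      by simp
  qed
qed

section \<open>Closed subspaces, integrals and commutation\<close>

lemma closed_sequence_limit:
  assumes "closed K" "\<And>n. f n \<in> K" "f \<longlonglongrightarrow> l"
  shows "l \<in> K"
  using assms closed_sequentially by blast

text \<open>The integral is a limit of Riemann sums, which are linear combinations of values.
  Commutation, selfadjointness, invariance under the involution and membership in the Lie triple
  system all pass to integrals this way.\<close>

lemma integral_in_closed_subspace:
  fixes f :: "real \<Rightarrow> 'a::banach"
  assumes K: "subspace K" "closed K" and f: "f integrable_on {a..b}" and fK: "\<And>x. x \<in> {a..b} \<Longrightarrow> f x \<in> K"
  shows "integral {a..b} f \<in> K"
proof -
  let ?I = "integral {a..b} f"
  have "\<exists>y\<in>K. dist y ?I < e" if e: "e > 0" for e
  proof -
    have "(f has_integral ?I) (cbox a b)" using f by (simp add: integrable_integral)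
    then obtain g where g: "gauge g"
      "\<And>D. D tagged_division_of cbox a b \<Longrightarrow> g fine D \<Longrightarrow> norm ((\<Sum>(x, k)\<in>D. measure lborel k *\<^sub>R f x) - ?I) < e"
      using e unfolding has_integral by meson
    obtain D where D: "D tagged_division_of cbox a b" "g fine D"
      using fine_division_exists[OF g(1), of a b] by blast
    have "(\<Sum>(x, k)\<in>D. measure lborel k *\<^sub>R f x) \<in> K"
    proof (rule subspace_sum[OF K(1)], clarify)
      fix x k assume "(x, k) \<in> D"
      then have "x \<in> {a..b}" using tagged_division_ofD(2,3)[OF D(1)] by fastforce
      then show "measure lborel k *\<^sub>R f x \<in> K" by (intro subspace_scale[OF K(1)] fK)
    qed
    then show ?thesis using g(2)[OF D] by (auto simp: dist_norm)
  qed
  then have "?I \<in> closure K" by (auto simp: closure_approachable)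
  then show ?thesis using K(2) by simp
qed

lemma subspace_commuting: "subspace {y :: 'a::real_normed_algebra. x * y = y * x}"
  by (auto simp: subspace_def algebra_simps)

lemma closed_commuting: "closed {y :: 'a::real_normed_algebra. x * y = y * x}"
  by (intro closed_Collect_eq continuous_intros)

lemma integrable_ln:
  fixes p :: "'a::{real_normed_algebra_1,banach}"
  assumes "p \<in> log_dom"
  shows "(\<lambda>s. (p - 1) * resolv p s) integrable_on {0..1}"
  by (intro integrable_continuous_interval continuous_intros continuous_on_resolv assms)

lemma resolv_commute:
  assumes "p \<in> log_dom" "s \<in> {0..1}" "x * p = p * x"
  shows "x * resolv p s = resolv p s * x"
  unfolding resolv_def
  by (rule uinv_commute) (use assms in \<open>auto simp: log_dom_def algebra_simps\<close>)

lemma alg_ln_commute: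
  fixes p :: "'a::{real_normed_algebra_1,banach}"
  assumes p: "p \<in> log_dom" and x: "x * p = p * x"
  shows "x * alg_ln p = alg_ln p * x"
proof -
  have "alg_ln p \<in> {y. x * y = y * x}"
    unfolding alg_ln_def
  proof (rule integral_in_closed_subspace[OF subspace_commuting closed_commuting integrable_ln[OF p]])
    fix s :: real assume s: "s \<in> {0..1}"
    have "x * (p - 1) = (p - 1) * x" using x by (simp add: algebra_simps)
    then have "x * ((p - 1) * resolv p s) = (p - 1) * resolv p s * x"
      using resolv_commute[OF p s x] by (metis mult.assoc)
    then show "(p - 1) * resolv p s \<in> {y. x * y = y * x}" by simp
  qed
  then show ?thesis by simp
qed

section \<open>Derivatives of \<open>exp\<close> along curves\<close>

lemma norm_exp_remainder_le:
  fixes y :: "'a::{real_normed_algebra_1,banach}"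
  assumes "norm y \<le> r"
  shows "norm (exp y - 1 - y) \<le> 2 * exp (r + 1) * (norm y)\<^sup>2"
proof -
  have "exp_tower (0 :: 'a) [y] = y"
  proof (rule sums_unique2[OF exp_tower_sums])
    have "pow_tower n (0 :: 'a) [y] /\<^sub>R fact n = (if n = 1 then y else 0)" for n
      by (cases n) (auto simp: leib_mult_def pow_tower_Nil power_0_left)
    then show "(\<lambda>n. pow_tower n (0 :: 'a) [y] /\<^sub>R fact n) sums y"
      using sums_single[of 1 "\<lambda>_. y"] by simp
  qed
  then show ?thesis
    using taylor_rem_exp_tower_le[of "0 :: 'a" r y "[]"] assms norm_ge_zero[of y]
    by (simp add: taylor_rem_def exp_tower_Nil del: norm_ge_zero)
qed

lemma has_derivative_exp_0: "(exp has_derivative (\<lambda>v. v)) (at (0 :: 'a::{real_normed_algebra_1,banach}))"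
proof (rule has_derivativeI_sandwich[of 1 _ _ _ _ "\<lambda>y. 2 * exp 2 * norm y"])
  show "((\<lambda>y::'a. 2 * exp 2 * norm y) \<longlongrightarrow> 0) (at 0)"
    by (auto intro!: tendsto_eq_intros)
  fix y :: 'a assume "y \<noteq> 0" and y: "dist y 0 < 1"
  then show "norm (exp y - exp 0 - (y - 0)) / norm (y - 0) \<le> 2 * exp 2 * norm y"
    using norm_exp_remainder_le[of y 1] by (simp add: field_simps power2_eq_square)
qed (simp_all add: bounded_linear_ident)

text \<open>Commutation with the single value \<open>l t\<close> gives
  \<open>exp (l u) = exp (l t) * exp (l u - l t)\<close>, which moves the question to the derivative
  of \<open>exp\<close> at 0.\<close>

lemma has_vector_derivative_exp_commuting:
  fixes l :: "real \<Rightarrow> 'a::{real_normed_algebra_1,banach}"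
  assumes l: "(l has_vector_derivative l') (at t within S)"
    and comm: "\<And>u. u \<in> S \<Longrightarrow> l t * l u = l u * l t" and t: "t \<in> S"
  shows "((\<lambda>u. exp (l u)) has_vector_derivative exp (l t) * l') (at t within S)"
proof -
  have "((\<lambda>u. l u - l t) has_vector_derivative l') (at t within S)"
    using has_vector_derivative_diff[OF l has_vector_derivative_const[of "l t"]] by simp
  then have "((\<lambda>u. l u - l t) has_derivative (\<lambda>h. h *\<^sub>R l')) (at t within S)"
    by (simp add: has_vector_derivative_def)
  then have "((exp \<circ> (\<lambda>u. l u - l t)) has_derivative ((\<lambda>v. v) \<circ> (\<lambda>h. h *\<^sub>R l'))) (at t within S)"
    by (rule diff_chain_within) (simp add: has_derivative_at_withinI[OF has_derivative_exp_0])
  then have "((\<lambda>u. exp (l u - l t)) has_vector_derivative l') (at t within S)"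
    by (simp add: has_vector_derivative_def o_def)
  from has_vector_derivative_mult[OF has_vector_derivative_const[of "exp (l t)"] this]
  have *: "((\<lambda>u. exp (l t) * exp (l u - l t)) has_vector_derivative exp (l t) * l') (at t within S)"
    by simp
  have eq: "exp (l u) = exp (l t) * exp (l u - l t)" if "u \<in> S" for u
    using exp_add_commuting[of "l t" "l u - l t"] comm[OF that] by (simp add: algebra_simps)
  show ?thesis
    by (rule has_vector_derivative_transform[OF t _ *]) (rule eq)
qed

lemma exp_commute:
  fixes x y :: "'a::{real_normed_algebra_1,banach}"
  assumes "x * y = y * x"
  shows "x * exp y = exp y * x"
proof -
  have pw: "x * y ^ n = y ^ n * x" for n by (rule power_commuting_commutes[symmetric]) (rule assms[symmetric])
  have "(\<lambda>n. x * (y ^ n /\<^sub>R fact n)) = (\<lambda>n. (y ^ n /\<^sub>R fact n) * x)"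
    unfolding mult_scaleR_right mult_scaleR_left pw ..
  then have "(\<lambda>n. x * (y ^ n /\<^sub>R fact n)) sums (exp y * x)"
    using sums_mult2[OF exp_converges[of y], of x] by argo
  then show ?thesis by (rule sums_unique2[OF sums_mult[OF exp_converges]])
qed

text \<open>Along the segment \<open>1 + t (p - 1)\<close> the truncated integrals \<open>l t\<close> commute with each other, and
  \<open>exp (- l t) * (1 + t (p - 1))\<close> has derivative \<open>0\<close>.\<close>

lemma exp_alg_ln:
  fixes p :: "'a::{real_normed_algebra_1,banach}"
  assumes p: "p \<in> log_dom"
  shows "exp (alg_ln p) = p"
proof -
  define f where "f s = (p - 1) * resolv p s" for s
  define l where "l t = integral {0..t} f" for t
  define w where "w t = 1 + t *\<^sub>R (p - 1)" for t
  have fc: "continuous_on {0..1} f"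
    unfolding f_def by (intro continuous_intros continuous_on_resolv p)
  have dl: "(l has_vector_derivative f t) (at t within {0..1})" if "t \<in> {0..1}" for t
    unfolding l_def by (rule integral_has_vector_derivative[OF fc that])
  have int: "f integrable_on {0..t}" if "t \<in> {0..1}" for t
    by (rule integrable_continuous_interval, rule continuous_on_subset[OF fc]) (use that in auto)
  have lcomm: "x * l t = l t * x" if x: "x * p = p * x" and t: "t \<in> {0..1}" for x t
  proof -
    have "l t \<in> {y. x * y = y * x}"
      unfolding l_def
    proof (rule integral_in_closed_subspace[OF subspace_commuting closed_commuting int[OF t]])
      fix s :: real assume "s \<in> {0..t}"
      then have s: "s \<in> {0..1}" using t by auto
      have "x * (p - 1) = (p - 1) * x" using x by (simp add: algebra_simps)
      then show "f s \<in> {y. x * y = y * x}"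
        using resolv_commute[OF p s x] unfolding f_def by (simp, metis mult.assoc)
    qed
    then show ?thesis by simp
  qed
  have lp: "l t * p = p * l t" if "t \<in> {0..1}" for t using lcomm[OF refl that] by simp
  have "((\<lambda>u. exp (- l u) * w u) has_vector_derivative 0) (at t within {0..1})" if t: "t \<in> {0..1}" for t
  proof -
    have 1: "((\<lambda>u. exp (- l u)) has_vector_derivative exp (- l t) * (- f t)) (at t within {0..1})"
    proof (rule has_vector_derivative_exp_commuting[where l="\<lambda>u. - l u"])
      show "((\<lambda>u. - l u) has_vector_derivative - f t) (at t within {0..1})"
        using dl[OF t] by (rule has_vector_derivative_minus)
      show "- l t * - l u = - l u * - l t" if "u \<in> {0..1}" for u
        using lcomm[OF lp[OF t] that] by simp
    qed (rule t)
    have 2: "(w has_vector_derivative (p - 1)) (at t within {0..1})"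
      unfolding w_def by (auto intro!: derivative_eq_intros simp: has_vector_derivative_def)
    have "((\<lambda>u. exp (- l u) * w u) has_vector_derivative
        exp (- l t) * (p - 1) + exp (- l t) * (- f t) * w t) (at t within {0..1})"
      by (rule has_vector_derivative_mult[OF 1 2])
    moreover have "f t * w t = p - 1"
      using resolv_inverse(1)[OF p t] by (simp add: f_def w_def mult.assoc)
    ultimately show ?thesis by (simp add: mult.assoc)
  qed
  then obtain c where c: "\<And>t. t \<in> {0..1} \<Longrightarrow> exp (- l t) * w t = c"
    using has_vector_derivative_zero_constant[of "{0..1}" "\<lambda>u. exp (- l u) * w u"] by blast
  have "exp (- l 1) * p = 1"
    using c[of 1] c[of 0] by (simp add: w_def l_def)
  then have "exp (l 1) * (exp (- l 1) * p) = exp (l 1)" by simp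
  then have "p = exp (l 1)" by (simp add: exp_minus_inverse flip: mult.assoc)
  then show ?thesis by (simp add: l_def alg_ln_def f_def[abs_def])
qed

text \<open>Duhamel's formula: the integrand is the derivative of
  \<open>exp ((s + 1 / 2) (x + v)) * exp ((1 / 2 - s) x)\<close>. The interval is centred at 0 so
  that the reflection of \<open>s\<close> can later remove the odd powers of
  \<open>ad\<close>.\<close>

lemma exp_duhamel:
  fixes x v :: "'a::{real_normed_algebra_1,banach}"
  shows "((\<lambda>s. exp ((s + 1 / 2) *\<^sub>R (x + v)) * v * exp ((1 / 2 - s) *\<^sub>R x)) has_integral exp (x + v) - exp x)
    {- 1 / 2..1 / 2}"
proof -
  let ?S = "{- 1 / 2..1 / 2} :: real set"
  have *: "((\<lambda>s. exp ((s + 1 / 2) *\<^sub>R (x + v)) * exp ((1 / 2 - s) *\<^sub>R x)) has_vector_derivative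
      exp ((s + 1 / 2) *\<^sub>R (x + v)) * v * exp ((1 / 2 - s) *\<^sub>R x)) (at s within ?S)" for s
  proof -
    have 1: "((\<lambda>u. (u + a) *\<^sub>R z) has_vector_derivative z) (at s)" for a and z :: 'a
      by (auto intro!: derivative_eq_intros simp: has_vector_derivative_def)
    have 2: "((\<lambda>u. exp ((u + a) *\<^sub>R z)) has_vector_derivative exp ((s + a) *\<^sub>R z) * z) (at s within ?S)"
      for a and z :: 'a
      by (rule has_vector_derivative_within_subset[OF has_vector_derivative_exp_commuting[OF 1]])
        (simp_all add: mult.commute)
    have "((\<lambda>u. exp ((1 / 2 - u) *\<^sub>R x)) has_vector_derivative exp ((1 / 2 - s) *\<^sub>R x) * (- x)) (at s within ?S)"
      using 2[of "- (1 / 2)" "- x"] by (simp add: algebra_simps)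
    from has_vector_derivative_mult[OF 2[of "1 / 2" "x + v"] this]
    have "((\<lambda>s. exp ((s + 1 / 2) *\<^sub>R (x + v)) * exp ((1 / 2 - s) *\<^sub>R x)) has_vector_derivative
      exp ((s + 1 / 2) *\<^sub>R (x + v)) * (exp ((1 / 2 - s) *\<^sub>R x) * - x)
        + exp ((s + 1 / 2) *\<^sub>R (x + v)) * (x + v) * exp ((1 / 2 - s) *\<^sub>R x))
      (at s within ?S)" .
    moreover have "exp ((1 / 2 - s) *\<^sub>R x) * x = x * exp ((1 / 2 - s) *\<^sub>R x)"
      by (rule exp_commute[symmetric]) simp
    ultimately show ?thesis by (simp add: algebra_simps)
  qed
  have "((\<lambda>s. exp ((s + 1 / 2) *\<^sub>R (x + v)) * v * exp ((1 / 2 - s) *\<^sub>R x)) has_integral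
      exp ((1 / 2 + 1 / 2) *\<^sub>R (x + v)) * exp ((1 / 2 - 1 / 2) *\<^sub>R x)
      - exp ((- 1 / 2 + 1 / 2) *\<^sub>R (x + v)) * exp ((1 / 2 - (- 1 / 2)) *\<^sub>R x)) ?S"
    by (rule fundamental_theorem_of_calculus) (simp, rule *)
  then show ?thesis by simp
qed

section \<open>Hilbert-Schmidt operators\<close>

lemma norm_cinner_le: "cmod (cinner x y) \<le> norm x * norm y"
proof (cases "cinner x y = 0")
  case False
  define u where "u = cnj (cinner x y) / cmod (cinner x y)"
  have u: "cmod u = 1" using False by (simp add: u_def norm_divide)
  have "cinner (u *\<^sub>C x) y = complex_of_real (cmod (cinner x y))"
    using False by (simp add: cinner_scaleC_left u_def complex_norm_square[symmetric] mult.commute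
        power2_eq_square)
  then have "cmod (cinner x y) = inner (u *\<^sub>C x) y" by (simp add: inner_eq_Re_cinner)
  also have "\<dots> \<le> norm (u *\<^sub>C x) * norm y" by (rule norm_cauchy_schwarz)
  finally show ?thesis by (simp add: norm_scaleC u)
qed simp

lemma cmod_cinner_commute: "cmod (cinner x y) = cmod (cinner y x)"
  by (subst cinner_commute) simp

lemma cinner_zero_left: "cinner 0 y = 0"
  using cinner_add_left[of 0 0 y] by simp

lemma cinner_diff_left: "cinner (x - z) y = cinner x y - cinner z y"
  using cinner_add_left[of "x - z" z y] by simp

lemma orthonormal_onb: "orthonormal onb" and closure_cspan_onb: "closure (cspan onb) = UNIV"
  using is_onb_onb by (auto simp: is_onb_def)

text \<open>With the Fourier coefficients as \<open>c\<close> this is Bessel's inequality; with the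
  coefficients of an approximant from the span it gives the other half of Parseval.\<close>

lemma dist_onb_sum:
  fixes x :: "'a::complex_hilbert_space"
  assumes "finite F" "F \<subseteq> onb"
  shows "(norm (x - (\<Sum>f\<in>F. c f *\<^sub>C f)))\<^sup>2
    = (norm x)\<^sup>2 - (\<Sum>f\<in>F. (cmod (cinner x f))\<^sup>2) + (\<Sum>f\<in>F. (cmod (c f - cinner x f))\<^sup>2)"
  using assms
proof (induction F rule: finite_induct)
  case (insert g F)
  define y where "y = x - (\<Sum>f\<in>F. c f *\<^sub>C f)"
  have "cinner (\<Sum>f\<in>F'. c f *\<^sub>C f) g = (\<Sum>f\<in>F'. c f * cinner f g)" if "finite F'" for F'
    using that by (induction F' rule: finite_induct)
      (simp_all add: cinner_zero_left cinner_add_left cinner_scaleC_left)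
  moreover have "cinner f g = 0" if "f \<in> F" for f
    using orthonormal_onb insert that by (auto simp: orthonormal_def)
  ultimately have yg: "cinner y g = cinner x g"
    using insert(1) by (simp add: y_def cinner_diff_left)
  have "cinner g g = 1" using orthonormal_onb insert by (auto simp: orthonormal_def)
  then have "complex_of_real ((norm g)\<^sup>2) = complex_of_real 1" by (simp only: cinner_self of_real_1)
  then have g: "(norm g)\<^sup>2 = 1" by (simp only: of_real_eq_iff)
  have "(norm (y - c g *\<^sub>C g))\<^sup>2 = (norm y)\<^sup>2 - 2 * inner y (c g *\<^sub>C g) + (norm (c g *\<^sub>C g))\<^sup>2"
    unfolding power2_norm_eq_inner by (simp add: algebra_simps inner_commute)
  also have "inner y (c g *\<^sub>C g) = Re (cnj (c g) * cinner x g)"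
    by (simp add: inner_eq_Re_cinner cinner_scaleC_right yg)
  also have "(norm (c g *\<^sub>C g))\<^sup>2 = (cmod (c g))\<^sup>2" using g by (simp add: norm_scaleC power_mult_distrib)
  finally have "(norm (y - c g *\<^sub>C g))\<^sup>2
      = (norm y)\<^sup>2 - (cmod (cinner x g))\<^sup>2 + (cmod (c g - cinner x g))\<^sup>2"
    unfolding cmod_power2 by (simp add: algebra_simps power2_eq_square)
  then show ?case
    using insert by (simp add: y_def algebra_simps)
qed simp

lemma bessel:
  fixes x :: "'a::complex_hilbert_space"
  assumes "finite F" "F \<subseteq> onb"
  shows "(\<Sum>f\<in>F. (cmod (cinner x f))\<^sup>2) \<le> (norm x)\<^sup>2"
  using dist_onb_sum[OF assms, of x "cinner x"] zero_le_power2[of "norm (x - (\<Sum>f\<in>F. cinner x f *\<^sub>C f))"]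
  by simp

lemma parseval:
  fixes x :: "'a::complex_hilbert_space"
  shows "((\<lambda>f. (cmod (cinner x f))\<^sup>2) has_sum (norm x)\<^sup>2) onb"
proof -
  let ?g = "\<lambda>f. (cmod (cinner x f))\<^sup>2"
  have sm: "?g summable_on onb"
    by (rule nonneg_bdd_above_summable_on) (auto intro!: bdd_aboveI2[where M="(norm x)\<^sup>2"] bessel)
  have "infsum ?g onb \<le> (norm x)\<^sup>2"
    by (rule infsum_le_finite_sums[OF sm]) (rule bessel)
  moreover have "(norm x)\<^sup>2 \<le> infsum ?g onb"
  proof (rule field_le_epsilon)
    fix e :: real assume e: "0 < e"
    have "x \<in> closure (cspan onb)" using closure_cspan_onb by auto
    then obtain y where y: "y \<in> cspan onb" "dist y x < sqrt e"
      unfolding closure_approachable using e by (metis real_sqrt_gt_zero)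
    from y(1) obtain F c where F: "finite F" "F \<subseteq> onb" and yF: "y = (\<Sum>f\<in>F. c f *\<^sub>C f)"
      unfolding complex_module.span_explicit by auto
    have "(norm (x - y))\<^sup>2 \<le> (sqrt e)\<^sup>2"
      using y(2) by (intro power_mono) (auto simp: dist_norm norm_minus_commute)
    \<comment> \<open>Any coefficients serve here: their deviation from the Fourier coefficients
      enters \<open>dist_onb_sum\<close> as a nonnegative sum.\<close>
    moreover have "(norm x)\<^sup>2 - sum ?g F \<le> (norm (x - y))\<^sup>2"
      unfolding yF dist_onb_sum[OF F] by (simp add: sum_nonneg)
    moreover have "sum ?g F \<le> infsum ?g onb" by (rule finite_sum_le_infsum[OF sm F]) simp
    ultimately show "(norm x)\<^sup>2 \<le> infsum ?g onb + e" using e by simp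
  qed
  ultimately show ?thesis using has_sum_infsum[OF sm] by simp
qed

definition hs_norm :: "'a::separable_hilbert_space cop \<Rightarrow> real"
  where "hs_norm T = sqrt (\<Sum>\<^sub>\<infinity>e\<in>onb. (norm (cop_apply T e))\<^sup>2)"

text \<open>Reduces bounds on the Hilbert-Schmidt norm to finite subsets of the basis, where
  Minkowski's inequality and operator norm limits are available.\<close>

lemma hs_normI:
  assumes "0 \<le> c" "\<And>F. finite F \<Longrightarrow> F \<subseteq> onb \<Longrightarrow> L2_set (\<lambda>e. norm (cop_apply T e)) F \<le> c"
  shows "hilbert_schmidt T" "hs_norm T \<le> c"
proof -
  have le: "(\<Sum>e\<in>F. (norm (cop_apply T e))\<^sup>2) \<le> c\<^sup>2" if "finite F" "F \<subseteq> onb" for F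
    using assms(2)[OF that] unfolding L2_set_def by (rule sqrt_le_D)
  then show hs: "hilbert_schmidt T"
    unfolding hilbert_schmidt_def
    by (intro nonneg_bdd_above_summable_on bdd_aboveI2[where M="c\<^sup>2"]) auto
  then have "(\<Sum>\<^sub>\<infinity>e\<in>onb. (norm (cop_apply T e))\<^sup>2) \<le> c\<^sup>2"
    unfolding hilbert_schmidt_def using le by (intro infsum_le_finite_sums) auto
  then show "hs_norm T \<le> c"
    unfolding hs_norm_def using assms(1) by (metis real_le_lsqrt real_sqrt_le_iff real_sqrt_abs abs_of_nonneg)
qed

lemma L2_set_le_hs_norm:
  assumes "hilbert_schmidt T" "finite F" "F \<subseteq> onb"
  shows "L2_set (\<lambda>e. norm (cop_apply T e)) F \<le> hs_norm T"
  unfolding L2_set_def hs_norm_def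
  using assms by (intro real_sqrt_le_mono finite_sum_le_infsum) (auto simp: hilbert_schmidt_def)

lemma hs_norm_nonneg: "0 \<le> hs_norm T"
  by (simp add: hs_norm_def infsum_nonneg)

lemma hs_norm_zero: "hs_norm 0 = 0"
  by (simp add: hs_norm_def cop.zero_left)

lemma hs_norm_add_le:
  assumes "hilbert_schmidt S" "hilbert_schmidt T"
  shows "hs_norm (S + T) \<le> hs_norm S + hs_norm T"
proof (rule hs_normI(2))
  fix F :: "'a set" assume F: "finite F" "F \<subseteq> onb"
  have "L2_set (\<lambda>e. norm (cop_apply (S + T) e)) F
      \<le> L2_set (\<lambda>e. norm (cop_apply S e) + norm (cop_apply T e)) F"
    by (rule L2_set_mono) (simp_all add: cop.add_left norm_triangle_ineq)
  also have "\<dots> \<le> L2_set (\<lambda>e. norm (cop_apply S e)) F + L2_set (\<lambda>e. norm (cop_apply T e)) F"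
    by (rule L2_set_triangle_ineq)
  also have "\<dots> \<le> hs_norm S + hs_norm T"
    using assms F by (intro add_mono L2_set_le_hs_norm)
  finally show "L2_set (\<lambda>e. norm (cop_apply (S + T) e)) F \<le> hs_norm S + hs_norm T" .
qed (simp add: hs_norm_nonneg)

lemma hs_norm_mult_le:
  assumes "hilbert_schmidt T"
  shows "hs_norm (S * T) \<le> norm S * hs_norm T"
proof (rule hs_normI(2))
  fix F :: "'a set" assume F: "finite F" "F \<subseteq> onb"
  have "L2_set (\<lambda>e. norm (cop_apply (S * T) e)) F \<le> L2_set (\<lambda>e. norm S * norm (cop_apply T e)) F"
    by (rule L2_set_mono) (simp_all add: cop_apply_times norm_cop_apply)
  also have "\<dots> = norm S * L2_set (\<lambda>e. norm (cop_apply T e)) F"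
    by (simp add: L2_set_right_distrib)
  also have "\<dots> \<le> norm S * hs_norm T"
    using assms F by (intro mult_left_mono L2_set_le_hs_norm) auto
  finally show "L2_set (\<lambda>e. norm (cop_apply (S * T) e)) F \<le> norm S * hs_norm T" .
qed (simp add: hs_norm_nonneg)

lemma hs_norm_scaleR: "hs_norm (r *\<^sub>R T) = \<bar>r\<bar> * hs_norm T"
proof -
  have "(\<Sum>\<^sub>\<infinity>e\<in>onb. (norm (cop_apply (r *\<^sub>R T) e))\<^sup>2) = r\<^sup>2 * (\<Sum>\<^sub>\<infinity>e\<in>onb. (norm (cop_apply T e))\<^sup>2)"
    by (simp add: cop.scaleR_left power_mult_distrib infsum_cmult_right')
  then show ?thesis by (simp add: hs_norm_def real_sqrt_mult)
qed


subsection \<open>Adjoint pairs\<close>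

text \<open>A relation instead of the description in \<open>adj\<close>: it passes directly to sums,
  products and limits. The real inner product determines the complex one, since the operators are
  complex linear.\<close>

definition adjoint_pair :: "'a::separable_hilbert_space cop \<Rightarrow> 'a cop \<Rightarrow> bool"
  where "adjoint_pair S T \<longleftrightarrow> (\<forall>x y. inner (cop_apply S x) y = inner x (cop_apply T y))"

lemma adjoint_pairD: "adjoint_pair S T \<Longrightarrow> inner (cop_apply S x) y = inner x (cop_apply T y)"
  by (simp add: adjoint_pair_def)

lemma adjoint_pair_sym: "adjoint_pair S T \<Longrightarrow> adjoint_pair T S"
  by (simp add: adjoint_pair_def inner_commute)

lemma adjoint_pair_self: "adjoint_pair T T \<longleftrightarrow> selfadjoint T"
  by (simp add: adjoint_pair_def selfadjoint_iff_inner)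

lemma adjoint_pair_unique:
  assumes "adjoint_pair S T" "adjoint_pair S T'"
  shows "T = T'"
proof (rule cop_eqI)
  fix y
  have "inner x (cop_apply T y) = inner x (cop_apply T' y)" for x
    using assms by (simp add: adjoint_pair_def)
  then show "cop_apply T y = cop_apply T' y" using vector_eq_ldot by blast
qed

lemma adjoint_pair_simps:
  "adjoint_pair 0 0" "adjoint_pair 1 1"
  "adjoint_pair S T \<Longrightarrow> adjoint_pair S' T' \<Longrightarrow> adjoint_pair (S + S') (T + T')"
  "adjoint_pair S T \<Longrightarrow> adjoint_pair S' T' \<Longrightarrow> adjoint_pair (S - S') (T - T')"
  "adjoint_pair S T \<Longrightarrow> adjoint_pair (r *\<^sub>R S) (r *\<^sub>R T)"
  "adjoint_pair S T \<Longrightarrow> adjoint_pair S' T' \<Longrightarrow> adjoint_pair (S * S') (T' * T)"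
  by (simp_all add: adjoint_pair_def cop_apply_one cop_apply_times cop.zero_left cop.add_left
      cop.diff_left cop.scaleR_left inner_add_left inner_add_right inner_diff_left inner_diff_right)

lemma adjoint_pair_cinner:
  assumes "adjoint_pair S T"
  shows "cinner (cop_apply S x) y = cinner x (cop_apply T y)"
proof (rule complex_eqI)
  show "Re (cinner (cop_apply S x) y) = Re (cinner x (cop_apply T y))"
    using assms by (simp add: adjoint_pair_def inner_eq_Re_cinner)
  show "Im (cinner (cop_apply S x) y) = Im (cinner x (cop_apply T y))"
    using assms by (simp add: adjoint_pair_def cinner_Im flip: cop_apply_scaleC)
qed

lemma adjoint_pair_limit:
  assumes "\<And>n. adjoint_pair (S n) (T n)" "S \<longlonglongrightarrow> S'" "T \<longlonglongrightarrow> T'"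
  shows "adjoint_pair S' T'"
  unfolding adjoint_pair_def
proof (intro allI)
  fix x y
  have "(\<lambda>n. inner (cop_apply (S n) x) y) \<longlonglongrightarrow> inner (cop_apply S' x) y"
    by (intro tendsto_intros cop.tendsto assms)
  moreover have "(\<lambda>n. inner (cop_apply (S n) x) y) \<longlonglongrightarrow> inner x (cop_apply T' y)"
    unfolding adjoint_pairD[OF assms(1)] by (intro tendsto_intros cop.tendsto assms)
  ultimately show "inner (cop_apply S' x) y = inner x (cop_apply T' y)" by (rule LIMSEQ_unique)
qed

lemma has_sum_sum:
  fixes f :: "'b \<Rightarrow> 'c \<Rightarrow> 'a::topological_comm_monoid_add"
  assumes "finite F" "\<And>i. i \<in> F \<Longrightarrow> (f i has_sum s i) A"
  shows "((\<lambda>x. \<Sum>i\<in>F. f i x) has_sum (\<Sum>i\<in>F. s i)) A"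
  using assms by (induction F rule: finite_induct) (auto intro: has_sum_add)

text \<open>The numbers \<open>|<T f, e>|^2 = |<S e, f>|^2\<close> are summed in both orders:
  Parseval in \<open>e\<close> for each \<open>f\<close>, Bessel in \<open>f\<close> for each
  \<open>e\<close>. As \<open>F\<close> is finite, the exchange involves only a finite sum of
  series.\<close>

lemma hs_adjoint_le:
  assumes S: "hilbert_schmidt S" and ST: "adjoint_pair S T"
  shows "hilbert_schmidt T" "hs_norm T \<le> hs_norm S"
proof -
  have *: "L2_set (\<lambda>e. norm (cop_apply T e)) F \<le> hs_norm S" if F: "finite F" "F \<subseteq> onb" for F
  proof -
    have "((\<lambda>e. \<Sum>f\<in>F. (cmod (cinner (cop_apply T f) e))\<^sup>2) has_sum (\<Sum>f\<in>F. (norm (cop_apply T f))\<^sup>2)) onb"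
      by (intro has_sum_sum parseval) (use F in auto)
    moreover have "((\<lambda>e. (norm (cop_apply S e))\<^sup>2) has_sum (\<Sum>\<^sub>\<infinity>e\<in>onb. (norm (cop_apply S e))\<^sup>2)) onb"
      using S by (simp add: hilbert_schmidt_def)
    moreover have "(\<Sum>f\<in>F. (cmod (cinner (cop_apply T f) e))\<^sup>2) \<le> (norm (cop_apply S e))\<^sup>2" for e
    proof -
      have "cmod (cinner (cop_apply T f) e) = cmod (cinner (cop_apply S e) f)" for f
        by (simp add: adjoint_pair_cinner[OF ST] cmod_cinner_commute)
      then show ?thesis using bessel[OF F, of "cop_apply S e"] by simp
    qed
    ultimately have "(\<Sum>f\<in>F. (norm (cop_apply T f))\<^sup>2) \<le> (\<Sum>\<^sub>\<infinity>e\<in>onb. (norm (cop_apply S e))\<^sup>2)"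
      by (rule has_sum_mono)
    then show ?thesis unfolding L2_set_def hs_norm_def by simp
  qed
  show "hilbert_schmidt T" by (rule hs_normI(1)[OF hs_norm_nonneg *])
  show "hs_norm T \<le> hs_norm S" by (rule hs_normI(2)[OF hs_norm_nonneg *])
qed

lemma hs_norm_adjoint:
  assumes "hilbert_schmidt S" "adjoint_pair S T"
  shows "hs_norm T = hs_norm S"
  using hs_adjoint_le[OF assms] hs_adjoint_le[OF _ adjoint_pair_sym[OF assms(2)]] by (simp add: antisym)

lemma norm_cop_le:
  assumes "0 \<le> c" "\<And>x. norm (cop_apply T x) \<le> c * norm x"
  shows "norm T \<le> c"
  using assms by transfer (rule norm_blinfun_bound)

text \<open>By Parseval \<open>norm (S x)\<close> is computed from the coefficients
  \<open><x, T f>\<close>; Cauchy-Schwarz bounds these by \<open>norm x * norm (T f)\<close>, and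
  \<open>T\<close> has the same Hilbert-Schmidt norm as \<open>S\<close>.\<close>

lemma norm_le_hs_norm:
  assumes S: "hilbert_schmidt S" and ST: "adjoint_pair S T"
  shows "norm S \<le> hs_norm S"
proof (rule norm_cop_le[OF hs_norm_nonneg])
  fix x
  have T: "hilbert_schmidt T" by (rule hs_adjoint_le[OF S ST])
  have "((\<lambda>f. (cmod (cinner (cop_apply S x) f))\<^sup>2) has_sum (norm (cop_apply S x))\<^sup>2) onb"
    by (rule parseval)
  moreover have "((\<lambda>f. (norm x)\<^sup>2 * (norm (cop_apply T f))\<^sup>2) has_sum (norm x)\<^sup>2 * (\<Sum>\<^sub>\<infinity>f\<in>onb. (norm (cop_apply T f))\<^sup>2)) onb"
    using T by (intro has_sum_cmult_right) (simp add: hilbert_schmidt_def)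
  moreover have "(cmod (cinner (cop_apply S x) f))\<^sup>2 \<le> (norm x)\<^sup>2 * (norm (cop_apply T f))\<^sup>2" for f
    unfolding adjoint_pair_cinner[OF ST] power_mult_distrib[symmetric]
    by (intro power_mono norm_cinner_le) simp
  ultimately have "(norm (cop_apply S x))\<^sup>2 \<le> (norm x)\<^sup>2 * (\<Sum>\<^sub>\<infinity>f\<in>onb. (norm (cop_apply T f))\<^sup>2)"
    by (rule has_sum_mono)
  then have "sqrt ((norm (cop_apply S x))\<^sup>2) \<le> sqrt ((norm x)\<^sup>2 * (\<Sum>\<^sub>\<infinity>f\<in>onb. (norm (cop_apply T f))\<^sup>2))"
    by (rule real_sqrt_le_mono)
  then have "norm (cop_apply S x) \<le> norm x * hs_norm T"
    by (simp add: real_sqrt_mult hs_norm_def)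
  then show "norm (cop_apply S x) \<le> hs_norm S * norm x"
    by (simp add: hs_norm_adjoint[OF S ST] mult.commute)
qed

section \<open>The Hilbert-Schmidt inner product\<close>

definition hs_form :: "'a::separable_hilbert_space cop \<Rightarrow> 'a cop \<Rightarrow> real"
  where "hs_form S T = (\<Sum>\<^sub>\<infinity>e\<in>onb. inner (cop_apply S e) (cop_apply T e))"

lemma hs_form_self: "hs_form S S = (hs_norm S)\<^sup>2"
  unfolding hs_form_def hs_norm_def by (simp add: power2_norm_eq_inner infsum_nonneg)

lemma hs_form_add:
  assumes "hilbert_schmidt S" "hilbert_schmidt S'" "hilbert_schmidt T"
  shows "hs_form (S + S') T = hs_form S T + hs_form S' T"
  unfolding hs_form_def
  by (simp add: cop.add_left inner_add_left infsum_add hs_inner_summable assms)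

lemma hs_form_commute: "hs_form S T = hs_form T S"
  by (simp add: hs_form_def inner_commute)

lemma hs_form_scaleR: "hs_form (r *\<^sub>R S) T = r * hs_form S T"
  by (simp add: hs_form_def cop.scaleR_left infsum_cmult_right')

lemma hs_form_polar:
  assumes "hilbert_schmidt S" "hilbert_schmidt T"
  shows "hs_form S T = ((hs_norm (S + T))\<^sup>2 - (hs_norm S)\<^sup>2 - (hs_norm T)\<^sup>2) / 2"
proof -
  have "(hs_norm (S + T))\<^sup>2 = hs_form S (S + T) + hs_form T (S + T)"
    using assms hs_form_add[OF assms hilbert_schmidt_add[OF assms]] by (simp add: hs_form_self)
  also have "\<dots> = hs_form S S + hs_form T S + (hs_form S T + hs_form T T)"
    unfolding hs_form_commute[of S "S + T"] hs_form_commute[of T "S + T"]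
    using assms by (simp add: hs_form_add)
  finally show ?thesis by (simp add: hs_form_self hs_form_commute[of T S])
qed

text \<open>Polarisation turns the invariance of the norm under adjoints into that of the
  form.\<close>

lemma hs_form_adjoint:
  assumes S: "hilbert_schmidt S" "adjoint_pair S S'" and T: "hilbert_schmidt T" "adjoint_pair T T'"
  shows "hs_form S' T' = hs_form S T"
proof -
  have "hs_norm (S' + T') = hs_norm (S + T)"
    using assms by (intro hs_norm_adjoint hilbert_schmidt_add adjoint_pair_simps)
  then show ?thesis
    using hs_norm_adjoint[OF S] hs_norm_adjoint[OF T] hs_adjoint_le(1)[OF S] hs_adjoint_le(1)[OF T] S(1) T(1)
    by (simp add: hs_form_polar)
qed

lemma hs_form_left:
  assumes "adjoint_pair P P'"
  shows "hs_form (P * S) T = hs_form S (P' * T)"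
  using assms by (simp add: hs_form_def cop_apply_times adjoint_pair_def)

lemma hilbert_schmidt_right:
  assumes "hilbert_schmidt S" "adjoint_pair S S'" "adjoint_pair P P'"
  shows "hilbert_schmidt (S * P)"
proof -
  have "hilbert_schmidt (P' * S')"
    using hs_adjoint_le(1)[OF assms(1,2)] by (rule hilbert_schmidt_left)
  moreover have "adjoint_pair (P' * S') (S * P)"
    using assms adjoint_pair_sym adjoint_pair_simps(6) by blast
  ultimately show ?thesis by (rule hs_adjoint_le(1))
qed

text \<open>A right factor cannot be moved term by term in the sum over the basis; passing to
  adjoints makes it a left factor, which can.\<close>

lemma hs_form_right:
  assumes S: "hilbert_schmidt S" "adjoint_pair S S'" and T: "hilbert_schmidt T" "adjoint_pair T T'"
    and P: "adjoint_pair P P'"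
  shows "hs_form (S * P) T = hs_form S (T * P')"
proof -
  note SP = hilbert_schmidt_right[OF S P] adjoint_pair_simps(6)[OF S(2) P]
  note TP = hilbert_schmidt_right[OF T adjoint_pair_sym[OF P]]
    adjoint_pair_simps(6)[OF T(2) adjoint_pair_sym[OF P]]
  have "hs_form (S * P) T = hs_form (P' * S') T'"
    by (rule hs_form_adjoint[OF SP T, symmetric])
  also have "\<dots> = hs_form S' (P * T')"
    by (rule hs_form_left) (rule adjoint_pair_sym[OF P])
  also have "\<dots> = hs_form S (T * P')" by (rule hs_form_adjoint[OF S TP])
  finally show ?thesis .
qed

text \<open>Polarisation reduces Cauchy-Schwarz to the triangle inequality for
  \<open>hs_norm\<close>; the lower bound is the upper bound for \<open>-S\<close>.\<close>

lemma abs_hs_form_le: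
  assumes "hilbert_schmidt S" "hilbert_schmidt T"
  shows "\<bar>hs_form S T\<bar> \<le> hs_norm S * hs_norm T"
proof -
  have *: "hs_form S T \<le> hs_norm S * hs_norm T" if ST: "hilbert_schmidt S" "hilbert_schmidt T" for S T :: "'a cop"
  proof -
    have "(hs_norm (S + T))\<^sup>2 \<le> (hs_norm S + hs_norm T)\<^sup>2"
      by (intro power_mono hs_norm_add_le ST hs_norm_nonneg)
    then show ?thesis by (simp add: hs_form_polar[OF ST] power2_sum)
  qed
  have "hs_form ((-1) *\<^sub>R S) T \<le> hs_norm ((-1) *\<^sub>R S) * hs_norm T"
    using assms by (intro * hilbert_schmidt_scaleR)
  then have "- hs_form S T \<le> hs_norm S * hs_norm T" unfolding hs_form_scaleR hs_norm_scaleR by simp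
  with *[OF assms] show ?thesis by linarith
qed

subsection \<open>The Banach algebra of Hilbert-Schmidt perturbations of real scalars\<close>

text \<open>An operator \<open>S + r\<close> is stored together with the adjoint \<open>T\<close> of its Hilbert-Schmidt part.\<close>

typedef (overloaded) 'a hsa =
    "{(r :: real, S :: 'a::separable_hilbert_space cop, T). hilbert_schmidt S \<and> adjoint_pair S T}"
  by (rule exI[of _ "(0, 0, 0)"]) (simp add: hilbert_schmidt_zero adjoint_pair_simps)

lifting_forget cop.lifting

setup_lifting type_definition_hsa

lift_definition hsa_scalar :: "'a::separable_hilbert_space hsa \<Rightarrow> real" is "\<lambda>(r, S, T). r" .

lift_definition hsa_hs :: "'a::separable_hilbert_space hsa \<Rightarrow> 'a cop" is "\<lambda>(r, S, T). S" .

lift_definition hsa_adj :: "'a::separable_hilbert_space hsa \<Rightarrow> 'a cop" is "\<lambda>(r, S, T). T" .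

lemma hilbert_schmidt_hsa: "hilbert_schmidt (hsa_hs x)"
  by transfer auto

lemma adjoint_pair_hsa: "adjoint_pair (hsa_hs x) (hsa_adj x)"
  by transfer auto

lemma hsa_eqI:
  assumes "hsa_scalar x = hsa_scalar y" "hsa_hs x = hsa_hs y"
  shows "x = y"
  using assms by transfer (auto dest: adjoint_pair_unique)

instantiation hsa :: (separable_hilbert_space) real_normed_vector
begin

lift_definition zero_hsa :: "'a hsa" is "(0, 0, 0)"
  by (simp add: hilbert_schmidt_zero adjoint_pair_simps)

lift_definition plus_hsa :: "'a hsa \<Rightarrow> 'a hsa \<Rightarrow> 'a hsa"
  is "\<lambda>(r, S, T) (r', S', T'). (r + r', S + S', T + T')"
  by (auto simp: hilbert_schmidt_add adjoint_pair_simps)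

lift_definition scaleR_hsa :: "real \<Rightarrow> 'a hsa \<Rightarrow> 'a hsa"
  is "\<lambda>c (r, S, T). (c * r, c *\<^sub>R S, c *\<^sub>R T)"
  by (auto simp: hilbert_schmidt_scaleR adjoint_pair_simps)

definition uminus_hsa :: "'a hsa \<Rightarrow> 'a hsa"
  where "uminus_hsa x = (-1) *\<^sub>R x"

definition minus_hsa :: "'a hsa \<Rightarrow> 'a hsa \<Rightarrow> 'a hsa"
  where "minus_hsa x y = x + - y"

text \<open>With the sum of both parts, submultiplicativity follows by expanding
  \<open>(S + r) * (S' + r')\<close> and bounding each Hilbert-Schmidt term.\<close>

definition norm_hsa :: "'a hsa \<Rightarrow> real"
  where "norm_hsa x = \<bar>hsa_scalar x\<bar> + hs_norm (hsa_hs x)"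

definition dist_hsa :: "'a hsa \<Rightarrow> 'a hsa \<Rightarrow> real"
  where "dist_hsa x y = norm (x - y)"

definition uniformity_hsa :: "('a hsa \<times> 'a hsa) filter"
  where "uniformity_hsa = (INF e\<in>{0 <..}. principal {(x, y). dist x y < e})"

definition open_hsa :: "'a hsa set \<Rightarrow> bool"
  where "open_hsa S = (\<forall>x\<in>S. \<forall>\<^sub>F (x', y) in uniformity. x' = x \<longrightarrow> y \<in> S)"

definition sgn_hsa :: "'a hsa \<Rightarrow> 'a hsa"
  where "sgn_hsa x = scaleR (inverse (norm x)) x"

lemma hsa_vector_simps:
  "hsa_scalar 0 = 0" "hsa_hs 0 = 0" "hsa_adj 0 = 0"
  "hsa_scalar (x + y) = hsa_scalar x + hsa_scalar y"
  "hsa_hs (x + y) = hsa_hs x + hsa_hs y"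
  "hsa_adj (x + y) = hsa_adj x + hsa_adj y"
  "hsa_scalar (c *\<^sub>R x) = c * hsa_scalar x"
  "hsa_hs (c *\<^sub>R x) = c *\<^sub>R hsa_hs x"
  "hsa_adj (c *\<^sub>R x) = c *\<^sub>R hsa_adj x"
  "hsa_scalar (- x) = - hsa_scalar x"
  "hsa_hs (- x) = - hsa_hs x"
  "hsa_adj (- x) = - hsa_adj x"
  "hsa_scalar (x - y) = hsa_scalar x - hsa_scalar y"
  "hsa_hs (x - y) = hsa_hs x - hsa_hs y"
  "hsa_adj (x - y) = hsa_adj x - hsa_adj y"
  unfolding minus_hsa_def uminus_hsa_def by (transfer; auto)+

instance
proof
  fix x y z :: "'a hsa" and a b :: real and U :: "'a hsa set"
  show "dist x y = norm (x - y)" by (rule dist_hsa_def)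
  show "open U \<longleftrightarrow> (\<forall>x\<in>U. \<forall>\<^sub>F (x', y) in uniformity. x' = x \<longrightarrow> y \<in> U)" by (rule open_hsa_def)
  show "sgn x = inverse (norm x) *\<^sub>R x" by (rule sgn_hsa_def)
  show "uniformity = (INF e\<in>{0 <..}. principal {(x, y :: 'a hsa). dist x y < e})"
    by (rule uniformity_hsa_def)
  show "x - y = x + - y" by (rule minus_hsa_def)
  show "norm (x + y) \<le> norm x + norm y"
    using hs_norm_add_le[OF hilbert_schmidt_hsa[of x] hilbert_schmidt_hsa[of y]]
    by (simp add: norm_hsa_def hsa_vector_simps)
  show "norm (a *\<^sub>R x) = \<bar>a\<bar> * norm x"
    by (simp add: norm_hsa_def hsa_vector_simps hs_norm_scaleR abs_mult algebra_simps)
  show "norm x = 0 \<longleftrightarrow> x = 0"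
  proof
    assume "norm x = 0"
    then have r: "hsa_scalar x = 0" and h: "hs_norm (hsa_hs x) = 0"
      using hs_norm_nonneg[of "hsa_hs x"] by (auto simp: norm_hsa_def)
    have "norm (hsa_hs x) \<le> 0"
      using norm_le_hs_norm[OF hilbert_schmidt_hsa adjoint_pair_hsa, of x] h by simp
    with r show "x = 0" by (intro hsa_eqI) (simp_all add: hsa_vector_simps)
  qed (simp add: norm_hsa_def hsa_vector_simps hs_norm_zero)
qed (auto intro!: hsa_eqI simp: hsa_vector_simps algebra_simps)

end

instantiation hsa :: (separable_hilbert_space) real_normed_algebra_1
begin

lift_definition one_hsa :: "'a hsa" is "(1, 0, 0)"
  by (simp add: hilbert_schmidt_zero adjoint_pair_simps)

lift_definition times_hsa :: "'a hsa \<Rightarrow> 'a hsa \<Rightarrow> 'a hsa"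
  is "\<lambda>(r, S, T) (r', S', T'). (r * r', S * S' + r *\<^sub>R S' + r' *\<^sub>R S, T' * T + r *\<^sub>R T' + r' *\<^sub>R T)"
  by (auto intro!: hilbert_schmidt_add hilbert_schmidt_scaleR hilbert_schmidt_left adjoint_pair_simps)

lemma hsa_algebra_simps:
  "hsa_scalar 1 = 1" "hsa_hs 1 = 0" "hsa_adj 1 = 0"
  "hsa_scalar (x * y) = hsa_scalar x * hsa_scalar y"
  "hsa_hs (x * y) = hsa_hs x * hsa_hs y + hsa_scalar x *\<^sub>R hsa_hs y + hsa_scalar y *\<^sub>R hsa_hs x"
  "hsa_adj (x * y) = hsa_adj y * hsa_adj x + hsa_scalar x *\<^sub>R hsa_adj y + hsa_scalar y *\<^sub>R hsa_adj x"
  by (transfer; auto)+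

instance
proof
  fix x y :: "'a hsa"
  let ?a = "hsa_hs x" and ?b = "hsa_hs y" and ?r = "hsa_scalar x" and ?s = "hsa_scalar y"
  note hs = hilbert_schmidt_hsa hilbert_schmidt_left hilbert_schmidt_scaleR hilbert_schmidt_add
  have "hs_norm (?a * ?b) \<le> norm ?a * hs_norm ?b" by (rule hs_norm_mult_le) (rule hs)
  also have "\<dots> \<le> hs_norm ?a * hs_norm ?b"
    by (intro mult_right_mono norm_le_hs_norm[OF _ adjoint_pair_hsa] hs hs_norm_nonneg)
  finally have ab: "hs_norm (?a * ?b) \<le> hs_norm ?a * hs_norm ?b" .
  have "hs_norm (?a * ?b + ?r *\<^sub>R ?b + ?s *\<^sub>R ?a) \<le> hs_norm (?a * ?b + ?r *\<^sub>R ?b) + hs_norm (?s *\<^sub>R ?a)"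
    by (intro hs_norm_add_le hs)
  moreover have "hs_norm (?a * ?b + ?r *\<^sub>R ?b) \<le> hs_norm (?a * ?b) + hs_norm (?r *\<^sub>R ?b)"
    by (intro hs_norm_add_le hs)
  ultimately have "hs_norm (?a * ?b + ?r *\<^sub>R ?b + ?s *\<^sub>R ?a)
      \<le> hs_norm ?a * hs_norm ?b + \<bar>?r\<bar> * hs_norm ?b + \<bar>?s\<bar> * hs_norm ?a"
    using ab by (simp add: hs_norm_scaleR)
  then show "norm (x * y) \<le> norm x * norm y"
    by (simp add: norm_hsa_def hsa_algebra_simps abs_mult algebra_simps)
  show "norm (1 :: 'a hsa) = 1" by (simp add: norm_hsa_def hsa_algebra_simps hs_norm_zero)
  show "(0 :: 'a hsa) \<noteq> 1" using hsa_algebra_simps(1) hsa_vector_simps(1) by (metis zero_neq_one)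
qed (auto intro!: hsa_eqI simp: hsa_vector_simps hsa_algebra_simps algebra_simps)

end

text \<open>Lower semicontinuity: each finite partial sum is continuous for the operator norm, and
  \<open>hs_norm\<close> is bounded as soon as all of them are. It turns the Cauchy property into
  convergence in the norm of \<open>hsa\<close>.\<close>

lemma hs_norm_limit:
  assumes S: "\<And>n. n \<ge> N \<Longrightarrow> hilbert_schmidt (X n - A) \<and> hs_norm (X n - A) \<le> e" and e: "0 \<le> e"
    and lim: "X \<longlonglongrightarrow> L"
  shows "hilbert_schmidt (L - A)" "hs_norm (L - A) \<le> e"
proof -
  have *: "L2_set (\<lambda>e. norm (cop_apply (L - A) e)) F \<le> e" if F: "finite F" "F \<subseteq> onb" for F
  proof (rule LIMSEQ_le_const2)
    show "(\<lambda>n. L2_set (\<lambda>e. norm (cop_apply (X n - A) e)) F) \<longlonglongrightarrow> L2_set (\<lambda>e. norm (cop_apply (L - A) e)) F"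
      unfolding L2_set_def by (intro tendsto_intros cop.tendsto lim)
    show "\<exists>N. \<forall>n\<ge>N. L2_set (\<lambda>e. norm (cop_apply (X n - A) e)) F \<le> e"
      using S L2_set_le_hs_norm[OF _ F] by (meson order_trans)
  qed
  show "hilbert_schmidt (L - A)" by (rule hs_normI(1)[OF e *])
  show "hs_norm (L - A) \<le> e" by (rule hs_normI(2)[OF e *])
qed

instance hsa :: (separable_hilbert_space) banach
proof
  fix X :: "nat \<Rightarrow> 'a hsa"
  assume X: "Cauchy X"
  have C: "Cauchy (\<lambda>n. f (X n))" if "\<And>x y. norm (f x - f y) \<le> norm (x - y)"
    for f :: "'a hsa \<Rightarrow> 'b::real_normed_vector"
    using X that unfolding Cauchy_iff by (meson order_le_less_trans)
  have n1: "\<bar>hsa_scalar x\<bar> \<le> norm x" and n2: "norm (hsa_hs x) \<le> norm x"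
    and n3: "norm (hsa_adj x) \<le> norm x" for x :: "'a hsa"
    using norm_le_hs_norm[OF hilbert_schmidt_hsa adjoint_pair_hsa, of x] hs_norm_nonneg[of "hsa_hs x"]
      norm_le_hs_norm[OF hs_adjoint_le(1)[OF hilbert_schmidt_hsa adjoint_pair_hsa]
        adjoint_pair_sym[OF adjoint_pair_hsa], of x]
      hs_norm_adjoint[OF hilbert_schmidt_hsa adjoint_pair_hsa, of x]
    by (auto simp: norm_hsa_def)
  obtain r where r: "(\<lambda>n. hsa_scalar (X n)) \<longlonglongrightarrow> r"
    using Cauchy_convergent[OF C[of hsa_scalar]] n1 by (auto simp: convergent_def simp flip: hsa_vector_simps)
  obtain S where S: "(\<lambda>n. hsa_hs (X n)) \<longlonglongrightarrow> S"
    using Cauchy_convergent[OF C[of hsa_hs]] n2 by (auto simp: convergent_def simp flip: hsa_vector_simps)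
  obtain T where T: "(\<lambda>n. hsa_adj (X n)) \<longlonglongrightarrow> T"
    using Cauchy_convergent[OF C[of hsa_adj]] n3 by (auto simp: convergent_def simp flip: hsa_vector_simps)
  have lim: "\<exists>N. \<forall>m\<ge>N. hilbert_schmidt (S - hsa_hs (X m)) \<and> hs_norm (S - hsa_hs (X m)) \<le> e"
    if e: "e > 0" for e
  proof -
    obtain N where N: "\<And>m n. m \<ge> N \<Longrightarrow> n \<ge> N \<Longrightarrow> norm (X m - X n) < e"
      using X e unfolding Cauchy_iff by meson
    have "hilbert_schmidt (hsa_hs (X n) - hsa_hs (X m)) \<and> hs_norm (hsa_hs (X n) - hsa_hs (X m)) \<le> e"
      if "m \<ge> N" "n \<ge> N" for m n
      using N[of n m] that hilbert_schmidt_hsa[of "X n - X m"] abs_ge_zero[of "hsa_scalar (X n - X m)"]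
      by (auto simp: norm_hsa_def hsa_vector_simps)
    then show ?thesis
      using hs_norm_limit[of N "\<lambda>n. hsa_hs (X n)" "hsa_hs (X _)" e S] S e by (meson less_imp_le)
  qed
  obtain N where "hilbert_schmidt (S - hsa_hs (X N))" using lim[of 1] by auto
  from hilbert_schmidt_add[OF this hilbert_schmidt_hsa[of "X N"]] have hsS: "hilbert_schmidt S" by simp
  have ST: "adjoint_pair S T" by (rule adjoint_pair_limit[OF adjoint_pair_hsa S T])
  define L where "L = Abs_hsa (r, S, T)"
  have L: "hsa_scalar L = r" "hsa_hs L = S"
    using hsS ST by (simp_all add: L_def hsa_scalar.rep_eq hsa_hs.rep_eq Abs_hsa_inverse)
  have "X \<longlonglongrightarrow> L"
  proof (rule metric_LIMSEQ_I)
    fix e :: real assume e: "0 < e"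
    obtain N1 where N1: "\<And>m. m \<ge> N1 \<Longrightarrow> hs_norm (S - hsa_hs (X m)) \<le> e / 3"
      using lim[of "e / 3"] e by auto
    obtain N2 where N2: "\<And>m. m \<ge> N2 \<Longrightarrow> norm (hsa_scalar (X m) - r) < e / 3"
      using LIMSEQ_D[OF r, of "e / 3"] e by auto
    show "\<exists>N. \<forall>n\<ge>N. dist (X n) L < e"
    proof (intro exI[of _ "max N1 N2"] allI impI)
      fix n assume n: "n \<ge> max N1 N2"
      have "dist (X n) L = \<bar>hsa_scalar (X n) - r\<bar> + hs_norm (hsa_hs (X n) - S)"
        by (simp add: dist_norm norm_hsa_def hsa_vector_simps L)
      also have "hs_norm (hsa_hs (X n) - S) = hs_norm ((-1) *\<^sub>R (S - hsa_hs (X n)))" by simp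
      also have "\<dots> = hs_norm (S - hsa_hs (X n))" unfolding hs_norm_scaleR by simp
      finally show "dist (X n) L < e" using N1[of n] N2[of n] n e by simp
    qed
  qed
  then show "convergent X" by (auto simp: convergent_def)
qed

section \<open>The involution and the embedding of selfadjoint elements\<close>

lift_definition hsa_star :: "'a::separable_hilbert_space hsa \<Rightarrow> 'a hsa" is "\<lambda>(r, S, T). (r, T, S)"
  by (auto intro: hs_adjoint_le adjoint_pair_sym)

lemma hsa_star_simps:
  "hsa_scalar (hsa_star x) = hsa_scalar x" "hsa_hs (hsa_star x) = hsa_adj x" "hsa_adj (hsa_star x) = hsa_hs x"
  by (transfer; auto)+

definition hsa_cop :: "'a::separable_hilbert_space hsa \<Rightarrow> 'a cop"
  where "hsa_cop x = hsa_hs x + of_real (hsa_scalar x)"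

lemma hsa_cop_inject: "hsa_cop x = hsa_cop y \<longleftrightarrow> x = y"
proof
  assume "hsa_cop x = hsa_cop y"
  then show "x = y"
    using hs_part_eq[OF hilbert_schmidt_hsa] scalar_part_eq[OF hilbert_schmidt_hsa]
    unfolding hsa_cop_def by (metis hsa_eqI)
qed simp

lemma hsa_cop_simps:
  "hsa_cop 1 = 1" "hsa_cop (x + y) = hsa_cop x + hsa_cop y" "hsa_cop (c *\<^sub>R x) = c *\<^sub>R hsa_cop x"
  "hsa_cop (x - y) = hsa_cop x - hsa_cop y" "hsa_cop (x * y) = hsa_cop x * hsa_cop y"
  by (simp_all add: hsa_cop_def hsa_vector_simps hsa_algebra_simps of_real_def algebra_simps)

lemma adjoint_pair_star: "adjoint_pair (hsa_cop x) (hsa_cop (hsa_star x))"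
  unfolding hsa_cop_def hsa_star_simps of_real_def
  by (intro adjoint_pair_simps adjoint_pair_hsa)

lemma norm_hsa_cop_le: "norm (hsa_cop x) \<le> norm x"
proof -
  have "norm (hsa_cop x) \<le> norm (hsa_hs x) + norm (of_real (hsa_scalar x) :: 'a cop)"
    unfolding hsa_cop_def by (rule norm_triangle_ineq)
  then show ?thesis
    using norm_le_hs_norm[OF hilbert_schmidt_hsa adjoint_pair_hsa, of x] by (simp add: norm_hsa_def)
qed

lemma bounded_linear_hsa_cop: "bounded_linear hsa_cop"
  by (rule bounded_linear_intro[where K=1]) (simp_all add: hsa_cop_simps norm_hsa_cop_le)

lemma hsa_cop_exp: "hsa_cop (exp x) = exp (hsa_cop x)"
proof -
  have "hsa_cop (x ^ n) = hsa_cop x ^ n" for n by (induction n) (simp_all add: hsa_cop_simps)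
  then have "(\<lambda>n. hsa_cop (x ^ n /\<^sub>R fact n)) = (\<lambda>n. hsa_cop x ^ n /\<^sub>R fact n)"
    by (simp add: hsa_cop_simps)
  then show ?thesis
    using bounded_linear.sums[OF bounded_linear_hsa_cop exp_converges[of x]]
      exp_converges[of "hsa_cop x"] by (metis sums_unique2)
qed

lemma hsa_star_algebra:
  "hsa_star (hsa_star x) = x" "hsa_star 1 = 1" "hsa_star (x + y) = hsa_star x + hsa_star y"
  "hsa_star (c *\<^sub>R x) = c *\<^sub>R hsa_star x" "hsa_star (x * y) = hsa_star y * hsa_star x"
  by (auto intro!: hsa_eqI simp: hsa_star_simps hsa_vector_simps hsa_algebra_simps algebra_simps)

lemma bounded_linear_hsa_star: "bounded_linear hsa_star"
proof (rule bounded_linear_intro[where K=1])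
  show "norm (hsa_star x) \<le> norm x * 1" for x :: "'a hsa"
    using hs_adjoint_le(2)[OF hilbert_schmidt_hsa adjoint_pair_hsa, of x]
    by (simp add: norm_hsa_def hsa_star_simps)
qed (simp_all add: hsa_star_algebra)

lemma hsa_star_exp: "hsa_star (exp x) = exp (hsa_star x)"
proof -
  have "hsa_star (x ^ n) = hsa_star x ^ n" for n
    by (induction n) (simp_all add: hsa_star_algebra power_commutes)
  then have "(\<lambda>n. hsa_star (x ^ n /\<^sub>R fact n)) = (\<lambda>n. hsa_star x ^ n /\<^sub>R fact n)"
    by (simp add: hsa_star_algebra)
  then show ?thesis
    using bounded_linear.sums[OF bounded_linear_hsa_star exp_converges[of x]]
      exp_converges[of "hsa_star x"] by (metis sums_unique2)
qed

lift_definition hsr_embed :: "'a::separable_hilbert_space hsr \<Rightarrow> 'a hsa"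
  is "\<lambda>T. (scalar_part T, hs_part T, hs_part T)"
  by (auto simp: hs_part_eq adjoint_pair_self)

text \<open>Taking the selfadjoint part yields a linear left inverse of \<open>hsr_embed\<close>
  defined on the whole algebra, as \<open>smooth_on_linear_compose\<close> requires.\<close>

lift_definition hsr_proj :: "'a::separable_hilbert_space hsa \<Rightarrow> 'a hsr"
  is "\<lambda>(r, S, T). (1 / 2) *\<^sub>R (S + T) + of_real r"
proof clarify
  fix r :: real and S T :: "'a cop" assume *: "hilbert_schmidt S" "adjoint_pair S T"
  have "selfadjoint ((1 / 2) *\<^sub>R (S + T))"
    using adjoint_pair_simps(3)[OF * (2) adjoint_pair_sym[OF * (2)]]
    by (intro selfadjoint_simps(4)) (simp add: adjoint_pair_self[symmetric] add.commute)
  moreover have "hilbert_schmidt ((1 / 2) *\<^sub>R (S + T))"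
    using * hs_adjoint_le(1)[OF *] by (intro hilbert_schmidt_scaleR hilbert_schmidt_add)
  ultimately show "\<exists>a q. selfadjoint a \<and> hilbert_schmidt a \<and> (1 / 2) *\<^sub>R (S + T) + of_real r = a + of_real q"
    by blast
qed

lemma hsr_embed_simps:
  "hsa_scalar (hsr_embed x) = scalar_part (cop_of x)"
  "hsa_hs (hsr_embed x) = hs_part (cop_of x)" "hsa_adj (hsr_embed x) = hs_part (cop_of x)"
  by (transfer; auto)+

lemma hsa_cop_embed: "hsa_cop (hsr_embed x) = cop_of x"
  by (rule hsr_cases[of x]) (simp add: hsa_cop_def hsr_embed_simps)

lemma hsr_proj_embed: "hsr_proj (hsr_embed x) = x"
proof -
  have "cop_of (hsr_proj (hsr_embed x)) = cop_of x"
    by (rule hsr_cases[of x]) (simp add: hsr_proj.rep_eq hsr_embed.rep_eq flip: scaleR_2)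
  then show ?thesis by (simp add: cop_of_inject)
qed

lemma hsr_embed_proj:
  assumes "hsa_star x = x"
  shows "hsr_embed (hsr_proj x) = x"
proof -
  have "cop_of (hsr_proj x) = hsa_cop x"
    using assms unfolding hsa_cop_def
    by transfer (auto simp flip: scaleR_2)
  then show ?thesis by (simp add: hsa_cop_embed flip: hsa_cop_inject)
qed

lemma hsr_embed_inject: "hsr_embed x = hsr_embed y \<longleftrightarrow> x = y"
  using hsr_proj_embed by metis

lemma hsa_star_embed: "hsa_star (hsr_embed x) = hsr_embed x"
  by (rule hsa_eqI) (simp_all add: hsa_star_simps hsr_embed_simps)

lemma inner_hsr_eq:
  "inner x y = 4 * hs_form (hsa_hs (hsr_embed x)) (hsa_hs (hsr_embed y))
     + hsa_scalar (hsr_embed x) * hsa_scalar (hsr_embed y)"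
proof -
  obtain a r where x: "selfadjoint a" "hilbert_schmidt a" "cop_of x = a + of_real r"
    "hs_part (cop_of x) = a" "scalar_part (cop_of x) = r" by (rule hsr_cases[of x])
  obtain b q where y: "selfadjoint b" "hilbert_schmidt b" "cop_of y = b + of_real q"
    "hs_part (cop_of y) = b" "scalar_part (cop_of y) = q" by (rule hsr_cases[of y])
  show ?thesis
    unfolding inner_hsr_def inner2_def hsr_embed_simps x(4,5) y(4,5) Re_trace_hs[OF x(1,2) y(1,2)]
    by (simp add: hs_form_def inner_commute)
qed

lemma norm_hsr_eq: "(norm x)\<^sup>2 = 4 * (hs_norm (hsa_hs (hsr_embed x)))\<^sup>2 + (hsa_scalar (hsr_embed x))\<^sup>2"
  unfolding power2_norm_eq_inner inner_hsr_eq by (simp add: hs_form_self power2_eq_square)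

lemma bounded_linear_hsr_embed: "bounded_linear hsr_embed"
proof (rule bounded_linear_intro[where K=2])
  fix x y :: "'a hsr" and r :: real
  show "hsr_embed (x + y) = hsr_embed x + hsr_embed y"
    by (simp add: hsa_cop_embed hsa_cop_simps plus_hsr.rep_eq flip: hsa_cop_inject)
  show "hsr_embed (r *\<^sub>R x) = r *\<^sub>R hsr_embed x"
    by (simp add: hsa_cop_embed hsa_cop_simps scaleR_hsr.rep_eq flip: hsa_cop_inject)
  let ?h = "hs_norm (hsa_hs (hsr_embed x))" and ?r = "hsa_scalar (hsr_embed x)"
  have "?h\<^sup>2 \<le> (norm x)\<^sup>2" "?r\<^sup>2 \<le> (norm x)\<^sup>2"
    by (simp_all add: norm_hsr_eq)
  then have "?h \<le> norm x" "\<bar>?r\<bar> \<le> norm x"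
    by (auto intro: power2_le_imp_le simp: abs_le_square_iff[of ?r "norm x", simplified])
  then show "norm (hsr_embed x) \<le> norm x * 2" by (simp add: norm_hsa_def)
qed

lemma bounded_linear_hsr_proj: "bounded_linear hsr_proj"
proof (rule bounded_linear_intro[where K=2])
  fix x y :: "'a hsa" and r :: real
  show "hsr_proj (x + y) = hsr_proj x + hsr_proj y"
    by transfer (auto simp: algebra_simps)
  show "hsr_proj (r *\<^sub>R x) = r *\<^sub>R hsr_proj x"
    by transfer (auto simp: algebra_simps of_real_def)
  let ?y = "hsr_embed (hsr_proj x)"
  have y: "?y = (1 / 2) *\<^sub>R (x + hsa_star x)"
  proof -
    have "hsr_proj x = hsr_proj ((1 / 2) *\<^sub>R (x + hsa_star x))"
      by transfer (auto simp flip: scaleR_2 simp: add.commute)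
    moreover have "hsa_star ((1 / 2) *\<^sub>R (x + hsa_star x)) = (1 / 2) *\<^sub>R (x + hsa_star x)"
      by (simp add: hsa_star_algebra add.commute)
    ultimately show ?thesis by (metis hsr_embed_proj)
  qed
  have "norm (x + hsa_star x) \<le> norm x + norm (hsa_star x)" by (rule norm_triangle_ineq)
  moreover have "norm (hsa_star x) \<le> norm x"
    using hs_adjoint_le(2)[OF hilbert_schmidt_hsa adjoint_pair_hsa, of x]
    by (simp add: norm_hsa_def hsa_star_simps)
  ultimately have ny: "norm ?y \<le> norm x" unfolding y by simp
  have "(norm (hsr_proj x))\<^sup>2 \<le> (2 * norm ?y)\<^sup>2"
    using hs_norm_nonneg[of "hsa_hs ?y"]
    unfolding norm_hsr_eq norm_hsa_def by (simp add: power2_sum power_mult_distrib)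
  then have "norm (hsr_proj x) \<le> 2 * norm ?y"
    by (rule power2_le_imp_le) simp
  then show "norm (hsr_proj x) \<le> norm x * 2" using ny by simp
qed

instance hsr :: (separable_hilbert_space) complete_space
proof
  fix X :: "nat \<Rightarrow> 'a hsr" assume "Cauchy X"
  then have "Cauchy (\<lambda>n. hsr_embed (X n))" by (rule bounded_linear.Cauchy[OF bounded_linear_hsr_embed])
  then obtain L where "(\<lambda>n. hsr_embed (X n)) \<longlonglongrightarrow> L"
    using Cauchy_convergent convergent_def by blast
  from bounded_linear.tendsto[OF bounded_linear_hsr_proj this]
  show "convergent X" by (auto simp: hsr_proj_embed convergent_def)
qed

lemma hsr_exp_eq: "hsr_embed (hsr_exp x) = exp (hsr_embed x)"
  by (simp add: hsa_cop_embed hsa_cop_exp hsr_exp.rep_eq flip: hsa_cop_inject)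

section \<open>The logarithm on the cone of positive invertible operators\<close>

text \<open>In \<open>|x|^2 - 2 t <y, x> + t^2 |y|^2\<close> the choice of \<open>t\<close> gives
  \<open>t * N^2 \<le> c\<close>, so the last term costs at most half of the gain
  \<open>2 t c |x|^2\<close>. The summand \<open>c^2\<close> in the denominator keeps it positive
  and yields \<open>t * c \<le> 1\<close>.\<close>

lemma coercive_contraction:
  fixes x y :: "'a::real_inner"
  assumes c: "0 < c" and xy: "c * (norm x)\<^sup>2 \<le> inner y x" and y: "norm y \<le> N * norm x"
    and t: "t = c / (N\<^sup>2 + c\<^sup>2)"
  shows "norm (x - t *\<^sub>R y) \<le> sqrt (1 - t * c) * norm x"
proof -
  have p: "0 < N\<^sup>2 + c\<^sup>2" using c by (simp add: add_nonneg_pos)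
  have t0: "0 < t" using c p by (simp add: t)
  have tc: "t * N\<^sup>2 \<le> c"
    using p c by (simp add: t pos_divide_le_eq algebra_simps)
  have "(norm y)\<^sup>2 \<le> (N * norm x)\<^sup>2" using y by (intro power_mono) auto
  then have "t\<^sup>2 * (norm y)\<^sup>2 \<le> t * (t * N\<^sup>2) * (norm x)\<^sup>2"
    using t0 by (simp add: power2_eq_square mult_ac)
  also have "\<dots> \<le> t * c * (norm x)\<^sup>2"
    using tc t0 by (intro mult_right_mono mult_left_mono) auto
  finally have 1: "t\<^sup>2 * (norm y)\<^sup>2 \<le> t * c * (norm x)\<^sup>2" .
  have 2: "t * (c * (norm x)\<^sup>2) \<le> t * inner y x" using xy t0 by (intro mult_left_mono) auto
  have "(norm (x - t *\<^sub>R y))\<^sup>2 = (norm x)\<^sup>2 - 2 * (t * inner y x) + t\<^sup>2 * (norm y)\<^sup>2"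
    unfolding power2_norm_eq_inner by (simp add: algebra_simps inner_commute power2_eq_square)
  also have "\<dots> \<le> (1 - t * c) * (norm x)\<^sup>2" using 1 2 by (simp add: algebra_simps)
  finally have "sqrt ((norm (x - t *\<^sub>R y))\<^sup>2) \<le> sqrt ((1 - t * c) * (norm x)\<^sup>2)"
    by (rule real_sqrt_le_mono)
  then show ?thesis by (simp add: real_sqrt_mult)
qed

text \<open>Lax-Milgram by Banach's fixed point theorem: a solution is a fixed point of
  \<open>x + t (b - S x)\<close>, a map that stays in \<open>m\<close> and contracts by
  \<open>coercive_contraction\<close>.\<close>

lemma coercive_surjective:
  fixes S :: "'a::real_inner \<Rightarrow> 'a"
  assumes m: "complete m" "subspace m" and S: "\<And>x. x \<in> m \<Longrightarrow> S x \<in> m"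
    and diff: "\<And>x y. x \<in> m \<Longrightarrow> y \<in> m \<Longrightarrow> S (x - y) = S x - S y"
    and bd: "\<And>x. x \<in> m \<Longrightarrow> norm (S x) \<le> N * norm x"
    and c: "0 < c" and coer: "\<And>x. x \<in> m \<Longrightarrow> c * (norm x)\<^sup>2 \<le> inner (S x) x"
    and b: "b \<in> m"
  shows "\<exists>x\<in>m. S x = b"
proof -
  define t where "t = c / (N\<^sup>2 + c\<^sup>2)"
  have p: "0 < N\<^sup>2 + c\<^sup>2" using c by (simp add: add_nonneg_pos)
  have t0: "0 < t" and tc: "t * c \<le> 1"
    using c p by (simp_all add: t_def pos_divide_le_eq power2_eq_square)
  have "\<exists>!x\<in>m. x + t *\<^sub>R (b - S x) = x"
  proof (rule Banach_fix[OF m(1), where c="sqrt (1 - t * c)"])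
    show "m \<noteq> {}" using b by auto
    show "0 \<le> sqrt (1 - t * c)" "sqrt (1 - t * c) < 1" using t0 c tc by auto
    show "(\<lambda>x. x + t *\<^sub>R (b - S x)) ` m \<subseteq> m"
      using S b m(2) by (auto intro!: subspace_add subspace_scale subspace_diff)
    fix x y assume xy: "x \<in> m" "y \<in> m"
    then have d: "x - y \<in> m" by (rule subspace_diff[OF m(2)])
    have "x + t *\<^sub>R (b - S x) - (y + t *\<^sub>R (b - S y)) = (x - y) - t *\<^sub>R S (x - y)"
      using xy by (simp add: diff algebra_simps)
    then show "dist (x + t *\<^sub>R (b - S x)) (y + t *\<^sub>R (b - S y)) \<le> sqrt (1 - t * c) * dist x y"
      using coercive_contraction[OF c coer[OF d] bd[OF d] t_def] by (metis dist_norm)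
  qed
  then obtain x where "x \<in> m" "t *\<^sub>R (b - S x) = 0" by auto
  then show ?thesis using t0 by (intro bexI[of _ x]) auto
qed

section \<open>Coercive operators and positivity\<close>

definition coercive :: "'a::separable_hilbert_space cop \<Rightarrow> bool"
  where "coercive T \<longleftrightarrow> (\<exists>c>0. \<forall>x. c * (norm x)\<^sup>2 \<le> inner (cop_apply T x) x)"

lemma unit_elt_coercive:
  assumes "coercive T" shows "unit_elt T"
proof -
  obtain c where c: "0 < c" "\<And>x. c * (norm x)\<^sup>2 \<le> inner (cop_apply T x) x"
    using assms by (auto simp: coercive_def)
  define t where "t = c / ((norm T)\<^sup>2 + c\<^sup>2)"
  have t0: "0 < t" using c(1) by (simp add: t_def add_nonneg_pos)
  have tc: "t * c \<le> 1"
    using c(1) by (simp add: t_def pos_divide_le_eq add_nonneg_pos power2_eq_square)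
  have "norm (1 - t *\<^sub>R T) \<le> sqrt (1 - t * c)"
    using coercive_contraction[OF c norm_cop_apply t_def] tc
    by (intro norm_cop_le) (simp_all add: cop.diff_left cop.scaleR_left cop_apply_one)
  also have "\<dots> < 1" using t0 c(1) by simp
  finally have "unit_elt (1 - (1 - t *\<^sub>R T))" by (rule unit_one_minus(1))
  then obtain V where "V * (t *\<^sub>R T) = 1" "(t *\<^sub>R T) * V = 1" by (auto simp: unit_elt_def)
  then show ?thesis by (intro unit_eltI[of "t *\<^sub>R V"]) simp_all
qed

text \<open>Evaluating the nonnegative form at \<open>x - t T x\<close> gives
  \<open><T x, x> \<ge> 2 t |T x|^2 - t^2 <T T x, T x>\<close>. As
  \<open>t * norm T \<le> 1\<close>, the right side is at least \<open>t |T x|^2\<close>, and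
  \<open>S\<close> bounds \<open>|x|\<close> by \<open>|T x|\<close>.\<close>

lemma coercive_positive_unit:
  assumes T: "selfadjoint T" "positive_cop T" and S: "S * T = 1"
  shows "coercive T"
proof -
  have nn: "0 \<le> inner (cop_apply T x) x" for x
    using T(2) by (auto simp: positive_cop_def inner_eq_Re_cinner) (metis Re_complex_of_real)
  have S0: "0 < norm S" using S by auto
  define t where "t = 1 / (norm T + 1)"
  have t: "0 < t" by (simp add: t_def add_nonneg_pos)
  have tT: "t * norm T \<le> 1" by (simp add: t_def pos_divide_le_eq add_nonneg_pos)
  have "t / (norm S)\<^sup>2 * (norm x)\<^sup>2 \<le> inner (cop_apply T x) x" for x
  proof -
    let ?y = "cop_apply T x"
    have "norm x \<le> norm S * norm ?y"
      using norm_cop_apply[of S ?y] by (simp add: S cop_apply_one flip: cop_apply_times)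
    then have "(norm x)\<^sup>2 \<le> (norm S)\<^sup>2 * (norm ?y)\<^sup>2"
      unfolding power_mult_distrib[symmetric] by (intro power_mono) auto
    then have "t / (norm S)\<^sup>2 * (norm x)\<^sup>2 \<le> t * (norm ?y)\<^sup>2"
      using S0 t by (simp add: field_simps)
    moreover have "inner (cop_apply T ?y) ?y \<le> norm T * (norm ?y)\<^sup>2"
      using norm_cauchy_schwarz[of "cop_apply T ?y" ?y] mult_right_mono[OF norm_cop_apply[of T ?y], of "norm ?y"]
      by (simp add: power2_eq_square mult_ac)
    then have "t * (t * inner (cop_apply T ?y) ?y) \<le> t * ((t * norm T) * (norm ?y)\<^sup>2)"
      using t by (simp add: mult.assoc)
    moreover have "t * ((t * norm T) * (norm ?y)\<^sup>2) \<le> t * (norm ?y)\<^sup>2"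
      using tT t mult_right_mono[OF tT, of "(norm ?y)\<^sup>2"] by simp
    moreover have "0 \<le> inner (cop_apply T (x - t *\<^sub>R ?y)) (x - t *\<^sub>R ?y)" by (rule nn)
    moreover have "inner (cop_apply T ?y) x = (norm ?y)\<^sup>2"
      using T(1) by (simp add: selfadjoint_iff_inner power2_norm_eq_inner)
    then have "inner (cop_apply T (x - t *\<^sub>R ?y)) (x - t *\<^sub>R ?y)
        = inner ?y x - 2 * (t * (norm ?y)\<^sup>2) + t * (t * inner (cop_apply T ?y) ?y)"
      by (simp add: cop.diff_right cop.scaleR_right algebra_simps power2_norm_eq_inner)
    ultimately show ?thesis by linarith
  qed
  moreover have "0 < t / (norm S)\<^sup>2" using t S0 by simp
  ultimately show ?thesis unfolding coercive_def by blast
qed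

lemma selfadjoint_cop_of: "selfadjoint (cop_of p)"
  by (rule hsr_cases[of p]) (auto simp: of_real_def selfadjoint_simps)

lemma Sigma_iff: "p \<in> Sigma_set \<longleftrightarrow> coercive (cop_of p)"
proof
  assume "p \<in> Sigma_set"
  then show "coercive (cop_of p)"
    using coercive_positive_unit[OF selfadjoint_cop_of] by (auto simp: Sigma_set_def invertible_cop_def)
next
  assume c: "coercive (cop_of p)"
  then obtain V where "V * cop_of p = 1" "cop_of p * V = 1"
    using unit_elt_coercive by (auto simp: unit_elt_def)
  moreover have "\<exists>r\<ge>0. cinner (cop_apply (cop_of p) x) x = complex_of_real r" for x
  proof (intro exI conjI)
    have "cinner (cop_apply (cop_of p) x) x = cnj (cinner (cop_apply (cop_of p) x) x)"
      using selfadjoint_cop_of[of p] cinner_commute[of x "cop_apply (cop_of p) x"] by (simp add: selfadjoint_def)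
    then have "Im (cinner (cop_apply (cop_of p) x) x) = 0" by (simp add: complex_eq_iff)
    then show "cinner (cop_apply (cop_of p) x) x = complex_of_real (inner (cop_apply (cop_of p) x) x)"
      by (simp add: complex_eq_iff inner_eq_Re_cinner)
    show "0 \<le> inner (cop_apply (cop_of p) x) x"
      using c by (auto simp: coercive_def intro: order_trans[rotated])
  qed
  ultimately show "p \<in> Sigma_set" by (auto simp: Sigma_set_def positive_cop_def invertible_cop_def)
qed

lemma coercive_segment:
  assumes "coercive T" "s \<in> {0..1}"
  shows "coercive (1 + s *\<^sub>R (T - 1))"
proof -
  obtain c where c: "0 < c" "\<And>x. c * (norm x)\<^sup>2 \<le> inner (cop_apply T x) x"
    using assms by (auto simp: coercive_def)
  have "min 1 c * (norm x)\<^sup>2 \<le> inner (cop_apply (1 + s *\<^sub>R (T - 1)) x) x" for x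
  proof -
    have "(1 - s) * (min 1 c * (norm x)\<^sup>2) \<le> (1 - s) * (norm x)\<^sup>2"
      using assms(2) mult_right_mono[of "min 1 c" 1 "(norm x)\<^sup>2"] by (intro mult_left_mono) auto
    moreover have "s * (min 1 c * (norm x)\<^sup>2) \<le> s * inner (cop_apply T x) x"
      using assms(2) c(2)[of x] mult_right_mono[of "min 1 c" c "(norm x)\<^sup>2"] by (intro mult_left_mono) auto
    moreover have "inner (cop_apply (1 + s *\<^sub>R (T - 1)) x) x = (1 - s) * (norm x)\<^sup>2 + s * inner (cop_apply T x) x"
      by (simp add: cop.add_left cop.diff_left cop.scaleR_left cop_apply_one algebra_simps power2_norm_eq_inner)
    ultimately show ?thesis by (simp add: algebra_simps)
  qed
  moreover have "0 < min 1 c" using c by simp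
  ultimately show ?thesis unfolding coercive_def by blast
qed

lemma log_dom_coercive: "coercive T \<Longrightarrow> T \<in> log_dom"
  by (simp add: log_dom_def unit_elt_coercive coercive_segment)

text \<open>Supplies positivity of \<open>exp x\<close> and of
  \<open>exp (t x) * exp y * exp (t x)\<close>, both of the form \<open>g' * g\<close> with
  \<open>g\<close> invertible.\<close>

lemma coercive_square:
  assumes "adjoint_pair g g'" "h * g = 1"
  shows "coercive (g' * g)"
proof -
  have h: "0 < norm h" using assms(2) by auto
  have "1 / (norm h)\<^sup>2 * (norm x)\<^sup>2 \<le> inner (cop_apply (g' * g) x) x" for x
  proof -
    have "norm x \<le> norm h * norm (cop_apply g x)"
      using norm_cop_apply[of h "cop_apply g x"] by (simp add: assms cop_apply_one flip: cop_apply_times)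
    then have "(norm x)\<^sup>2 \<le> (norm h)\<^sup>2 * (norm (cop_apply g x))\<^sup>2"
      unfolding power_mult_distrib[symmetric] by (intro power_mono) auto
    moreover have "inner (cop_apply (g' * g) x) x = (norm (cop_apply g x))\<^sup>2"
      using adjoint_pairD[OF adjoint_pair_sym[OF assms(1)]]
      by (simp add: cop_apply_times power2_norm_eq_inner)
    ultimately show ?thesis using h by (simp add: field_simps)
  qed
  moreover have "0 < 1 / (norm h)\<^sup>2" using h by simp
  ultimately show ?thesis unfolding coercive_def by blast
qed

section \<open>Injectivity of \<open>exp\<close> on selfadjoint operators\<close>

lemma exp_half_square: "exp x = exp ((1 / 2) *\<^sub>R x) * exp ((1 / 2) *\<^sub>R x)"
  for x :: "'a::{real_normed_algebra_1,banach}"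
  using exp_add_commuting[of "(1 / 2) *\<^sub>R x" "(1 / 2) *\<^sub>R x"] by (simp flip: scaleR_add_left)

lemma exp_minus_left: "exp (- x) * exp x = 1"
  for x :: "'a::{real_normed_algebra_1,banach}"
  using exp_minus_inverse[of "- x"] by simp

lemma coercive_exp: "selfadjoint x \<Longrightarrow> coercive (exp x)"
  unfolding exp_half_square[of x]
  by (rule coercive_square[of _ _ "exp (- ((1 / 2) *\<^sub>R x))"])
    (auto simp: adjoint_pair_self exp_minus_left intro: selfadjoint_exp selfadjoint_simps)

text \<open>In the series of \<open><(exp w + exp (-w)) x, x> = 2 |x|^2\<close> the odd terms cancel
  and the even ones are nonnegative. The term of index 0 already equals \<open>2 |x|^2\<close>, so
  that of index 2, which is \<open>|w x|^2\<close>, vanishes.\<close>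

lemma exp_eq_one_selfadjoint:
  assumes w: "selfadjoint w" and e: "exp w = 1"
  shows "w = 0"
proof (rule cop_eqI)
  fix x
  have e': "exp (- w) = 1" using exp_minus_inverse[of w] e by simp
  define f where "f n = inner (cop_apply (w ^ n /\<^sub>R fact n + (- w) ^ n /\<^sub>R fact n) x) x" for n
  have bl: "bounded_linear (\<lambda>T. inner (cop_apply T x) x)"
    by (intro bounded_linear_intros cop.bounded_linear_left
        bounded_linear_compose[OF bounded_linear_inner_left])
  have "f sums inner (cop_apply (exp w + exp (- w)) x) x"
    unfolding f_def by (rule bounded_linear.sums[OF bl]) (intro sums_add exp_converges)
  then have fs: "f sums (2 * (norm x)\<^sup>2)"
    unfolding e e' cop.add_left cop_apply_one inner_add_left by (simp add: power2_norm_eq_inner)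
  have even: "f (m + m) = 2 / fact (m + m) * (norm (cop_apply (w ^ m) x))\<^sup>2" for m
  proof -
    have "(- w) ^ (m + m) = w ^ (m + m)" by (simp add: power_minus_even)
    moreover have "inner (cop_apply (w ^ (m + m)) x) x = (norm (cop_apply (w ^ m) x))\<^sup>2"
      using selfadjoint_simps(5)[OF w, of m]
      by (simp add: power_add cop_apply_times selfadjoint_iff_inner power2_norm_eq_inner)
    ultimately show ?thesis
      by (simp add: f_def cop.add_left cop.scaleR_left inner_add_left divide_inverse)
  qed
  have nn: "0 \<le> f n" for n
  proof (cases "even n")
    case True
    then obtain m where "n = m + m" by (metis evenE mult_2)
    then show ?thesis using even[of m] by simp
  next
    case False
    then show ?thesis by (simp add: f_def power_minus_odd cop.zero_left)
  qed
  have "sum f {0, 2} \<le> (\<Sum>n. f n)"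
    by (rule sum_le_suminf) (use fs nn sums_summable in auto)
  moreover have "(\<Sum>n. f n) = 2 * (norm x)\<^sup>2" using fs by (rule sums_unique[symmetric])
  moreover have "f 0 = 2 * (norm x)\<^sup>2" using even[of 0] by (simp add: cop_apply_one)
  moreover have "f 2 = (norm (cop_apply w x))\<^sup>2"
    using even[of 1] by (simp add: numeral_2_eq_2)
  ultimately have "(norm (cop_apply w x))\<^sup>2 \<le> 0" by simp
  then show "cop_apply w x = cop_apply 0 x" by (simp add: cop.zero_left)
qed

lemma selfadjoint_uinv:
  assumes "selfadjoint u" "unit_elt u"
  shows "selfadjoint (uinv u)"
  unfolding selfadjoint_iff_inner
proof (intro allI)
  fix x y
  have r: "cop_apply u (cop_apply (uinv u) z) = z" for z
    using assms(2) by (simp add: uinv_right cop_apply_one flip: cop_apply_times)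
  have "inner (cop_apply (uinv u) x) (cop_apply u (cop_apply (uinv u) y))
      = inner (cop_apply u (cop_apply (uinv u) x)) (cop_apply (uinv u) y)"
    using assms(1) by (simp add: selfadjoint_iff_inner)
  then show "inner (cop_apply (uinv u) x) y = inner x (cop_apply (uinv u) y)" by (simp add: r)
qed

lemma selfadjoint_alg_ln:
  assumes T: "selfadjoint T" "T \<in> log_dom"
  shows "selfadjoint (alg_ln T)"
proof -
  have "alg_ln T \<in> {x. selfadjoint x}"
    unfolding alg_ln_def
  proof (rule integral_in_closed_subspace[OF _ _ integrable_ln[OF T(2)]])
    show "subspace {x :: 'a cop. selfadjoint x}" by (simp add: subspace_def selfadjoint_simps)
    show "closed {x :: 'a cop. selfadjoint x}"
      unfolding closed_sequential_limits adjoint_pair_self[symmetric] using adjoint_pair_limit by blast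
    fix s :: real assume s: "s \<in> {0..1}"
    have T1: "adjoint_pair (T - 1) (T - 1)"
      using T(1) by (intro adjoint_pair_simps) (simp add: adjoint_pair_self)
    have "selfadjoint (resolv T s)"
      unfolding resolv_def
    proof (rule selfadjoint_uinv)
      show "selfadjoint (1 + s *\<^sub>R (T - 1))"
        using T1 by (intro selfadjoint_simps) (simp add: adjoint_pair_self)
    qed (use T(2) s in \<open>auto simp: log_dom_def\<close>)
    then have "adjoint_pair (resolv T s) (resolv T s)" by (simp add: adjoint_pair_self)
    with T1 have "adjoint_pair ((T - 1) * resolv T s) (resolv T s * (T - 1))"
      by (rule adjoint_pair_simps(6))
    moreover have "(T - 1) * resolv T s = resolv T s * (T - 1)"
      by (rule resolv_commute[OF T(2) s]) (simp add: algebra_simps)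
    ultimately show "(T - 1) * resolv T s \<in> {x. selfadjoint x}" by (simp add: adjoint_pair_self)
  qed
  then show ?thesis by simp
qed

text \<open>With \<open>z\<close> the logarithm of \<open>exp x\<close>, \<open>z\<close> commutes
  with \<open>x\<close>, so \<open>exp (x - z) = 1\<close> and \<open>x = z\<close>: a selfadjoint
  \<open>x\<close> is recovered from \<open>exp x\<close>.\<close>

lemma exp_inject_selfadjoint:
  assumes "selfadjoint x" "selfadjoint y" "exp x = exp y"
  shows "x = y"
proof -
  have *: "x = alg_ln (exp x)" if x: "selfadjoint x" for x :: "'a cop"
  proof -
    let ?z = "alg_ln (exp x)"
    have L: "exp x \<in> log_dom" by (intro log_dom_coercive coercive_exp x)
    have xz: "x * ?z = ?z * x" by (intro alg_ln_commute[OF L] exp_commute) simp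
    have "exp (x + (- ?z)) = exp x * exp (- ?z)"
      by (rule exp_add_commuting) (simp add: xz)
    also have "\<dots> = 1" using exp_minus_inverse[of ?z] exp_alg_ln[OF L] by simp
    finally have e: "exp (x + (- ?z)) = 1" .
    have "adjoint_pair (x - ?z) (x - ?z)"
      using x selfadjoint_alg_ln[OF selfadjoint_exp[OF x] L]
      by (intro adjoint_pair_simps) (simp_all add: adjoint_pair_self)
    then have "selfadjoint (x + (- ?z))" by (simp add: adjoint_pair_self)
    from exp_eq_one_selfadjoint[OF this e] show "x = ?z" by (simp add: algebra_simps)
  qed
  show ?thesis using *[OF assms(1)] *[OF assms(2)] assms(3) by simp
qed

text \<open>The inverse \<open>S\<close> of \<open>a + r\<close> as an operator satisfies
  \<open>S a = 1 - r S\<close>. Here \<open>r\<close> is nonzero, as otherwise 1 would be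
  Hilbert-Schmidt; solving for \<open>S\<close> exhibits it as \<open>1 / r\<close> plus a
  Hilbert-Schmidt operator.\<close>

lemma unit_elt_hsa:
  assumes star: "hsa_star u = u" and c: "coercive (hsa_cop u)"
  shows "unit_elt u"
proof -
  define S where "S = uinv (hsa_cop u)"
  let ?a = "hsa_hs u" and ?r = "hsa_scalar u"
  have U: "unit_elt (hsa_cop u)" by (rule unit_elt_coercive[OF c])
  have SA: "selfadjoint S"
    unfolding S_def using adjoint_pair_star[of u] U by (intro selfadjoint_uinv) (simp_all add: star adjoint_pair_self)
  have S1: "S * (?a + of_real ?r) = 1" using uinv_left[OF U] by (simp add: S_def hsa_cop_def)
  have Sa: "S * ?a = 1 - ?r *\<^sub>R S" using S1 by (simp add: algebra_simps of_real_def)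
  have hs: "hilbert_schmidt (S * ?a)" by (rule hilbert_schmidt_left[OF hilbert_schmidt_hsa])
  have r: "?r \<noteq> 0"
  proof
    assume "?r = 0"
    then have "hilbert_schmidt (of_real 1 :: 'a cop)" using hs Sa by simp
    then show False unfolding not_hilbert_schmidt_of_real by simp
  qed
  define b where "b = (- 1 / ?r) *\<^sub>R (S * ?a)"
  have b: "hilbert_schmidt b" unfolding b_def by (rule hilbert_schmidt_scaleR[OF hs])
  have "adjoint_pair (S * ?a) (S * ?a)"
    unfolding Sa using SA by (intro adjoint_pair_simps) (simp add: adjoint_pair_self)
  then have bb: "adjoint_pair b b" unfolding b_def by (rule adjoint_pair_simps)
  define v where "v = Abs_hsa (1 / ?r, b, b)"
  have v: "hsa_scalar v = 1 / ?r" "hsa_hs v = b"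
    using b bb by (simp_all add: v_def hsa_scalar.rep_eq hsa_hs.rep_eq Abs_hsa_inverse)
  have "hsa_cop v = S"
    unfolding hsa_cop_def v b_def Sa using r by (simp add: of_real_def algebra_simps)
  then have "hsa_cop (v * u) = hsa_cop 1" "hsa_cop (u * v) = hsa_cop 1"
    using uinv_left[OF U] uinv_right[OF U] by (simp_all add: hsa_cop_simps S_def)
  then show ?thesis by (intro unit_eltI[of v]) (simp_all only: hsa_cop_inject)
qed

lemma log_dom_hsa:
  assumes "hsa_star u = u" "coercive (hsa_cop u)"
  shows "u \<in> log_dom"
  unfolding log_dom_def
proof (intro CollectI ballI unit_elt_hsa)
  fix s :: real assume s: "s \<in> {0..1}"
  have "hsa_star (u + (-1) *\<^sub>R 1) = u + (-1) *\<^sub>R 1" unfolding hsa_star_algebra assms ..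
  then have "hsa_star (u - 1) = u - 1" by simp
  then show "hsa_star (1 + s *\<^sub>R (u - 1)) = 1 + s *\<^sub>R (u - 1)" by (simp add: hsa_star_algebra)
  show "coercive (hsa_cop (1 + s *\<^sub>R (u - 1)))"
    using coercive_segment[OF assms(2) s] by (simp add: hsa_cop_simps)
qed

lemma hsa_star_fixed_iff: "hsa_star u = u \<longleftrightarrow> selfadjoint (hsa_cop u)"
proof
  assume "selfadjoint (hsa_cop u)"
  then have "hsa_cop (hsa_star u) = hsa_cop u"
    using adjoint_pair_unique[OF adjoint_pair_star, of u "hsa_cop u"] by (simp add: adjoint_pair_self)
  then show "hsa_star u = u" by (simp only: hsa_cop_inject)
qed (use adjoint_pair_star[of u] in \<open>simp add: adjoint_pair_self\<close>)

text \<open>The involution fixes \<open>1 + s (u - 1)\<close>, hence its inverse by uniqueness,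
  hence the integrand because its factors commute.\<close>

lemma hsa_star_alg_ln:
  assumes u: "hsa_star u = u" "u \<in> log_dom"
  shows "hsa_star (alg_ln u) = alg_ln u"
proof -
  interpret star: bounded_linear hsa_star by (rule bounded_linear_hsa_star)
  have "alg_ln u \<in> {x. hsa_star x = x}"
    unfolding alg_ln_def
  proof (rule integral_in_closed_subspace[OF _ _ integrable_ln[OF u(2)]])
    show "subspace {x :: 'a hsa. hsa_star x = x}"
      by (auto simp: subspace_def star.zero star.add star.scaleR)
    show "closed {x :: 'a hsa. hsa_star x = x}"
      by (intro closed_Collect_eq star.continuous_on continuous_intros)
    fix s :: real assume s: "s \<in> {0..1}"
    have 1: "hsa_star (1 + s *\<^sub>R (u - 1)) = 1 + s *\<^sub>R (u - 1)"
      by (simp add: star.add star.scaleR star.diff u hsa_star_algebra(2))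
    have "hsa_star (resolv u s) * (1 + s *\<^sub>R (u - 1)) = 1" "(1 + s *\<^sub>R (u - 1)) * hsa_star (resolv u s) = 1"
      using resolv_inverse[OF u(2) s, THEN arg_cong[of _ _ hsa_star]]
      unfolding hsa_star_algebra(5) hsa_star_algebra(2) 1 by simp_all
    then have "hsa_star (resolv u s) = resolv u s"
      unfolding resolv_def by (rule uinv_eqI[symmetric])
    moreover have "(u - 1) * resolv u s = resolv u s * (u - 1)"
      by (rule resolv_commute[OF u(2) s]) (simp add: algebra_simps)
    ultimately show "(u - 1) * resolv u s \<in> {x. hsa_star x = x}"
      by (simp add: hsa_star_algebra(5) star.diff u hsa_star_algebra(2))
  qed
  then show ?thesis by simp
qed

lemma alg_ln_exp_hsa:
  assumes x: "hsa_star x = x"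
  shows "alg_ln (exp x) = x"
proof -
  have 1: "hsa_star (exp x) = exp x" by (simp add: hsa_star_exp x)
  have sx: "selfadjoint (hsa_cop x)" using x by (simp add: hsa_star_fixed_iff)
  have L: "exp x \<in> log_dom"
    by (rule log_dom_hsa[OF 1]) (simp add: hsa_cop_exp coercive_exp sx)
  have "hsa_cop (alg_ln (exp x)) = hsa_cop x"
  proof (rule exp_inject_selfadjoint[OF _ sx])
    show "selfadjoint (hsa_cop (alg_ln (exp x)))"
      using hsa_star_alg_ln[OF 1 L] by (simp add: hsa_star_fixed_iff)
    show "exp (hsa_cop (alg_ln (exp x))) = exp (hsa_cop x)"
      unfolding hsa_cop_exp[symmetric] exp_alg_ln[OF L] ..
  qed
  then show ?thesis by (simp only: hsa_cop_inject)
qed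

lemma cop_ln_exp: "selfadjoint x \<Longrightarrow> cop_ln (exp x) = x"
  unfolding cop_ln_def by (rule the_equality) (auto intro: exp_inject_selfadjoint)

definition hsr_ln :: "'a::separable_hilbert_space hsr \<Rightarrow> 'a hsr"
  where "hsr_ln p = hsr_proj (alg_ln (hsr_embed p))"

lemma log_dom_Sigma: "p \<in> Sigma_set \<Longrightarrow> hsr_embed p \<in> log_dom"
  by (rule log_dom_hsa[OF hsa_star_embed]) (simp add: hsa_cop_embed Sigma_iff)

lemma hsr_exp_ln: "p \<in> Sigma_set \<Longrightarrow> hsr_exp (hsr_ln p) = p"
  by (simp add: hsr_exp_eq hsr_ln_def hsr_embed_proj hsa_star_alg_ln hsa_star_embed log_dom_Sigma
      exp_alg_ln flip: hsr_embed_inject)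

lemma hsr_ln_exp: "hsr_ln (hsr_exp x) = x"
  by (simp add: hsr_ln_def hsr_exp_eq alg_ln_exp_hsa hsa_star_embed hsr_proj_embed)

lemma hsr_exp_in_Sigma: "hsr_exp x \<in> Sigma_set"
  by (simp add: Sigma_iff hsr_exp.rep_eq coercive_exp selfadjoint_cop_of)

lemma smooth_on_hsr_exp: "smooth_on UNIV hsr_exp"
proof (rule smooth_on_subset[OF smooth_on_linear_compose[OF smooth_on_exp bounded_linear_hsr_embed bounded_linear_hsr_proj]])
  show "hsr_proj (exp (hsr_embed x)) = hsr_exp x" for x
    by (simp flip: hsr_exp_eq add: hsr_proj_embed)
qed auto

lemma smooth_on_hsr_ln: "smooth_on Sigma_set hsr_ln"
  by (rule smooth_on_subset[OF smooth_on_linear_compose[OF smooth_on_alg_ln bounded_linear_hsr_embed bounded_linear_hsr_proj]])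
    (auto simp: log_dom_Sigma hsr_ln_def)

text \<open>A perturbation of operator norm at most \<open>c / 2\<close> leaves the coercivity
  constant \<open>c / 2\<close>; the factor \<open>K\<close> converts the Hilbert norm of
  \<open>hsr\<close> into the operator norm.\<close>

lemma open_Sigma: "open (Sigma_set :: 'a::separable_hilbert_space hsr set)"
  unfolding open_dist
proof
  fix p :: "'a hsr" assume "p \<in> Sigma_set"
  then obtain c where c: "0 < c" "\<And>x. c * (norm x)\<^sup>2 \<le> inner (cop_apply (cop_of p) x) x"
    by (auto simp: Sigma_iff coercive_def)
  obtain K where K: "0 < K" "\<And>x :: 'a hsr. norm (hsr_embed x) \<le> norm x * K"
    using bounded_linear.pos_bounded[OF bounded_linear_hsr_embed] by blast
  show "\<exists>e>0. \<forall>q. dist q p < e \<longrightarrow> q \<in> Sigma_set"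
  proof (intro exI[of _ "c / (2 * K)"] conjI allI impI)
    show "0 < c / (2 * K)" using c K by simp
    fix q assume q: "dist q p < c / (2 * K)"
    have d: "cop_of q - cop_of p = hsa_cop (hsr_embed (q - p))"
      by (simp add: hsa_cop_embed hsa_cop_simps linear_diff[OF bounded_linear.linear[OF bounded_linear_hsr_embed]])
    have "norm (cop_of q - cop_of p) \<le> norm (q - p) * K"
      unfolding d by (rule order_trans[OF norm_hsa_cop_le K(2)])
    also have "\<dots> \<le> c / 2" using q K(1) by (simp add: dist_norm field_simps)
    finally have n: "norm (cop_of q - cop_of p) \<le> c / 2" .
    have "c / 2 * (norm x)\<^sup>2 \<le> inner (cop_apply (cop_of q) x) x" for x
    proof -
      have "\<bar>inner (cop_apply (cop_of q - cop_of p) x) x\<bar> \<le> norm (cop_of q - cop_of p) * norm x * norm x"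
        by (rule order_trans[OF Cauchy_Schwarz_ineq2]) (intro mult_right_mono norm_cop_apply norm_ge_zero)
      also have "\<dots> \<le> c / 2 * norm x * norm x" using n by (intro mult_right_mono) auto
      finally have "- inner (cop_apply (cop_of q - cop_of p) x) x \<le> c / 2 * norm x * norm x"
        by (rule abs_le_D2)
      then show ?thesis
        using c(2)[of x] by (simp add: cop.diff_left inner_diff_left power2_eq_square mult.assoc)
    qed
    then show "q \<in> Sigma_set"
      unfolding Sigma_iff coercive_def using c(1) by (intro exI[of _ "c / 2"]) auto
  qed
qed

section \<open>Lie triple systems in Banach algebras\<close>

definition ad :: "'a::ring \<Rightarrow> 'a \<Rightarrow> 'a"
  where "ad x c = x * c - c * x"

lemma ad_pow_scaleR: "(ad (r *\<^sub>R x) ^^ n) c = r ^ n *\<^sub>R (ad x ^^ n) c"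
  for x :: "'a::real_normed_algebra"
  by (induction n) (simp_all add: ad_def algebra_simps)

text \<open>This is \<open>Ad (exp x) = exp (ad x)\<close>. The Cauchy product of the two
  exponential series with \<open>c\<close> between them satisfies
  \<open>(n + 1) S (n + 1) = ad x (S n)\<close>, the recursion of the series on the left.\<close>

lemma exp_conj_sums:
  fixes x c :: "'a::{real_normed_algebra_1,banach}"
  shows "(\<lambda>n. (ad x ^^ n) c /\<^sub>R fact n) sums (exp x * c * exp (- x))"
proof -
  define X where "X n = x ^ n /\<^sub>R fact n" for n
  define Y where "Y n = (- x) ^ n /\<^sub>R fact n" for n
  define S where "S n = (\<Sum>i\<le>n. X i * c * Y (n - i))" for n
  have X: "real (Suc n) *\<^sub>R X (Suc n) = x * X n" for n
    by (simp add: X_def field_simps del: of_nat_Suc)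
  have Y: "real (Suc n) *\<^sub>R Y (Suc n) = - Y n * x" for n
    by (simp add: Y_def field_simps power_Suc2 del: power_Suc of_nat_Suc)
  have rec: "real (Suc n) *\<^sub>R S (Suc n) = ad x (S n)" for n
  proof -
    \<comment> \<open>The weight \<open>n + 1\<close> is split as \<open>i + (n + 1 - i)\<close>,
      and each part cancels one factorial, in \<open>X\<close> or in \<open>Y\<close>. The boundary
      term with weight 0 drops out of either sum.\<close>
    have "real (Suc n) *\<^sub>R S (Suc n)
        = (\<Sum>i\<le>Suc n. real i *\<^sub>R (X i * c * Y (Suc n - i)) + real (Suc n - i) *\<^sub>R (X i * c * Y (Suc n - i)))"
      unfolding S_def scaleR_sum_right by (intro sum.cong) (simp_all flip: scaleR_add_left of_nat_add)
    also have "\<dots> = (\<Sum>i\<le>Suc n. real i *\<^sub>R (X i * c * Y (Suc n - i)))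
        + (\<Sum>i\<le>Suc n. real (Suc n - i) *\<^sub>R (X i * c * Y (Suc n - i)))"
      by (rule sum.distrib)
    also have "(\<Sum>i\<le>Suc n. real i *\<^sub>R (X i * c * Y (Suc n - i)))
        = (\<Sum>i\<le>n. real (Suc i) *\<^sub>R X (Suc i) * c * Y (n - i))"
      by (simp only: sum.atMost_Suc_shift) simp
    also have "\<dots> = x * S n"
      unfolding X S_def sum_distrib_left by (simp add: mult.assoc)
    also have "(\<Sum>i\<le>Suc n. real (Suc n - i) *\<^sub>R (X i * c * Y (Suc n - i)))
        = (\<Sum>i\<le>n. X i * c * (real (Suc (n - i)) *\<^sub>R Y (Suc (n - i))))"
      by (simp add: Suc_diff_le add_diff_eq)
    also have "\<dots> = - (S n * x)"
      unfolding Y S_def sum_distrib_right sum_negf[symmetric] by (intro sum.cong) (simp_all add: mult.assoc)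
    finally show ?thesis by (simp add: ad_def)
  qed
  have S: "S n = (ad x ^^ n) c /\<^sub>R fact n" for n
  proof (induction n)
    case 0
    show ?case by (simp add: S_def X_def Y_def)
  next
    case (Suc n)
    have "S (Suc n) = (real (Suc n) *\<^sub>R S (Suc n)) /\<^sub>R real (Suc n)" by simp
    also have "\<dots> = ad x ((ad x ^^ n) c /\<^sub>R fact n) /\<^sub>R real (Suc n)" unfolding rec Suc ..
    also have "\<dots> = (ad x ^^ Suc n) c /\<^sub>R fact (Suc n)"
      by (simp add: ad_def scaleR_diff_right)
    finally show ?case .
  qed
  have "summable (\<lambda>n. norm (X n * c))"
    by (rule summable_comparison_test'[OF summable_mult2[OF summable_norm_exp[of x], of "norm c"]])
      (unfold X_def real_norm_def abs_norm_cancel, rule norm_mult_ineq)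
  moreover have "summable (\<lambda>n. norm (Y n))"
    unfolding Y_def by (rule summable_norm_exp)
  ultimately have "(\<lambda>n. \<Sum>i\<le>n. X i * c * Y (n - i)) sums ((\<Sum>n. X n * c) * (\<Sum>n. Y n))"
    by (rule Cauchy_product_sums)
  moreover have "(\<Sum>n. X n * c) = exp x * c" "(\<Sum>n. Y n) = exp (- x)"
    using sums_mult2[OF exp_converges[of x], of c] exp_converges[of "- x"]
    unfolding X_def Y_def by (auto dest: sums_unique)
  ultimately show ?thesis using S unfolding S_def by simp
qed

text \<open>\<open>ad x (ad x c)\<close> is the triple bracket \<open>[[c, x], x]\<close>; its
  iterates are the even powers of \<open>ad x\<close>.\<close>

definition lie_triple :: "'a::ring set \<Rightarrow> bool"
  where "lie_triple K \<longleftrightarrow> (\<forall>x\<in>K. \<forall>c\<in>K. ad x (ad x c) \<in> K)"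

lemma sums_in_closed_subspace:
  assumes K: "subspace K" "closed K" and f: "f sums s" "\<And>n. f n \<in> K"
  shows "s \<in> K"
proof (rule closed_sequence_limit[OF K(2) _ f(1)[unfolded sums_def]])
  show "sum f {..<n} \<in> K" for n by (intro subspace_sum K(1) f(2))
qed

text \<open>Adding the series for \<open>x\<close> and \<open>-x\<close> cancels the odd powers of
  \<open>ad x\<close>, which may leave \<open>K\<close>.\<close>

lemma exp_conj_in_lie_triple:
  fixes x c :: "'a::{real_normed_algebra_1,banach}"
  assumes K: "subspace K" "closed K" "lie_triple K" and x: "x \<in> K" and c: "c \<in> K"
  shows "exp x * c * exp (- x) + exp (- x) * c * exp x \<in> K"
proof (rule sums_in_closed_subspace[OF K(1,2)])
  have m: "(ad (- x) ^^ n) c = (- 1) ^ n *\<^sub>R (ad x ^^ n) c" for n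
    using ad_pow_scaleR[of n "- 1" x c] by simp
  show "(\<lambda>n. (ad x ^^ n) c /\<^sub>R fact n + (ad (- x) ^^ n) c /\<^sub>R fact n) sums
      (exp x * c * exp (- x) + exp (- x) * c * exp x)"
    using sums_add[OF exp_conj_sums[of x c] exp_conj_sums[of "- x" c]] by simp
  fix n
  show "(ad x ^^ n) c /\<^sub>R fact n + (ad (- x) ^^ n) c /\<^sub>R fact n \<in> K"
  proof (cases "even n")
    case True
    have "(ad x ^^ (2 * k)) c \<in> K" for k
      by (induction k) (use K(3) x c in \<open>auto simp: lie_triple_def\<close>)
    then have "(ad x ^^ n) c \<in> K" using True by (metis dvd_def)
    then have "(2 / fact n) *\<^sub>R (ad x ^^ n) c \<in> K" by (rule subspace_scale[OF K(1)])
    then show ?thesis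
      unfolding m using True by (simp add: divide_inverse flip: scaleR_2)
  next
    case False
    then show ?thesis unfolding m using subspace_0[OF K(1)] by simp
  qed
qed

text \<open>The operator \<open>sinh (ad b / 2) / (ad b / 2)\<close>, written as the average of the
  conjugations \<open>exp (u ad b)\<close>, so that invariance and coercivity can be checked on the
  integrand.\<close>

definition conj_int :: "'a::{real_normed_algebra_1,banach} \<Rightarrow> 'a \<Rightarrow> 'a"
  where "conj_int b c = integral {- 1 / 2..1 / 2} (\<lambda>u. exp (u *\<^sub>R b) * c * exp (- (u *\<^sub>R b)))"

lemma continuous_on_exp_algebra [continuous_intros]:
  fixes f :: "'b::topological_space \<Rightarrow> 'a::{real_normed_algebra_1,banach}"
  assumes "continuous_on S f"
  shows "continuous_on S (\<lambda>x. exp (f x))"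
  using continuous_on_compose2[OF smooth_on_imp_continuous_on[OF smooth_on_exp] assms] by simp

lemma integrable_conj:
  "(\<lambda>u. exp (u *\<^sub>R b) * c * exp (- (u *\<^sub>R b))) integrable_on {s..t}"
  for b c :: "'a::{real_normed_algebra_1,banach}"
  by (intro integrable_continuous_interval continuous_intros)

lemma conj_int_diff: "conj_int b (c - d) = conj_int b c - conj_int b d"
proof -
  have "(\<lambda>u. exp (u *\<^sub>R b) * (c - d) * exp (- (u *\<^sub>R b)))
      = (\<lambda>u. exp (u *\<^sub>R b) * c * exp (- (u *\<^sub>R b)) - exp (u *\<^sub>R b) * d * exp (- (u *\<^sub>R b)))"
    by (simp only: left_diff_distrib right_diff_distrib)
  then show ?thesis
    unfolding conj_int_def by (simp only: integral_diff[OF integrable_conj integrable_conj])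
qed

lemma norm_exp_scaleR_le:
  fixes b :: "'a::{real_normed_algebra_1,banach}"
  assumes "\<bar>u\<bar> \<le> r" "norm b \<le> B"
  shows "norm (exp (u *\<^sub>R b)) \<le> exp (r * B)"
proof -
  have "norm (u *\<^sub>R b) \<le> r * B"
    unfolding norm_scaleR using assms by (intro mult_mono) auto
  then show ?thesis using norm_exp[of "u *\<^sub>R b"] by (meson exp_le_cancel_iff order_trans)
qed

lemma norm_mult3_le: "norm (x * y * z) \<le> norm x * norm y * norm z"
  for x y z :: "'a::real_normed_algebra"
  by (rule order_trans[OF norm_mult_ineq mult_right_mono[OF norm_mult_ineq norm_ge_zero]])

lemma norm_conj_int_le: "norm (conj_int b c) \<le> exp (norm b) * norm c"
proof -
  have "norm (conj_int b c) \<le> (exp (norm b) * norm c) * (1 / 2 - (- 1 / 2))"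
    unfolding conj_int_def
  proof (rule integral_bound)
    fix u :: real assume u: "u \<in> {- 1 / 2..1 / 2}"
    have "norm (exp (u *\<^sub>R b)) \<le> exp (1 / 2 * norm b)" "norm (exp (- (u *\<^sub>R b))) \<le> exp (1 / 2 * norm b)"
      using norm_exp_scaleR_le[of u "1 / 2" b "norm b"] norm_exp_scaleR_le[of "- u" "1 / 2" b "norm b"] u
      by auto
    then have "norm (exp (u *\<^sub>R b)) * norm c * norm (exp (- (u *\<^sub>R b)))
        \<le> exp (1 / 2 * norm b) * norm c * exp (1 / 2 * norm b)"
      by (intro mult_mono) auto
    also have "\<dots> = exp (norm b) * norm c"
      using exp_add[of "norm b / 2" "norm b / 2"] by (simp add: mult_ac)
    finally show "norm (exp (u *\<^sub>R b) * c * exp (- (u *\<^sub>R b))) \<le> exp (norm b) * norm c"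
      using norm_mult3_le order_trans by blast
  qed (auto intro!: continuous_intros)
  then show ?thesis by simp
qed

text \<open>A single conjugate may leave \<open>K\<close>, but its sum with the conjugate at
  \<open>-u\<close> does not, and the symmetric interval allows the integrand to be replaced by half
  this sum.\<close>

lemma conj_int_in_lie_triple:
  assumes K: "subspace K" "closed K" "lie_triple K" and b: "b \<in> K" and c: "c \<in> K"
  shows "conj_int b c \<in> K"
proof -
  let ?f = "\<lambda>u. exp (u *\<^sub>R b) * c * exp (- (u *\<^sub>R b))"
  have "integral {- 1 / 2..1 / 2} (\<lambda>u. ?f (- u)) = integral {- 1 / 2..1 / 2} ?f"
  proof (rule integral_unique)
    have "(?f has_integral integral {- 1 / 2..1 / 2} ?f) {- 1 / 2..1 / 2}"
      by (rule integrable_integral[OF integrable_conj])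
    from has_integral_reflect_lemma_real[OF this]
    show "((\<lambda>u. ?f (- u)) has_integral integral {- 1 / 2..1 / 2} ?f) {- 1 / 2..1 / 2}" by simp
  qed
  then have "2 *\<^sub>R conj_int b c = integral {- 1 / 2..1 / 2} (\<lambda>u. ?f u) + integral {- 1 / 2..1 / 2} (\<lambda>u. ?f (- u))"
    by (simp add: conj_int_def scaleR_2)
  also have "\<dots> = integral {- 1 / 2..1 / 2} (\<lambda>u. ?f u + ?f (- u))"
    by (rule integral_add[symmetric]) (intro integrable_continuous_interval continuous_intros)+
  also have "\<dots> \<in> K"
  proof (rule integral_in_closed_subspace[OF K(1,2)])
    show "(\<lambda>u. ?f u + ?f (- u)) integrable_on {- 1 / 2..1 / 2}"
      by (intro integrable_continuous_interval continuous_intros)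
    fix u :: real
    show "?f u + ?f (- u) \<in> K"
      using exp_conj_in_lie_triple[OF K subspace_scale[OF K(1) b, of u] c] by simp
  qed
  finally have "(1 / 2) *\<^sub>R (2 *\<^sub>R conj_int b c) \<in> K" by (rule subspace_scale[OF K(1)])
  then show ?thesis by simp
qed

text \<open>The hypothesis on \<open>c\<close> says that the derivative of \<open>exp\<close> at \<open>b\<close> maps \<open>c\<close> to the velocity
  \<open>x * exp b + exp b * x\<close> of the curve \<open>\<lambda>h. exp (h x) * exp b * exp (h x)\<close>.\<close>

lemma exp_euler_step:
  fixes b c x :: "'a::{real_normed_algebra_1,banach}"
  assumes b: "norm b \<le> B" and c: "norm c \<le> C" and x: "norm x \<le> X"
    and h: "0 \<le> h" "h \<le> 1" "h * C \<le> 1"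
    and bc: "exp ((1 / 2) *\<^sub>R b) * conj_int b c * exp ((1 / 2) *\<^sub>R b) = x * exp b + exp b * x"
  shows "norm (exp (b + h *\<^sub>R c) - exp (h *\<^sub>R x) * exp b * exp (h *\<^sub>R x))
    \<le> (3 * exp (B + 2) * C * C * exp B + X\<^sup>2 * exp B + 4 * (exp (X + 1) * X\<^sup>2 * exp B * exp X)) * h\<^sup>2"
proof -
  let ?S = "{- 1 / 2..1 / 2} :: real set"
  have C: "0 \<le> C" and X: "0 \<le> X" and B: "0 \<le> B" using b c x norm_ge_zero order_trans by blast+
  define E where "E = exp b"
  have nE: "norm E \<le> exp B" unfolding E_def using norm_exp[of b] b by (meson exp_le_cancel_iff order_trans)
  let ?f = "\<lambda>u. exp ((u + 1 / 2) *\<^sub>R b) * c * exp ((1 / 2 - u) *\<^sub>R b)"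
  let ?g = "\<lambda>u. exp ((u + 1 / 2) *\<^sub>R (b + h *\<^sub>R c)) * (h *\<^sub>R c) * exp ((1 / 2 - u) *\<^sub>R b)"
  have f_cont: "continuous_on ?S ?f" by (intro continuous_intros)
  \<comment> \<open>The Duhamel integrand with \<open>b\<close> in both exponentials is a conjugate
    of \<open>c\<close> between two factors \<open>exp (b / 2)\<close>, so its integral is the
    prescribed velocity.\<close>
  have "integral ?S ?f = x * E + E * x"
  proof -
    have fe: "?f u = exp ((1 / 2) *\<^sub>R b) * (exp (u *\<^sub>R b) * c * exp (- (u *\<^sub>R b))) * exp ((1 / 2) *\<^sub>R b)" for u
    proof -
      have "exp ((u + 1 / 2) *\<^sub>R b) = exp ((1 / 2) *\<^sub>R b) * exp (u *\<^sub>R b)"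
        using exp_add_commuting[of "(1 / 2) *\<^sub>R b" "u *\<^sub>R b"] by (simp add: scaleR_add_left add.commute)
      moreover have "exp ((1 / 2 - u) *\<^sub>R b) = exp (- (u *\<^sub>R b)) * exp ((1 / 2) *\<^sub>R b)"
        using exp_add_commuting[of "- (u *\<^sub>R b)" "(1 / 2) *\<^sub>R b"] by (simp add: scaleR_diff_left)
      ultimately show ?thesis by (simp add: mult.assoc)
    qed
    have "bounded_linear (\<lambda>y. exp ((1 / 2) *\<^sub>R b) * y * exp ((1 / 2) *\<^sub>R b))"
      by (intro bounded_linear_intros bounded_linear_compose[OF bounded_linear_mult_left]
          bounded_linear_mult_right)
    from integral_linear[OF integrable_conj this, of "- 1 / 2" "1 / 2" b c]
    have "integral ?S ?f = exp ((1 / 2) *\<^sub>R b) * conj_int b c * exp ((1 / 2) *\<^sub>R b)"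
      unfolding fe conj_int_def o_def .
    then show ?thesis using bc by (simp add: E_def)
  qed
  then have If: "(?f has_integral x * E + E * x) ?S"
    using integrable_integral[of ?f ?S]
    by (metis integrable_continuous_interval[OF f_cont])
  have "(?g has_integral exp (b + h *\<^sub>R c) - E) ?S"
    unfolding E_def by (rule exp_duhamel)
  from has_integral_diff[OF this has_integral_cmul[OF If, of h]]
  have "((\<lambda>u. ?g u - h *\<^sub>R ?f u) has_integral (exp (b + h *\<^sub>R c) - E - h *\<^sub>R (x * E + E * x))) (cbox (- 1 / 2) (1 / 2))"
    by simp
  then have "norm (exp (b + h *\<^sub>R c) - E - h *\<^sub>R (x * E + E * x))
      \<le> (3 * exp (B + 2) * C * C * exp B * h\<^sup>2) * measure lborel (cbox (- 1 / 2) (1 / 2 :: real))"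
  proof (rule has_integral_bound[rotated])
    show "0 \<le> 3 * exp (B + 2) * C * C * exp B * h\<^sup>2" using C by simp
    fix u :: real assume "u \<in> cbox (- 1 / 2) (1 / 2)"
    then have u: "\<bar>u + 1 / 2\<bar> \<le> 1" "\<bar>1 / 2 - u\<bar> \<le> 1" by auto
    \<comment> \<open>The integrands differ in the first exponential alone. That difference is
      \<open>O(h)\<close>, and the factor \<open>h c\<close> supplies the second power of
      \<open>h\<close>.\<close>
    have "?g u - h *\<^sub>R ?f u
        = (exp ((u + 1 / 2) *\<^sub>R b + (u + 1 / 2) *\<^sub>R h *\<^sub>R c) - exp ((u + 1 / 2) *\<^sub>R b)) * (h *\<^sub>R c) * exp ((1 / 2 - u) *\<^sub>R b)"
      by (simp add: algebra_simps)
    moreover have "norm (exp ((u + 1 / 2) *\<^sub>R b + (u + 1 / 2) *\<^sub>R h *\<^sub>R c) - exp ((u + 1 / 2) *\<^sub>R b)) \<le> 3 * exp (B + 2) * (h * C)"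
    proof -
      have nc: "norm ((u + 1 / 2) *\<^sub>R h *\<^sub>R c) \<le> 1 * (h * C)"
        unfolding norm_scaleR using u h(1) c by (intro mult_mono) auto
      moreover have "norm ((u + 1 / 2) *\<^sub>R b) \<le> 1 * B"
        unfolding norm_scaleR using u b by (intro mult_mono) auto
      ultimately show ?thesis
        using norm_exp_add_diff_le[of "(u + 1 / 2) *\<^sub>R b" B "(u + 1 / 2) *\<^sub>R h *\<^sub>R c"] h(3)
        by (intro order_trans[OF _ mult_left_mono[OF nc[simplified]]]) auto
    qed
    moreover have "norm (h *\<^sub>R c) \<le> h * C"
      using h(1) c by (simp add: mult_left_mono)
    moreover have "norm (exp ((1 / 2 - u) *\<^sub>R b)) \<le> exp B"
      using norm_exp_scaleR_le[OF u(2) b] by simp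
    ultimately have "norm (?g u - h *\<^sub>R ?f u) \<le> (3 * exp (B + 2) * (h * C)) * (h * C) * exp B"
      using h(1) C by (simp only:) (rule order_trans[OF norm_mult3_le], intro mult_mono, auto)
    then show "norm (?g u - h *\<^sub>R ?f u) \<le> 3 * exp (B + 2) * C * C * exp B * h\<^sup>2"
      by (simp add: power2_eq_square mult_ac)
  qed
  then have 1: "norm (exp (b + h *\<^sub>R c) - E - h *\<^sub>R (x * E + E * x)) \<le> 3 * exp (B + 2) * C * C * exp B * h\<^sup>2"
    by simp
  define r where "r = exp (h *\<^sub>R x) - 1 - h *\<^sub>R x"
  have hx: "norm (h *\<^sub>R x) \<le> X"
    using mult_mono[OF h(2) x] h(1) by simp
  have hx2: "(norm (h *\<^sub>R x))\<^sup>2 \<le> X\<^sup>2 * h\<^sup>2"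
    using mult_right_mono[OF power_mono[OF x norm_ge_zero, of 2], of "h\<^sup>2"]
    by (simp add: power_mult_distrib mult.commute)
  have r: "norm r \<le> 2 * exp (X + 1) * (X\<^sup>2 * h\<^sup>2)"
    unfolding r_def using norm_exp_remainder_le[OF hx] by (rule order_trans) (intro mult_left_mono hx2, simp)
  have g: "norm (exp (h *\<^sub>R x)) \<le> exp X"
    using norm_exp[of "h *\<^sub>R x"] hx by (meson exp_le_cancel_iff order_trans)
  have g1: "norm (1 + h *\<^sub>R x) \<le> exp X"
  proof -
    have "norm (1 + h *\<^sub>R x) \<le> 1 + norm (h *\<^sub>R x)"
      using norm_triangle_ineq[of 1 "h *\<^sub>R x"] by simp
    with hx exp_ge_add_one_self[of X] show ?thesis by linarith
  qed
  \<comment> \<open>The exact curve is compared with the same first order expression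
    \<open>E + h (x E + E x)\<close>; what is left is quadratic in \<open>h x\<close> or contains
    the remainder \<open>r\<close>.\<close>
  have "exp (h *\<^sub>R x) * E * exp (h *\<^sub>R x) - E - h *\<^sub>R (x * E + E * x)
      = (h *\<^sub>R x) * E * (h *\<^sub>R x) + r * E * exp (h *\<^sub>R x) + (1 + h *\<^sub>R x) * E * r"
    unfolding r_def by (simp add: algebra_simps)
  moreover have "norm ((h *\<^sub>R x) * E * (h *\<^sub>R x)) \<le> X\<^sup>2 * exp B * h\<^sup>2"
  proof -
    have "norm ((h *\<^sub>R x) * E * (h *\<^sub>R x)) \<le> norm (h *\<^sub>R x) * norm E * norm (h *\<^sub>R x)" by (rule norm_mult3_le)
    also have "\<dots> = (norm (h *\<^sub>R x))\<^sup>2 * norm E" by (simp add: power2_eq_square)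
    also have "\<dots> \<le> (X\<^sup>2 * h\<^sup>2) * exp B" using hx2 nE by (intro mult_mono) auto
    finally show ?thesis by (simp add: mult_ac)
  qed
  moreover have "norm (r * E * exp (h *\<^sub>R x)) \<le> 2 * exp (X + 1) * (X\<^sup>2 * h\<^sup>2) * exp B * exp X"
    using r nE g by (intro order_trans[OF norm_mult3_le] mult_mono) auto
  moreover have "norm ((1 + h *\<^sub>R x) * E * r) \<le> exp X * exp B * (2 * exp (X + 1) * (X\<^sup>2 * h\<^sup>2))"
    using r nE g1 by (intro order_trans[OF norm_mult3_le] mult_mono) auto
  ultimately have 2: "norm (exp (h *\<^sub>R x) * E * exp (h *\<^sub>R x) - E - h *\<^sub>R (x * E + E * x))
      \<le> X\<^sup>2 * exp B * h\<^sup>2 + 2 * exp (X + 1) * (X\<^sup>2 * h\<^sup>2) * exp B * exp X + exp X * exp B * (2 * exp (X + 1) * (X\<^sup>2 * h\<^sup>2))"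
    by (simp only:) (intro norm_triangle_mono)
  have eq: "exp (b + h *\<^sub>R c) - exp (h *\<^sub>R x) * E * exp (h *\<^sub>R x)
      = (exp (b + h *\<^sub>R c) - E - h *\<^sub>R (x * E + E * x)) - (exp (h *\<^sub>R x) * E * exp (h *\<^sub>R x) - E - h *\<^sub>R (x * E + E * x))"
    by simp
  have "norm (exp (b + h *\<^sub>R c) - exp (h *\<^sub>R x) * E * exp (h *\<^sub>R x))
      \<le> 3 * exp (B + 2) * C * C * exp B * h\<^sup>2 + (X\<^sup>2 * exp B * h\<^sup>2 + 2 * exp (X + 1) * (X\<^sup>2 * h\<^sup>2) * exp B * exp X
        + exp X * exp B * (2 * exp (X + 1) * (X\<^sup>2 * h\<^sup>2)))"
    unfolding eq by (rule order_trans[OF norm_triangle_ineq4 add_mono[OF 1 2]])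
  also have "\<dots> = (3 * exp (B + 2) * C * C * exp B + X\<^sup>2 * exp B + 4 * (exp (X + 1) * X\<^sup>2 * exp B * exp X)) * h\<^sup>2"
    by (simp add: algebra_simps)
  finally show ?thesis by (simp add: E_def)
qed

section \<open>Conjugation invariance of the exponential of a Lie triple system\<close>

text \<open>Extends the inner product of \<open>hsr\<close> to all of \<open>hsa\<close>, because
  conjugates \<open>p * x * q\<close> of selfadjoint elements need not be selfadjoint.\<close>

definition hsa_form :: "'a::separable_hilbert_space hsa \<Rightarrow> 'a hsa \<Rightarrow> real"
  where "hsa_form x y = 4 * hs_form (hsa_hs x) (hsa_hs y) + hsa_scalar x * hsa_scalar y"

lemma bounded_linear_hsa_form: "bounded_linear (\<lambda>x. hsa_form x y)"
proof (rule bounded_linear_intro[where K="4 * norm y"])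
  fix x z :: "'a hsa" and r :: real
  show "hsa_form (x + z) y = hsa_form x y + hsa_form z y"
    by (simp add: hsa_form_def hsa_vector_simps hs_form_add hilbert_schmidt_hsa algebra_simps)
  show "hsa_form (r *\<^sub>R x) y = r *\<^sub>R hsa_form x y"
    by (simp add: hsa_form_def hsa_vector_simps hs_form_scaleR algebra_simps)
  let ?h = "hs_norm (hsa_hs x)" and ?k = "hs_norm (hsa_hs y)"
  have "norm (hsa_form x y) \<le> 4 * \<bar>hs_form (hsa_hs x) (hsa_hs y)\<bar> + \<bar>hsa_scalar x * hsa_scalar y\<bar>"
    unfolding hsa_form_def real_norm_def by (rule order_trans[OF abs_triangle_ineq]) simp
  also have "\<dots> \<le> 4 * (?h * ?k) + 4 * (\<bar>hsa_scalar x\<bar> * \<bar>hsa_scalar y\<bar>)"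
    using abs_hs_form_le[OF hilbert_schmidt_hsa hilbert_schmidt_hsa, of x y]
      mult_nonneg_nonneg[OF abs_ge_zero abs_ge_zero, of "hsa_scalar x" "hsa_scalar y"]
    unfolding abs_mult by linarith
  also have "\<dots> \<le> 4 * (norm x * norm y)"
    using hs_norm_nonneg[of "hsa_hs x"] hs_norm_nonneg[of "hsa_hs y"]
    by (simp add: norm_hsa_def algebra_simps)
  finally show "norm (hsa_form x y) \<le> norm x * (4 * norm y)" by simp
qed

lemma hsa_conj:
  assumes "p * q = 1"
  shows "hsa_scalar (p * x * q) = hsa_scalar x" "hsa_hs (p * x * q) = hsa_cop p * hsa_hs x * hsa_cop q"
proof -
  have "hsa_scalar (p * q) = 1" by (simp add: assms hsa_algebra_simps)
  then show s: "hsa_scalar (p * x * q) = hsa_scalar x" by (simp add: hsa_algebra_simps)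
  have "hsa_cop (p * x * q) = hsa_cop p * (hsa_hs x + of_real (hsa_scalar x)) * hsa_cop q"
    by (simp add: hsa_cop_simps hsa_cop_def[of x])
  also have "\<dots> = hsa_cop p * hsa_hs x * hsa_cop q + hsa_scalar x *\<^sub>R hsa_cop (p * q)"
    by (simp add: hsa_cop_simps of_real_def algebra_simps)
  finally have "hsa_hs (p * x * q) + of_real (hsa_scalar x)
      = hsa_cop p * hsa_hs x * hsa_cop q + hsa_scalar x *\<^sub>R 1"
    unfolding hsa_cop_def[of "p * x * q"] s assms hsa_cop_simps(1) .
  then show "hsa_hs (p * x * q) = hsa_cop p * hsa_hs x * hsa_cop q"
    by (simp add: of_real_def)
qed

text \<open>Left and right multiplication by selfadjoint elements are symmetric for the
  Hilbert-Schmidt form, and conjugation fixes the scalar part. This is where selfadjointness of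
  \<open>b\<close> enters the coercivity of \<open>conj_int b\<close>.\<close>

lemma hsa_form_conj:
  assumes p: "hsa_star p = p" and q: "hsa_star q = q" and pq: "p * q = 1"
  shows "hsa_form (p * x * q) y = hsa_form x (p * y * q)"
proof -
  have P: "adjoint_pair (hsa_cop p) (hsa_cop p)" and Q: "adjoint_pair (hsa_cop q) (hsa_cop q)"
    using adjoint_pair_star[of p] adjoint_pair_star[of q] by (simp_all add: p q)
  have "hs_form (hsa_cop p * hsa_hs x * hsa_cop q) (hsa_hs y)
      = hs_form (hsa_hs x * hsa_cop q) (hsa_cop p * hsa_hs y)"
    unfolding mult.assoc by (rule hs_form_left[OF P])
  also have "\<dots> = hs_form (hsa_hs x) (hsa_cop p * hsa_hs y * hsa_cop q)"
    by (rule hs_form_right[OF hilbert_schmidt_hsa adjoint_pair_hsa _ _ Q])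
      (rule hilbert_schmidt_left[OF hilbert_schmidt_hsa], rule adjoint_pair_simps(6)[OF P adjoint_pair_hsa])
  finally show ?thesis by (simp add: hsa_form_def hsa_conj[OF pq])
qed

lemma norm_hsa_le_form: "(norm x)\<^sup>2 \<le> 2 * hsa_form x x"
proof -
  let ?h = "hs_norm (hsa_hs x)" and ?r = "\<bar>hsa_scalar x\<bar>"
  have "0 \<le> (?r - ?h)\<^sup>2" by simp
  then have "(?r + ?h)\<^sup>2 \<le> 2 * ?r\<^sup>2 + 2 * ?h\<^sup>2" by (simp add: power2_sum power2_diff)
  also have "\<dots> \<le> 2 * (4 * ?h\<^sup>2 + ?r\<^sup>2)" by simp
  finally show ?thesis
    by (simp add: norm_hsa_def hsa_form_def hs_form_self power2_eq_square)
qed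

lemma inner_hsr_form: "inner x y = hsa_form (hsr_embed x) (hsr_embed y)"
  by (simp add: inner_hsr_eq hsa_form_def)

lemma norm_hsr_le: "norm x \<le> 2 * norm (hsr_embed x)"
proof (rule power2_le_imp_le)
  show "(norm x)\<^sup>2 \<le> (2 * norm (hsr_embed x))\<^sup>2"
    using hs_norm_nonneg[of "hsa_hs (hsr_embed x)"]
    unfolding norm_hsr_eq norm_hsa_def by (simp add: power2_sum power_mult_distrib)
qed simp

text \<open>Conjugation by \<open>exp (u b)\<close> is the square of conjugation by
  \<open>p = exp (u b / 2)\<close>, which is symmetric, so the form equals that of
  \<open>d = p * x * q\<close> with itself. Undoing the conjugation gives
  \<open>norm x \<le> exp (B / 2) * norm d\<close>.\<close>

lemma hsa_form_exp_conj_ge: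
  assumes b: "hsa_star b = b" "norm b \<le> B" and u: "\<bar>u\<bar> \<le> 1 / 2"
  shows "exp (- B) / 2 * (norm x)\<^sup>2 \<le> hsa_form (exp (u *\<^sub>R b) * x * exp (- (u *\<^sub>R b))) x"
proof -
  define p where "p = exp ((u / 2) *\<^sub>R b)"
  define q where "q = exp ((- u / 2) *\<^sub>R b)"
  have pq: "p * q = 1" "q * p = 1"
    unfolding p_def q_def using exp_minus_inverse[of "(u / 2) *\<^sub>R b"] exp_minus_left[of "(u / 2) *\<^sub>R b"] by simp_all
  have sp: "hsa_star p = p" "hsa_star q = q"
    unfolding p_def q_def hsa_star_exp hsa_star_algebra b by (rule refl)+
  have pp: "exp (u *\<^sub>R b) = p * p" "exp (- (u *\<^sub>R b)) = q * q"
    using exp_half_square[of "u *\<^sub>R b"] exp_half_square[of "- (u *\<^sub>R b)"]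
    by (simp_all add: p_def q_def)
  have n: "norm p \<le> exp (1 / 4 * B)" "norm q \<le> exp (1 / 4 * B)"
    unfolding p_def q_def by (rule norm_exp_scaleR_le[OF _ b(2)]; use u in simp)+
  have e: "exp (1 / 4 * B) * exp (1 / 4 * B) = exp (B / 2)" "exp (B / 2) * exp (B / 2) = exp B"
    by (simp_all flip: exp_add)
  let ?d = "p * x * q"
  have "x = q * ?d * p" by (simp add: pq mult.assoc) (simp add: pq flip: mult.assoc)
  then have "norm x \<le> norm q * norm ?d * norm p" using norm_mult3_le by metis
  also have "\<dots> \<le> exp (1 / 4 * B) * norm ?d * exp (1 / 4 * B)" using n by (intro mult_mono) auto
  also have "\<dots> = exp (B / 2) * norm ?d" using e(1) by (simp add: mult_ac)
  finally have "(norm x)\<^sup>2 \<le> (exp (B / 2) * norm ?d)\<^sup>2" by (intro power_mono) auto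
  also have "\<dots> = exp B * (norm ?d)\<^sup>2" using e(2) by (simp add: power2_eq_square mult_ac)
  also have "\<dots> \<le> exp B * (2 * hsa_form ?d ?d)" by (intro mult_left_mono norm_hsa_le_form) auto
  also have "hsa_form ?d ?d = hsa_form (exp (u *\<^sub>R b) * x * exp (- (u *\<^sub>R b))) x"
    unfolding pp using hsa_form_conj[OF sp pq(1), of ?d x] by (simp add: mult.assoc)
  finally show ?thesis by (simp add: exp_minus field_simps)
qed

lemma hsa_form_conj_int_ge:
  assumes b: "hsa_star b = b" "norm b \<le> B"
  shows "exp (- B) / 2 * (norm x)\<^sup>2 \<le> hsa_form (conj_int b x) x"
proof -
  let ?S = "{- 1 / 2..1 / 2} :: real set"
  let ?f = "\<lambda>u. exp (u *\<^sub>R b) * x * exp (- (u *\<^sub>R b))"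
  have eq: "hsa_form (conj_int b x) x = integral ?S (\<lambda>u. hsa_form (?f u) x)"
    unfolding conj_int_def
    by (rule integral_linear[OF integrable_conj bounded_linear_hsa_form, unfolded o_def, symmetric])
  have "integral ?S (\<lambda>u. exp (- B) / 2 * (norm x)\<^sup>2) \<le> integral ?S (\<lambda>u. hsa_form (?f u) x)"
  proof (rule integral_le)
    show "(\<lambda>u. hsa_form (?f u) x) integrable_on ?S"
      using integrable_linear[OF integrable_conj bounded_linear_hsa_form] by (simp add: o_def)
    fix u :: real assume "u \<in> ?S"
    then have "\<bar>u\<bar> \<le> 1 / 2" by auto
    then show "exp (- B) / 2 * (norm x)\<^sup>2 \<le> hsa_form (?f u) x"
      by (rule hsa_form_exp_conj_ge[OF b])
  qed (rule integrable_const_ivl)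
  then show ?thesis unfolding eq by simp
qed

text \<open>The derivative of \<open>exp\<close> at \<open>b\<close> is \<open>c \<mapsto> exp (b/2) * conj_int b c * exp (b/2)\<close>, so \<open>c\<close> has to be
  found with \<open>conj_int b c\<close> equal to the element \<open>V\<close> of the Lie triple system; this is possible
  inside the system because \<open>conj_int b\<close> is coercive.\<close>

lemma exp_velocity_in_lie_triple:
  fixes m :: "'a::separable_hilbert_space hsr set"
  defines "K \<equiv> hsr_embed ` m"
  assumes m: "subspace m" "complete m" and K: "subspace K" "closed K" "lie_triple K" and x: "x \<in> K"
  shows "\<exists>C\<ge>0. \<forall>b\<in>K. norm b \<le> B \<longrightarrow> (\<exists>c\<in>K. norm c \<le> C \<and>
    exp ((1 / 2) *\<^sub>R b) * conj_int b c * exp ((1 / 2) *\<^sub>R b) = x * exp b + exp b * x)"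
proof -
  interpret E: bounded_linear hsr_embed by (rule bounded_linear_hsr_embed)
  obtain N where N: "0 < N" "\<And>x. norm (hsr_embed x :: 'a hsa) \<le> norm x * N" using E.pos_bounded by blast
  define d where "d = exp (- B) / 2"
  define d' where "d' = d / 4"
  have d: "0 < d" "0 < d'" by (simp_all add: d_def d'_def)
  \<comment> \<open>One 2 counts the summands of \<open>V\<close>, the other is the norm comparison
    in \<open>norm_hsr_le\<close>; \<open>d'\<close> is the coercivity constant in
    \<open>hsr\<close> and \<open>N\<close> the bound of the embedding.\<close>
  define C where "C = (2 * (2 * (exp B * norm x))) / d' * N"
  show ?thesis
  proof (intro exI[of _ C] conjI ballI impI)
    show "0 \<le> C" using d N(1) by (simp add: C_def)
    fix b assume b: "b \<in> K" "norm b \<le> B"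
    have sb: "hsa_star b = b" using b(1) by (auto simp: K_def hsa_star_embed)
    define p where "p = exp ((1 / 2) *\<^sub>R b)"
    define q where "q = exp (- ((1 / 2) *\<^sub>R b))"
    have pq: "p * q = 1" "q * p = 1" by (simp_all add: p_def q_def exp_minus_inverse exp_minus_left)
    have pp: "exp b = p * p" unfolding p_def by (rule exp_half_square)
    \<comment> \<open>The wanted velocity \<open>x * exp b + exp b * x\<close> with a factor
      \<open>p = exp (b / 2)\<close> stripped from either side; the result is even in
      \<open>b\<close>, hence in \<open>K\<close>.\<close>
    define V where "V = p * x * q + q * x * p"
    have VK: "V \<in> K"
      unfolding V_def p_def q_def
      by (rule exp_conj_in_lie_triple[OF K subspace_scale[OF K(1) b(1)] x])
    then obtain v where v: "v \<in> m" "V = hsr_embed v" by (auto simp: K_def)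
    have n: "norm p \<le> exp (1 / 2 * B)" "norm q \<le> exp (1 / 2 * B)"
      using norm_exp_scaleR_le[of "1 / 2" "1 / 2" b B] norm_exp_scaleR_le[of "- (1 / 2)" "1 / 2" b B] b(2)
      by (simp_all add: p_def q_def)
    have e: "exp (1 / 2 * B) * exp (1 / 2 * B) = exp B" by (simp flip: exp_add)
    have "norm (p * x * q) \<le> exp (1 / 2 * B) * norm x * exp (1 / 2 * B)"
      "norm (q * x * p) \<le> exp (1 / 2 * B) * norm x * exp (1 / 2 * B)"
      using n by (auto intro!: order_trans[OF norm_mult3_le] mult_mono)
    then have "norm V \<le> 2 * (exp (1 / 2 * B) * norm x * exp (1 / 2 * B))"
      unfolding V_def using norm_triangle_ineq[of "p * x * q" "q * x * p"] by linarith
    also have "\<dots> = 2 * (exp B * norm x)" using e by (simp add: mult_ac)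
    finally have nv: "norm v \<le> 2 * (2 * (exp B * norm x))" using norm_hsr_le[of v] v(2) by simp
    \<comment> \<open>\<open>conj_int b\<close> is read on \<open>hsr\<close>, where the inner
      product lives. On \<open>m\<close> the projection loses nothing, since
      \<open>conj_int b\<close> preserves \<open>K\<close>.\<close>
    define S where "S c = hsr_proj (conj_int b (hsr_embed c))" for c
    have SK: "conj_int b (hsr_embed c) \<in> K" if "c \<in> m" for c
      by (rule conj_int_in_lie_triple[OF K b(1)]) (use that in \<open>auto simp: K_def\<close>)
    have ES: "hsr_embed (S c) = conj_int b (hsr_embed c)" and Sm: "S c \<in> m" if "c \<in> m" for c
      using SK[OF that] by (auto simp: S_def K_def hsr_proj_embed)
    have coer: "d' * (norm c)\<^sup>2 \<le> inner (S c) c" if c: "c \<in> m" for c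
    proof -
      have "(norm c)\<^sup>2 \<le> (2 * norm (hsr_embed c))\<^sup>2" by (intro power_mono norm_hsr_le) simp
      then have "d' * (norm c)\<^sup>2 \<le> d * (norm (hsr_embed c))\<^sup>2" using d by (simp add: d'_def power_mult_distrib)
      also have "\<dots> \<le> inner (S c) c"
        unfolding inner_hsr_form ES[OF c] d_def by (rule hsa_form_conj_int_ge[OF sb b(2)])
      finally show ?thesis .
    qed
    have "\<exists>c\<in>m. S c = v"
    proof (rule coercive_surjective[OF m(2,1) Sm _ _ d(2) coer v(1)])
      show "S (c - c') = S c - S c'" for c c'
        by (simp add: S_def E.diff conj_int_diff linear_diff[OF bounded_linear.linear[OF bounded_linear_hsr_proj]])
      show "norm (S c) \<le> (2 * exp (norm b) * N) * norm c" if "c \<in> m" for c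
      proof -
        have "norm (S c) \<le> 2 * norm (conj_int b (hsr_embed c))"
          using norm_hsr_le[of "S c"] by (simp add: ES that)
        also have "\<dots> \<le> 2 * (exp (norm b) * norm (hsr_embed c))"
          by (intro mult_left_mono norm_conj_int_le) simp
        also have "\<dots> \<le> 2 * (exp (norm b) * (norm c * N))"
          by (intro mult_left_mono N(2)) auto
        finally show ?thesis by (simp add: mult_ac)
      qed
    qed
    then obtain c where c: "c \<in> m" "S c = v" by blast
    have "d' * (norm c)\<^sup>2 \<le> norm v * norm c"
      using coer[OF c(1)] norm_cauchy_schwarz[of v c] c(2) by simp
    then have "norm c * (d' * norm c) \<le> norm c * norm v" by (simp add: power2_eq_square mult_ac)
    then have "d' * norm c \<le> norm v"
      by (cases "norm c = 0") (auto simp: mult_le_cancel_left)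
    then have "norm c \<le> norm v / d'" using d by (simp add: field_simps)
    also have "\<dots> \<le> (2 * (2 * (exp B * norm x))) / d'" using nv d by (intro divide_right_mono) auto
    finally have nc: "norm (hsr_embed c) \<le> C"
      unfolding C_def by (rule order_trans[OF N(2) mult_right_mono]) (use N(1) in simp)
    have "p * conj_int b (hsr_embed c) * p = p * V * p"
      using ES[OF c(1)] c(2) v(2) by simp
    also have "\<dots> = x * exp b + exp b * x"
    proof -
      have "p * V * p = p * p * x * (q * p) + (p * q) * x * p * p"
        unfolding V_def by (simp only: distrib_left distrib_right mult.assoc)
      then show ?thesis by (simp add: pq pp mult.assoc add.commute)
    qed
    finally show "\<exists>c\<in>K. norm c \<le> C \<and>
        exp ((1 / 2) *\<^sub>R b) * conj_int b c * exp ((1 / 2) *\<^sub>R b) = x * exp b + exp b * x"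
      using c(1) nc by (intro bexI[of _ "hsr_embed c"]) (auto simp: p_def K_def)
  qed
qed

section \<open>Euler's method and its continuation\<close>

definition exp_conj :: "'a::{real_normed_algebra_1,banach} \<Rightarrow> 'a \<Rightarrow> real \<Rightarrow> 'a"
  where "exp_conj x y t = exp (t *\<^sub>R x) * exp y * exp (t *\<^sub>R x)"

lemma exp_conj_add:
  "exp (s *\<^sub>R x) * exp_conj x y t * exp (s *\<^sub>R x) = exp_conj x y (s + t)"
proof -
  have "exp ((s + t) *\<^sub>R x) = exp (s *\<^sub>R x) * exp (t *\<^sub>R x)" "exp ((s + t) *\<^sub>R x) = exp (t *\<^sub>R x) * exp (s *\<^sub>R x)"
    using exp_add_commuting[of "s *\<^sub>R x" "t *\<^sub>R x"] exp_add_commuting[of "t *\<^sub>R x" "s *\<^sub>R x"]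
    by (simp_all add: scaleR_add_left mult.commute add.commute)
  then show ?thesis unfolding exp_conj_def by (metis mult.assoc)
qed

text \<open>The curve is \<open>g\<^sup>* g\<close> for the invertible
  \<open>g = exp (y / 2) * exp (t x)\<close>, hence selfadjoint and coercive.\<close>

lemma exp_conj_hsa:
  assumes x: "hsa_star x = x" and y: "hsa_star y = y"
  shows "hsa_star (exp_conj x y t) = exp_conj x y t" "exp_conj x y t \<in> log_dom"
proof -
  show s: "hsa_star (exp_conj x y t) = exp_conj x y t"
    by (simp add: exp_conj_def hsa_star_algebra hsa_star_exp x y mult.assoc)
  let ?g = "exp ((1 / 2) *\<^sub>R y) * exp (t *\<^sub>R x)"
  have g: "hsa_star ?g * ?g = exp_conj x y t"
    unfolding exp_conj_def exp_half_square[of y] by (simp add: hsa_star_algebra hsa_star_exp x y mult.assoc)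
  have "exp (- (t *\<^sub>R x)) * exp (- ((1 / 2) *\<^sub>R y)) * ?g
      = exp (- (t *\<^sub>R x)) * (exp (- ((1 / 2) *\<^sub>R y)) * exp ((1 / 2) *\<^sub>R y)) * exp (t *\<^sub>R x)"
    by (simp only: mult.assoc)
  then have h: "exp (- (t *\<^sub>R x)) * exp (- ((1 / 2) *\<^sub>R y)) * ?g = 1"
    by (simp add: exp_minus_left)
  have "coercive (hsa_cop (hsa_star ?g) * hsa_cop ?g)"
    by (rule coercive_square[OF adjoint_pair_star, of "hsa_cop (exp (- (t *\<^sub>R x)) * exp (- ((1 / 2) *\<^sub>R y)))"])
      (simp only: hsa_cop_simps(5)[symmetric] h hsa_cop_simps(1))
  then have "coercive (hsa_cop (exp_conj x y t))" by (simp only: hsa_cop_simps(5)[symmetric] g)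
  then show "exp_conj x y t \<in> log_dom" by (rule log_dom_hsa[OF s])
qed

text \<open>Euler's method with \<open>n\<close> steps, staying inside \<open>K\<close>; the total error is of order \<open>1 / n\<close>.\<close>

lemma exp_conj_euler:
  fixes m :: "'a::separable_hilbert_space hsr set"
  defines "K \<equiv> hsr_embed ` m"
  assumes m: "subspace m" "complete m" and K: "subspace K" "closed K" "lie_triple K" and x: "x \<in> K"
  shows "\<exists>\<tau>>0. \<forall>y\<in>K. \<forall>t\<in>{0..\<tau>}. norm y \<le> Y \<longrightarrow> (\<exists>z\<in>K. exp z = exp_conj x y t)"
proof -
  obtain C where C: "C \<ge> 0" "\<And>b. b \<in> K \<Longrightarrow> norm b \<le> Y + 1 \<Longrightarrow> \<exists>c\<in>K. norm c \<le> C \<and>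
      exp ((1 / 2) *\<^sub>R b) * conj_int b c * exp ((1 / 2) *\<^sub>R b) = x * exp b + exp b * x"
    using exp_velocity_in_lie_triple[OF m, of x "Y + 1"] K x unfolding K_def by blast
  define X where "X = norm x"
  define D where "D = 3 * exp (Y + 1 + 2) * C * C * exp (Y + 1) + X\<^sup>2 * exp (Y + 1)
    + 4 * (exp (X + 1) * X\<^sup>2 * exp (Y + 1) * exp X)"
  have D0: "0 \<le> D" using C(1) by (simp add: D_def X_def)
  \<comment> \<open>Up to time \<open>\<tau>\<close> the polygon moves by at most
    \<open>\<tau> * C \<le> 1\<close>, so it stays in the ball of radius \<open>Y + 1\<close> on
    which the velocity bound \<open>C\<close> was obtained.\<close>
  define \<tau> where "\<tau> = 1 / (C + 1)"
  have \<tau>: "0 < \<tau>" "\<tau> \<le> 1" "\<tau> * C \<le> 1" using C(1) by (simp_all add: \<tau>_def field_simps)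
  have "\<exists>z\<in>K. exp z = exp_conj x y t" if y: "y \<in> K" "norm y \<le> Y" and t: "t \<in> {0..\<tau>}" for y t
  proof -
    have star: "hsa_star z = z" if "z \<in> K" for z using that by (auto simp: K_def hsa_star_embed)
    note q = exp_conj_hsa[OF star[OF x] star[OF y(1)]]
    \<comment> \<open>Each step multiplies the old error by at most \<open>exp (2 X h)\<close> and
      adds a local error \<open>D h^2\<close>; the factor \<open>exp (2 X k h)\<close> accounts for
      the accumulated growth.\<close>
    have step: "\<exists>b\<in>K. norm (b - y) \<le> real k * h * C \<and>
        norm (exp b - exp_conj x y (real k * h)) \<le> real k * (D * h\<^sup>2) * exp (2 * X * (real k * h))"
      if h: "0 \<le> h" and kN: "real k * h \<le> \<tau>" for k h
      using kN
    proof (induction k)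
      case 0
      show ?case by (rule bexI[OF _ y(1)]) (simp add: exp_conj_def)
    next
      case (Suc k)
      have le: "real k * h + h \<le> \<tau>" using Suc.prems by (simp add: algebra_simps)
      then obtain b where b: "b \<in> K" "norm (b - y) \<le> real k * h * C"
        "norm (exp b - exp_conj x y (real k * h)) \<le> real k * (D * h\<^sup>2) * exp (2 * X * (real k * h))"
        using Suc.IH h by auto
      have kh: "0 \<le> real k * h" using h by simp
      have "real k * h * C \<le> \<tau> * C" using le h C(1) by (intro mult_right_mono) auto
      then have nb: "norm b \<le> Y + 1"
        using b(2) \<tau>(3) y(2) norm_triangle_ineq[of "b - y" y] by simp
      obtain c where c: "c \<in> K" "norm c \<le> C"
        "exp ((1 / 2) *\<^sub>R b) * conj_int b c * exp ((1 / 2) *\<^sub>R b) = x * exp b + exp b * x"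
        using C(2)[OF b(1) nb] by blast
      have h1: "h \<le> 1" "h * C \<le> 1"
        using le kh \<tau> mult_right_mono[of h \<tau> C] C(1) by auto
      have 1: "norm (exp (b + h *\<^sub>R c) - exp (h *\<^sub>R x) * exp b * exp (h *\<^sub>R x)) \<le> D * h\<^sup>2"
        unfolding D_def by (rule exp_euler_step[OF nb c(2) _ h h1 c(3)]) (simp add: X_def)
      let ?g = "exp (h *\<^sub>R x)" and ?q = "exp_conj x y (real k * h)"
      have ng: "norm ?g \<le> exp (h * X)"
        using norm_exp[of "h *\<^sub>R x"] h by (simp add: X_def)
      have "norm (?g * (exp b - ?q) * ?g)
          \<le> exp (h * X) * (real k * (D * h\<^sup>2) * exp (2 * X * (real k * h))) * exp (h * X)"
        using ng b(3) D0 by (intro order_trans[OF norm_mult3_le] mult_mono) auto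
      also have "\<dots> = real k * (D * h\<^sup>2) * exp (2 * X * (real (Suc k) * h))"
        by (simp add: algebra_simps flip: exp_add)
      finally have 2: "norm (?g * exp b * ?g - ?g * ?q * ?g) \<le> real k * (D * h\<^sup>2) * exp (2 * X * (real (Suc k) * h))"
        by (simp add: algebra_simps)
      have 3: "D * h\<^sup>2 \<le> D * h\<^sup>2 * exp (2 * X * (real (Suc k) * h))"
        using mult_left_mono[of 1 "exp (2 * X * (real (Suc k) * h))" "D * h\<^sup>2"] D0 h
        by (simp add: X_def)
      have "exp (b + h *\<^sub>R c) - exp_conj x y (real (Suc k) * h)
          = (exp (b + h *\<^sub>R c) - ?g * exp b * ?g) + (?g * exp b * ?g - ?g * ?q * ?g)"
        using exp_conj_add[of h x y "real k * h"] by (simp add: algebra_simps)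
      then have "norm (exp (b + h *\<^sub>R c) - exp_conj x y (real (Suc k) * h))
          \<le> D * h\<^sup>2 + real k * (D * h\<^sup>2) * exp (2 * X * (real (Suc k) * h))"
        using 1 2 norm_triangle_mono by metis
      also have "\<dots> \<le> real (Suc k) * (D * h\<^sup>2) * exp (2 * X * (real (Suc k) * h))"
        using 3 by (simp add: algebra_simps)
      finally have e: "norm (exp (b + h *\<^sub>R c) - exp_conj x y (real (Suc k) * h))
          \<le> real (Suc k) * (D * h\<^sup>2) * exp (2 * X * (real (Suc k) * h))" .
      have "norm (b + h *\<^sub>R c - y) \<le> norm (b - y) + norm (h *\<^sub>R c)"
        using norm_triangle_ineq[of "b - y" "h *\<^sub>R c"] by (simp add: algebra_simps)
      also have "\<dots> \<le> real k * h * C + h * C"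
        using b(2) c(2) h by (intro add_mono) (simp_all add: mult_left_mono)
      finally have "norm (b + h *\<^sub>R c - y) \<le> real (Suc k) * h * C" by (simp add: algebra_simps)
      with e show ?case
        using subspace_add[OF K(1) b(1) subspace_scale[OF K(1) c(1)]] by blast
    qed
    have "\<exists>b\<in>K. norm (exp b - exp_conj x y t) \<le> D * t\<^sup>2 * exp (2 * X * t) * (1 / real (Suc n))" for n
    proof -
      define N where "N = real (Suc n)"
      have N: "0 < N" by (simp add: N_def)
      have eq: "N * (t / N) = t" "N * (D * (t / N)\<^sup>2) = D * t\<^sup>2 * (1 / N)"
        using N by (simp_all add: power2_eq_square)
      have "\<exists>b\<in>K. norm (b - y) \<le> N * (t / N) * C \<and>
          norm (exp b - exp_conj x y (N * (t / N))) \<le> N * (D * (t / N)\<^sup>2) * exp (2 * X * (N * (t / N)))"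
        unfolding N_def by (rule step) (use t in \<open>auto simp del: of_nat_Suc\<close>)
      then obtain b where "b \<in> K" "norm (exp b - exp_conj x y t) \<le> D * t\<^sup>2 * (1 / N) * exp (2 * X * t)"
        unfolding eq by blast
      moreover have "D * t\<^sup>2 * (1 / N) * exp (2 * X * t) = D * t\<^sup>2 * exp (2 * X * t) * (1 / N)"
        by (simp only: mult_ac)
      ultimately show ?thesis unfolding N_def by auto
    qed
    then obtain f where f: "\<And>n. f n \<in> K"
      "\<And>n. norm (exp (f n) - exp_conj x y t) \<le> D * t\<^sup>2 * exp (2 * X * t) * (1 / real (Suc n))"
      by metis
    define A where "A = D * t\<^sup>2 * exp (2 * X * t)"
    have "(\<lambda>n. A * (1 / real (Suc n))) \<longlonglongrightarrow> A * 0"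
      by (rule tendsto_mult[OF tendsto_const LIMSEQ_Suc[OF lim_1_over_n]])
    then have A: "(\<lambda>n. A * (1 / real (Suc n))) \<longlonglongrightarrow> 0" by (simp only: mult_zero_right)
    have "\<forall>n. norm (exp (f n) - exp_conj x y t) \<le> A * (1 / real (Suc n))"
      unfolding A_def by (intro allI f(2))
    then have "(\<lambda>n. exp (f n) - exp_conj x y t) \<longlonglongrightarrow> 0"
      by (rule Lim_null_comparison[OF always_eventually A])
    then have lim: "(\<lambda>n. exp (f n)) \<longlonglongrightarrow> exp_conj x y t" by (simp add: LIM_zero_iff)
    \<comment> \<open>The logarithm recovers the polygon end points \<open>f n\<close> from their
      exponentials; by its continuity they converge, and the limit lies in the closed
      \<open>K\<close>.\<close>
    have "isCont alg_ln (exp_conj x y t)"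
      using continuous_on_eq_continuous_at[OF open_log_dom, of alg_ln]
        smooth_on_imp_continuous_on[OF smooth_on_alg_ln] q(2) by blast
    from isCont_tendsto_compose[OF this lim]
    have "f \<longlonglongrightarrow> alg_ln (exp_conj x y t)" using f(1) by (simp add: alg_ln_exp_hsa star)
    then have "alg_ln (exp_conj x y t) \<in> K" by (rule closed_sequence_limit[OF K(2) f(1)])
    then show ?thesis using exp_alg_ln[OF q(2)] by blast
  qed
  then show ?thesis using \<tau>(1) by blast
qed

text \<open>Continuation from time 0 to 1: any intermediate point found in \<open>K\<close> is the
  logarithm of the curve there and so has norm at most \<open>Y\<close>, by compactness. One time
  \<open>\<tau>\<close> therefore allows a restart from each of the points
  \<open>k / N\<close>.\<close>

lemma exp_conj_in_lie_triple_exp: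
  fixes m :: "'a::separable_hilbert_space hsr set"
  defines "K \<equiv> hsr_embed ` m"
  assumes m: "subspace m" "complete m" and K: "subspace K" "closed K" "lie_triple K"
    and x: "x \<in> K" and y: "y \<in> K"
  shows "\<exists>z\<in>K. exp z = exp x * exp y * exp x"
proof -
  have star: "hsa_star z = z" if "z \<in> K" for z using that by (auto simp: K_def hsa_star_embed)
  note q = exp_conj_hsa[OF star[OF x] star[OF y]]
  have "continuous_on {0..1} (\<lambda>t. alg_ln (exp_conj x y t))"
    by (rule continuous_on_compose2[OF smooth_on_imp_continuous_on[OF smooth_on_alg_ln]])
      (auto simp: exp_conj_def[abs_def] intro!: continuous_intros q(2)[unfolded exp_conj_def])
  then have "bounded ((\<lambda>t. alg_ln (exp_conj x y t)) ` {0..1})"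
    by (intro compact_imp_bounded compact_continuous_image) auto
  then obtain Y where Y: "\<And>t. t \<in> {0..1} \<Longrightarrow> norm (alg_ln (exp_conj x y t)) \<le> Y"
    unfolding bounded_iff by blast
  obtain \<tau> where \<tau>: "\<tau> > 0"
    "\<And>y t. y \<in> K \<Longrightarrow> t \<in> {0..\<tau>} \<Longrightarrow> norm y \<le> Y \<Longrightarrow> \<exists>z\<in>K. exp z = exp_conj x y t"
    using exp_conj_euler[OF m, of x Y] K x unfolding K_def by blast
  obtain N :: nat where N: "1 / \<tau> < real N" using reals_Archimedean2 by blast
  have N0: "0 < real N" using N \<tau>(1) by (meson less_trans zero_less_divide_1_iff)
  define h where "h = 1 / real N"
  have h: "h \<in> {0..\<tau>}" using N N0 \<tau>(1) by (simp add: h_def field_simps)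
  have "\<exists>z\<in>K. exp z = exp_conj x y (real k * h)" if "k \<le> N" for k
    using that
  proof (induction k)
    case 0
    show ?case by (rule bexI[OF _ y]) (simp add: exp_conj_def)
  next
    case (Suc k)
    then obtain z where z: "z \<in> K" "exp z = exp_conj x y (real k * h)" by auto
    have "real k * h \<in> {0..1}" using Suc.prems N0 by (simp add: h_def)
    from Y[OF this] have "norm z \<le> Y"
      using z alg_ln_exp_hsa[OF star[OF z(1)]] by simp
    from \<tau>(2)[OF z(1) h this] obtain w where w: "w \<in> K" "exp w = exp_conj x z h" by blast
    have "exp_conj x z h = exp (h *\<^sub>R x) * exp_conj x y (real k * h) * exp (h *\<^sub>R x)"
      by (simp add: exp_conj_def[of x z] z(2))
    also have "\<dots> = exp_conj x y (real (Suc k) * h)"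
      unfolding exp_conj_add by (simp add: algebra_simps)
    finally show ?case using w by auto
  qed
  from this[of N] show ?thesis using N0 by (simp add: h_def exp_conj_def)
qed

section \<open>Closedness and geodesic convexity\<close>

lemma closed_hsr_embed_image:
  assumes "closed m"
  shows "closed (hsr_embed ` m)"
proof -
  have "hsr_embed ` m = {x. hsa_star x = x} \<inter> hsr_proj -` m"
  proof
    show "{x. hsa_star x = x} \<inter> hsr_proj -` m \<subseteq> hsr_embed ` m"
    proof
      fix x assume "x \<in> {x. hsa_star x = x} \<inter> hsr_proj -` m"
      then show "x \<in> hsr_embed ` m"
        by (intro image_eqI[of _ _ "hsr_proj x"]) (simp_all add: hsr_embed_proj)
    qed
  qed (auto simp: hsa_star_embed hsr_proj_embed)
  moreover have "closed {x :: 'a hsa. hsa_star x = x}"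
    by (intro closed_Collect_eq bounded_linear.continuous_on[OF bounded_linear_hsa_star] continuous_on_id)
  moreover have "closed (hsr_proj -` m)"
    by (intro closed_vimage assms bounded_linear.continuous_on[OF bounded_linear_hsr_proj] continuous_on_id)
  ultimately show ?thesis by (simp only: closed_Int)
qed

lemma lie_triple_hsr_embed:
  assumes "lie_triple_system m"
  shows "lie_triple (hsr_embed ` m)"
  unfolding lie_triple_def
proof (intro ballI)
  fix x c assume "x \<in> hsr_embed ` m" "c \<in> hsr_embed ` m"
  then obtain a b where a: "a \<in> m" "x = hsr_embed a" and b: "b \<in> m" "c = hsr_embed b" by blast
  \<comment> \<open>The order of the brackets is chosen so that \<open>[[b, a], a]\<close> equals
    \<open>ad a (ad a b)\<close> with both signs cancelling.\<close>
  have "commutator (commutator (cop_of b) (cop_of a)) (cop_of a) \<in> cop_of ` m"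
    using assms a b by (simp add: lie_triple_system_def)
  then obtain d where d: "d \<in> m" "commutator (commutator (cop_of b) (cop_of a)) (cop_of a) = cop_of d"
    by blast
  have "hsa_cop (ad x (ad x c)) = commutator (commutator (cop_of b) (cop_of a)) (cop_of a)"
    unfolding ad_def commutator_def a(2) b(2) hsa_cop_simps hsa_cop_embed by (simp only: algebra_simps)
  then have "hsa_cop (ad x (ad x c)) = hsa_cop (hsr_embed d)" by (simp add: d hsa_cop_embed)
  then show "ad x (ad x c) \<in> hsr_embed ` m" using d(1) by (simp add: hsa_cop_inject)
qed

lemma cop_of_hsr_exp: "cop_of (hsr_exp x) = hsa_cop (exp (hsr_embed x))"
  unfolding hsr_exp_eq[symmetric] hsa_cop_embed ..

lemma cop_powr_hsr_exp: "cop_powr (cop_of (hsr_exp x)) t = hsa_cop (exp (t *\<^sub>R hsr_embed x))"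
  unfolding cop_powr_def hsr_exp.rep_eq cop_ln_exp[OF selfadjoint_cop_of] hsa_cop_exp hsa_cop_simps(3) hsa_cop_embed ..

text \<open>Two conjugations suffice: by \<open>exp (-x / 2)\<close> to write
  \<open>p^(-1/2) q p^(-1/2)\<close> as \<open>exp z\<close> with \<open>z\<close> in the system,
  and by \<open>exp (x / 2)\<close> around \<open>exp (t z)\<close>, the power with exponent
  \<open>t\<close>.\<close>

lemma geodesically_convex_exp:
  fixes m :: "'a::separable_hilbert_space hsr set"
  assumes m: "subspace m" "closed m" "lie_triple_system m"
  shows "geodesically_convex (hsr_exp ` m)"
  unfolding geodesically_convex_def
proof (intro conjI ballI)
  show "hsr_exp ` m \<subseteq> Sigma_set" using hsr_exp_in_Sigma by auto
  let ?K = "hsr_embed ` m"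
  have K: "subspace ?K" "closed ?K" "lie_triple ?K"
    using m linear_subspace_image[OF bounded_linear.linear[OF bounded_linear_hsr_embed]]
    by (auto intro: closed_hsr_embed_image lie_triple_hsr_embed)
  note conj = exp_conj_in_lie_triple_exp[OF m(1) complete_eq_closed[THEN iffD2, OF m(2)] K]
  fix p q assume "p \<in> hsr_exp ` m" "q \<in> hsr_exp ` m"
  then obtain x y where x: "x \<in> m" "p = hsr_exp x" and y: "y \<in> m" "q = hsr_exp y" by blast
  let ?x = "hsr_embed x" and ?y = "hsr_embed y"
  have "(- (1 / 2)) *\<^sub>R ?x \<in> ?K" using x by (intro subspace_scale[OF K(1)]) auto
  from conj[OF this] y(1) obtain z where z: "z \<in> m"
    "exp (hsr_embed z) = exp ((- (1 / 2)) *\<^sub>R ?x) * exp ?y * exp ((- (1 / 2)) *\<^sub>R ?x)" by blast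
  have "geodesic p q t \<in> cop_of ` hsr_exp ` m" for t
  proof -
    have "(1 / 2) *\<^sub>R ?x \<in> ?K" "t *\<^sub>R hsr_embed z \<in> ?K"
      using x z by (auto intro!: subspace_scale[OF K(1)])
    from conj[OF this] obtain w where w: "w \<in> m"
      "exp (hsr_embed w) = exp ((1 / 2) *\<^sub>R ?x) * exp (t *\<^sub>R hsr_embed z) * exp ((1 / 2) *\<^sub>R ?x)" by blast
    have "cop_powr (cop_of p) (- (1 / 2)) * cop_of q * cop_powr (cop_of p) (- (1 / 2)) = cop_of (hsr_exp z)"
      unfolding x(2) y(2) cop_powr_hsr_exp unfolding cop_of_hsr_exp z(2) hsa_cop_simps(5) ..
    then have "geodesic p q t = cop_powr (cop_of p) (1 / 2) * cop_powr (cop_of (hsr_exp z)) t * cop_powr (cop_of p) (1 / 2)"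
      by (simp only: geodesic_def Let_def)
    also have "\<dots> = cop_of (hsr_exp w)"
      unfolding x(2) cop_powr_hsr_exp unfolding cop_of_hsr_exp w(2) hsa_cop_simps(5) ..
    finally have "geodesic p q t = cop_of (hsr_exp w)" .
    then show ?thesis using w(1) by blast
  qed
  then show "geodesic p q ` {0..1} \<subseteq> cop_of ` hsr_exp ` m" by (rule image_subsetI)
qed

text \<open>As a preimage of \<open>m\<close> under the continuous logarithm, the image inherits
  closedness in \<open>Sigma_set\<close>.\<close>

lemma hsr_exp_image_eq: "hsr_exp ` m = Sigma_set \<inter> hsr_ln -` m"
proof
  show "Sigma_set \<inter> hsr_ln -` m \<subseteq> hsr_exp ` m"
  proof
    fix p assume "p \<in> Sigma_set \<inter> hsr_ln -` m"
    then show "p \<in> hsr_exp ` m" by (intro image_eqI[of _ _ "hsr_ln p"]) (simp_all add: hsr_exp_ln)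
  qed
qed (auto simp: hsr_ln_exp hsr_exp_in_Sigma)

lemma diffeomorphism_hsr_ln: "diffeomorphism_on Sigma_set UNIV hsr_ln"
  unfolding diffeomorphism_on_def
proof (intro conjI)
  show bij: "bij_betw hsr_ln Sigma_set UNIV"
    by (rule bij_betw_byWitness[where f'=hsr_exp]) (auto simp: hsr_exp_ln hsr_ln_exp hsr_exp_in_Sigma)
  have eq: "the_inv_into Sigma_set hsr_ln x = hsr_exp x" for x
    using bij by (intro the_inv_into_f_eq) (auto simp: bij_betw_def hsr_ln_exp hsr_exp_in_Sigma)
  show "smooth_on UNIV (the_inv_into Sigma_set hsr_ln)"
    by (rule smooth_on_subset[OF smooth_on_hsr_exp]) (simp_all add: eq)
qed (simp_all add: open_Sigma smooth_on_hsr_ln)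

theorem corollary4p5:
  fixes m :: "'h::separable_hilbert_space hsr set"
    and M :: "'h hsr riemannian"
  assumes "subspace m" and "closed m"
    and "lie_triple_system m"
    and "M = induced Sigma_mfd (hsr_exp ` m)"
  shows "riemannian_submanifold M Sigma_mfd
    \<and> closedin (topol Sigma_mfd) (points M)
    \<and> geodesically_convex (points M)"
proof -
  have M: "points M = hsr_exp ` m" "topol M = subtopology (top_of_set Sigma_set) (hsr_exp ` m)"
    "tangent M = tangent_vectors (hsr_exp ` m)"
    "metric M = (\<lambda>p v w. if v \<in> tangent_vectors (hsr_exp ` m) p \<and> w \<in> tangent_vectors (hsr_exp ` m) p
                       then Sigma_metric p v w else 0)"
    by (simp_all add: assms(4) induced_def Sigma_mfd_def cong: if_cong)
  have N: "points Sigma_mfd = Sigma_set" "topol Sigma_mfd = top_of_set Sigma_set" "metric Sigma_mfd = Sigma_metric"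
    by (simp_all add: Sigma_mfd_def)
  have sub: "hsr_exp ` m \<subseteq> Sigma_set" using hsr_exp_in_Sigma by blast
  have "riemannian_submanifold M Sigma_mfd"
    unfolding riemannian_submanifold_def M N
  proof (intro conjI ballI)
    fix p assume p: "p \<in> hsr_exp ` m"
    have "hsr_ln ` (Sigma_set \<inter> hsr_exp ` m) = UNIV \<inter> m"
      unfolding Int_absorb1[OF sub] by (simp add: image_image hsr_ln_exp)
    \<comment> \<open>The logarithm serves as chart around every point at once, with
      \<open>m\<close> itself as the model subspace.\<close>
    then show "\<exists>U V (\<phi> :: 'h hsr \<Rightarrow> 'h hsr) F. p \<in> U \<and> U \<subseteq> Sigma_set \<and> diffeomorphism_on U V \<phi> \<and>
        subspace F \<and> closed F \<and> \<phi> ` (U \<inter> hsr_exp ` m) = V \<inter> F"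
      using p sub diffeomorphism_hsr_ln assms(1,2)
      by (intro exI[of _ Sigma_set] exI[of _ UNIV] exI[of _ hsr_ln] exI[of _ m]) auto
  qed (simp_all add: sub)
  moreover have "closedin (topol Sigma_mfd) (points M)"
    unfolding M N hsr_exp_image_eq
    by (rule continuous_closedin_preimage[OF smooth_on_imp_continuous_on[OF smooth_on_hsr_ln] assms(2)])
  moreover have "geodesically_convex (points M)"
    unfolding M by (rule geodesically_convex_exp[OF assms(1-3)])
  ultimately show ?thesis by blast
qed

end
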